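(* Suppose that $$0<\liminf_{n\to\infty}\alpha_n,\qquad \limsup_{n\to\infty}(1-\beta_n)<1,\qquad \limsup_{n\to\infty}\alpha_n<\liminf_{n\to\infty}(1-\beta_n),$$ and that there exists $\varepsilon>0$ such that for each $t\in\mathbb{R}$ $$G_n(t)=O\bigl((\log n)^{-(1+\varepsilon)}\bigr),\qquad H_n(t)=O\bigl((\log n)^{-(1+\varepsilon)}\bigr),$$ as $n\to\infty$. In addition, assume that $\mathbf{E}|X_1|^{\gamma}<\infty$ for some $\gamma>0$. Then, with the same $\varepsilon$, $$n^{1/2}(\mathbf{E}T_n-\mu_n)=O\bigl((\log n)^{-(1+\varepsilon)}\bigr),$$ $$\frac{\sqrt{\mathrm{Var}(T_n)}}{\sigma_{W,n}/\sqrt n}=1+O\bigl((\log n)^{-(1+\varepsilon)}\bigr),$$ as $n\to\infty$. Moreover, the relations $$\mathbf{P}\Bigl(\frac{\sqrt{n}(T_n-\mu_n)}{\sigma_{W,n}}>x\Bigr)=[1-\Phi(x)](1+o(1)),\qquad \mathbf{P}\Bigl(\frac{\sqrt{n}(T_n-\mu_n)}{\sigma_{W,n}}<-x\Bigr)=\Phi(-x)(1+o(1)),$$ as $n\to\infty$, remain valid, uniformly in the range $-A\le x\le c\sqrt{\log n}$, for each $c>0$ and $A>0$, if in them $\mu_n$ and/or $\sigma_{W,n}$ are replaced by $\mathbf{E}T_n$ and $\sqrt{n\,\mathrm{Var}(T_n)}$ respectively.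
   Context: Let $X_1,X_2,\dots$ be i.i.d. real-valued random variables with common distribution function $F$, and for each $n\ge1$ let $X_{1:n}\le\dots\le X_{n:n}$ be the order statistics of $X_1,\dots,X_n$. Let $F^{-1}(u)=\inf\{x:F(x)\ge u\}$ for $0<u\le1$, $F^{-1}(0)=F^{-1}(0^+)$, be the left-continuous inverse, and write $\xi_\nu=F^{-1}(\nu)$ for $0<\nu<1$. $\Phi$ is the standard normal distribution function. Let $k_n,m_n$ be integer sequences with $0\le k_n<n-m_n\le n$, and put $\alpha_n=k_n/n$, $\beta_n=m_n/n$. Standing assumption: $\min(k_n,m_n)\to\infty$ as $n\to\infty$. The trimmed mean is $T_n=\frac1n\sum_{i=k_n+1}^{n-m_n}X_{i:n}$ (note the normalization by $n$). Under the stated assumptions its expectation and variance are finite for all sufficiently large $n$; the asymptotic statements concern such $n$. Let $W_i^{(n)}$, $i=1,\dots,n$, be $X_i$ Winsorized outside $(\xi_{\alpha_n},\xi_{1-\beta_n}]$: $W_i^{(n)}=\xi_{\alpha_n}$ if $X_i\le\xi_{\alpha_n}$; $W_i^{(n)}=X_i$ if $\xi_{\alpha_n}<X_i\le\xi_{1-\beta_n}$; $W_i^{(n)}=\xi_{1-\beta_n}$ if $X_i>\xi_{1-\beta_n}$. Normalizing sequences: $\mu_n=\int_{\alpha_n}^{1-\beta_n}F^{-1}(s)\,ds$ and $\sigma_{W,n}=\bigl(\mathrm{Var}(W_1^{(n)})\bigr)^{1/2}$. Standing assumption: $\liminf_{n\to\infty}\sigma_{W,n}>0$. Auxiliary functions,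 for $t\in\mathbb{R}$ (for fixed $t$ well-defined for all sufficiently large $n$ under the stated conditions on $\alpha_n,\beta_n$): $$G_n(t)=F^{-1}\Bigl(\alpha_n+t\sqrt{\tfrac{\alpha_n\log n}{n}}\Bigr)-F^{-1}(\alpha_n),\qquad H_n(t)=F^{-1}\Bigl(1-\beta_n+t\sqrt{\tfrac{\beta_n\log n}{n}}\Bigr)-F^{-1}(1-\beta_n).$$ *)

theory Defs
  imports "HOL-Probability.Probability" "HOL-Library.Landau_Symbols"
begin

text \<open>
  The left-continuous inverse, for arguments in [0,1]. It is real-valued here: at the endpoints
  0 and 1, where the mathematical value may be infinite, and outside [0,1], the value is
  unspecified. In the intended use the arguments eventually lie in (0,1), so asymptotic
  statements do not depend on these values.
\<close>
definition quantile :: "(real \<Rightarrow> real) \<Rightarrow> real \<Rightarrow> real" where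
  "quantile F u =
     (if u = 0 then Lim (at_right 0) (\<lambda>v. Inf {x. F x \<ge> v}) else Inf {x. F x \<ge> u})"

text \<open>The \<open>i\<close>-th smallest value (\<open>1 \<le> i \<le> n\<close>) of \<open>X 1, \<dots>, X n\<close>.\<close>
definition order_stat :: "(nat \<Rightarrow> 'a \<Rightarrow> real) \<Rightarrow> nat \<Rightarrow> nat \<Rightarrow> 'a \<Rightarrow> real" where
  "order_stat X n i \<omega> = sort (map (\<lambda>j. X j \<omega>) [1..<n + 1]) ! (i - 1)"

text \<open>The normalisation is by the sample size, not by the number of summands.\<close>
definition trimmed_mean ::
    "(nat \<Rightarrow> 'a \<Rightarrow> real) \<Rightarrow> (nat \<Rightarrow> nat) \<Rightarrow> (nat \<Rightarrow> nat) \<Rightarrow> nat \<Rightarrow> 'a \<Rightarrow> real" where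
  "trimmed_mean X k m n \<omega> = (1 / real n) * (\<Sum>i = k n + 1..n - m n. order_stat X n i \<omega>)"

definition winsorize :: "real \<Rightarrow> real \<Rightarrow> real \<Rightarrow> real" where
  "winsorize a b x = (if x \<le> a then a else if x \<le> b then x else b)"

definition trimmed_centering :: "(real \<Rightarrow> real) \<Rightarrow> real \<Rightarrow> real \<Rightarrow> real" where
  "trimmed_centering F \<alpha> \<beta> = (LBINT s=\<alpha>..1 - \<beta>. quantile F s)"

definition winsorized_sd ::
    "'a measure \<Rightarrow> ('a \<Rightarrow> real) \<Rightarrow> (real \<Rightarrow> real) \<Rightarrow> real \<Rightarrow> real \<Rightarrow> real" where
  "winsorized_sd M Y F \<alpha> \<beta> =
     sqrt (prob_space.variance M
             (\<lambda>\<omega>. winsorize (quantile F \<alpha>) (quantile F (1 - \<beta>)) (Y \<omega>)))"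

definition G_incr :: "(real \<Rightarrow> real) \<Rightarrow> real \<Rightarrow> nat \<Rightarrow> real \<Rightarrow> real" where
  "G_incr F \<alpha> n t = quantile F (\<alpha> + t * sqrt (\<alpha> * ln (real n) / real n)) - quantile F \<alpha>"

definition H_incr :: "(real \<Rightarrow> real) \<Rightarrow> real \<Rightarrow> nat \<Rightarrow> real \<Rightarrow> real" where
  "H_incr F \<beta> n t =
     quantile F (1 - \<beta> + t * sqrt (\<beta> * ln (real n) / real n)) - quantile F (1 - \<beta>)"

abbreviation std_normal_cdf :: "real \<Rightarrow> real"  ("\<Phi>") where
  "\<Phi> \<equiv> cdf std_normal_distribution"

text \<open>\<open>p n x = q x (1 + o(1))\<close> as \<open>n \<rightarrow> \<infinity>\<close>, uniformly in \<open>x \<in> S n\<close>.\<close>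
definition uniform_asymp_equiv ::
    "(nat \<Rightarrow> real set) \<Rightarrow> (nat \<Rightarrow> real \<Rightarrow> real) \<Rightarrow> (real \<Rightarrow> real) \<Rightarrow> bool" where
  "uniform_asymp_equiv S p q \<longleftrightarrow>
     (\<forall>e>0. eventually (\<lambda>n. \<forall>x\<in>S n. \<bar>p n x - q x\<bar> \<le> e * \<bar>q x\<bar>) sequentially)"

end

theory Submission
  imports Defs "HOL-Real_Asymp.Real_Asymp"
begin

text \<open>Write \<open>L(j)\<close> for the sum of the \<open>j\<close> smallest observations. For every \<open>a\<close>,
  \<open>L(j) = j a - (\<Sum>i. (a - X\<^sub>i)\<^sup>+) + R\<close> with \<open>R \<ge> 0\<close>, and for \<open>a\<close> the
  \<open>j/n\<close>-quantile \<open>R\<close> is at most a binomial deviation times the distance from \<open>a\<close> to the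
  \<open>j\<close>-th order statistic. Using this for \<open>j = n - m\<^sub>n\<close> and \<open>j = k\<^sub>n\<close> shows that \<open>n (T\<^sub>n - \<mu>\<^sub>n)\<close> is the centred
  sum of the Winsorized observations plus a difference of two such remainders. Hoeffding's inequality and the
  hypotheses on \<open>G\<^sub>n\<close>, \<open>H\<^sub>n\<close> make the remainders small outside an event of probability
  \<open>O(n powr - r)\<close> for any \<open>r\<close>; on that event the moment assumption bounds the fourth moment of the order statistic
  polynomially. This gives the mean and the variance.

  For the moderate deviations of the Winsorized sum, apply Lindeberg's replacement
  to \<open>s \<mapsto> ((s - t)\<^sup>+)\<^sup>3\<close>, whose third difference is a smoothed indicator. Its Taylor remainder at \<open>s\<close> vanishes
  unless \<open>s\<close> is near or above \<open>t\<close>, so it may be weighted with \<open>exp (\<theta> (s - t))\<close>; the error then carries the factor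
  \<open>exp (- x\<^sup>2 / 2)\<close>, which makes it a relative error, and no tilting of measure or Berry--Esseen theorem is needed.\<close>

subsection \<open>Lindeberg replacement with exponential weights\<close>

text \<open>Two estimates of the remainder are needed. Write L for (log n)^-(1+\<epsilon>). Off an
  exceptional event the remainder in n (T - \<mu>) is at most of order sqrt(n log n) L. After
  division by sqrt n, the range |x| <= c sqrt(log n) costs one more factor sqrt(log n), and log n *
  L tends to 0 because \<epsilon> > 0. This suffices for the tails but would lose sqrt(log n) in
  mean and variance. There the binomial deviation is kept random: its second moment is at most n, so
  the remainder has L2 norm of order sqrt n * L. The law may have atoms, so a quantile is compared
  with strict and non-strict counts. The relative error n^(-1/8) of the Gaussian approximation comes
  from balancing the width of the smoothed indicator against the replacement error; any negative
  power of n would do, since the range of x grows only like sqrt(log n). Sums are handled through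
  powers of the averaging operator of the step law, so the two laws compared never share a
  probability space.\<close>

definition translate_avg :: "real measure \<Rightarrow> (real \<Rightarrow> real) \<Rightarrow> real \<Rightarrow> real" where
  "translate_avg P g s = (\<integral>y. g (s + y) \<partial>P)"

text \<open>A class that contains the truncated cubes and their Taylor coefficients, is integrable
  under every \<open>exp_dist\<close> after any shift, and is preserved by
  \<open>translate_avg\<close>. The rate 1 in the exponent matches the tilts \<theta> <= 1.\<close>

definition exp_growth :: "(real \<Rightarrow> real) \<Rightarrow> bool" where
  "exp_growth g \<longleftrightarrow> g \<in> borel_measurable borel \<and> (\<exists>C. \<forall>s. \<bar>g s\<bar> \<le> C * exp \<bar>s\<bar>)"

lemma exp_growth_measurable: "exp_growth g \<Longrightarrow> g \<in> borel_measurable borel"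
  by (simp add: exp_growth_def)

lemma exp_growthD:
  assumes "exp_growth g"
  shows "\<exists>C\<ge>0. \<forall>s. \<bar>g s\<bar> \<le> C * exp \<bar>s\<bar>"
proof -
  obtain C where C: "\<forall>s. \<bar>g s\<bar> \<le> C * exp \<bar>s\<bar>"
    using assms by (auto simp: exp_growth_def)
  then have "0 \<le> C" using C[rule_format, of 0] by auto
  then show ?thesis using C by blast
qed

text \<open>\<open>g1\<close> and \<open>g2\<close> play the roles of g' and g''/2. They are only
  required to serve as approximating coefficients, so averaging g simply averages them too, and
  nothing is differentiated under an integral.\<close>

definition taylor3 :: "real \<Rightarrow> real \<Rightarrow> (real \<Rightarrow> real) \<Rightarrow> bool" where
  "taylor3 \<theta> c g \<longleftrightarrow> exp_growth g \<and> (\<exists>g1 g2. exp_growth g1 \<and> exp_growth g2 \<and>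
     (\<forall>s y. \<bar>g (s + y) - g s - y * g1 s - y\<^sup>2 * g2 s\<bar> \<le> c * \<bar>y\<bar> ^ 3 * exp (\<theta> * (s + \<bar>y\<bar>))))"

locale exp_dist = prob_space P for P :: "real measure" +
  assumes sets_P [measurable_cong]: "sets P = sets borel"
    and integrable_exp_abs: "integrable P (\<lambda>y. exp \<bar>y\<bar>)"
begin

lemma space_P [simp]: "space P = UNIV"
  using sets_eq_imp_space_eq[OF sets_P] by simp

lemma integrable_shift:
  assumes "exp_growth g"
  shows "integrable P (\<lambda>y. g (s + y))"
proof -
  obtain C where C: "C \<ge> 0" "\<And>s. \<bar>g s\<bar> \<le> C * exp \<bar>s\<bar>" using exp_growthD[OF assms] by auto
  have [measurable]: "g \<in> borel_measurable borel" using assms by (rule exp_growth_measurable)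
  show ?thesis
  proof (rule Bochner_Integration.integrable_bound)
    show "integrable P (\<lambda>y. C * exp \<bar>s\<bar> * exp \<bar>y\<bar>)"
      using integrable_exp_abs by simp
    show "AE y in P. norm (g (s + y)) \<le> norm (C * exp \<bar>s\<bar> * exp \<bar>y\<bar>)"
    proof (rule AE_I2)
      fix y
      have "norm (g (s + y)) \<le> C * exp \<bar>s + y\<bar>" using C(2)[of "s + y"] by simp
      also have "\<dots> \<le> C * exp (\<bar>s\<bar> + \<bar>y\<bar>)" using C(1) by (intro mult_left_mono) auto
      finally show "norm (g (s + y)) \<le> norm (C * exp \<bar>s\<bar> * exp \<bar>y\<bar>)"
        using C(1) by (simp add: exp_add)
    qed
  qed simp
qed

lemma exp_growth_avg:
  assumes "exp_growth g"
  shows "exp_growth (translate_avg P g)"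
proof -
  obtain C where C: "C \<ge> 0" "\<And>s. \<bar>g s\<bar> \<le> C * exp \<bar>s\<bar>" using exp_growthD[OF assms] by auto
  have [measurable]: "g \<in> borel_measurable borel" using assms by (rule exp_growth_measurable)
  have "translate_avg P g \<in> borel_measurable borel"
    unfolding translate_avg_def by measurable
  moreover have "\<bar>translate_avg P g s\<bar> \<le> (C * expectation (\<lambda>y. exp \<bar>y\<bar>)) * exp \<bar>s\<bar>" for s
  proof -
    have "\<bar>translate_avg P g s\<bar> \<le> (\<integral>y. C * exp \<bar>s\<bar> * exp \<bar>y\<bar> \<partial>P)"
      unfolding translate_avg_def
    proof (rule integral_abs_bound[THEN order_trans], rule integral_mono)
      fix y
      have "\<bar>g (s + y)\<bar> \<le> C * exp \<bar>s + y\<bar>" using C(2) by simp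
      also have "\<dots> \<le> C * exp (\<bar>s\<bar> + \<bar>y\<bar>)" using C(1) by (intro mult_left_mono) auto
      finally show "\<bar>g (s + y)\<bar> \<le> C * exp \<bar>s\<bar> * exp \<bar>y\<bar>" by (simp add: exp_add)
    qed (use integrable_shift[OF assms] integrable_exp_abs in auto)
    then show ?thesis by (simp add: mult_ac)
  qed
  ultimately show ?thesis unfolding exp_growth_def by blast
qed

lemma exp_growth_avg_funpow: "exp_growth g \<Longrightarrow> exp_growth ((translate_avg P ^^ n) g)"
  by (induction n) (auto intro: exp_growth_avg)

lemma integrable_exp:
  assumes "0 \<le> \<theta>" "\<theta> \<le> 1"
  shows "integrable P (\<lambda>y. exp (\<theta> * y))"
proof (rule Bochner_Integration.integrable_bound[OF integrable_exp_abs])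
  show "AE y in P. norm (exp (\<theta> * y)) \<le> norm (exp \<bar>y\<bar>)"
  proof (rule AE_I2)
    fix y :: real
    have "\<theta> * y \<le> \<theta> * \<bar>y\<bar>" using assms by (intro mult_left_mono) auto
    also have "\<dots> \<le> 1 * \<bar>y\<bar>" using assms by (intro mult_right_mono) auto
    finally show "norm (exp (\<theta> * y)) \<le> norm (exp \<bar>y\<bar>)" by simp
  qed
qed simp

text \<open>The expansion at \<open>s + z\<close> is averaged over z. The weight factorises, so the
  only price is the moment generating function at \<theta>; n iterations cost L^n.\<close>

lemma taylor3_avg:
  assumes g: "taylor3 \<theta> c g" and \<theta>: "0 \<le> \<theta>" "\<theta> \<le> 1" and c: "c \<ge> 0"
    and L: "expectation (\<lambda>z. exp (\<theta> * z)) \<le> L"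
  shows "taylor3 \<theta> (c * L) (translate_avg P g)"
proof -
  obtain g1 g2 where gr: "exp_growth g" "exp_growth g1" "exp_growth g2"
    and b: "\<And>s y. \<bar>g (s + y) - g s - y * g1 s - y\<^sup>2 * g2 s\<bar> \<le> c * \<bar>y\<bar> ^ 3 * exp (\<theta> * (s + \<bar>y\<bar>))"
    using g unfolding taylor3_def by auto
  note int = integrable_shift[OF gr(1)] integrable_shift[OF gr(2)] integrable_shift[OF gr(3)]
  have "\<bar>translate_avg P g (s + y) - translate_avg P g s - y * translate_avg P g1 s
      - y\<^sup>2 * translate_avg P g2 s\<bar> \<le> c * L * \<bar>y\<bar> ^ 3 * exp (\<theta> * (s + \<bar>y\<bar>))" for s y
  proof -
    let ?r = "\<lambda>z. g (s + y + z) - g (s + z) - y * g1 (s + z) - y\<^sup>2 * g2 (s + z)"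
    have expand: "translate_avg P g (s + y) - translate_avg P g s - y * translate_avg P g1 s
      - y\<^sup>2 * translate_avg P g2 s = (\<integral>z. ?r z \<partial>P)"
      unfolding translate_avg_def using int by simp
    have "\<bar>\<integral>z. ?r z \<partial>P\<bar> \<le> (\<integral>z. c * \<bar>y\<bar> ^ 3 * exp (\<theta> * (s + \<bar>y\<bar>)) * exp (\<theta> * z) \<partial>P)"
    proof (rule integral_abs_bound[THEN order_trans], rule integral_mono)
      show "integrable P (\<lambda>z. \<bar>?r z\<bar>)" using int by simp
      show "integrable P (\<lambda>z. c * \<bar>y\<bar> ^ 3 * exp (\<theta> * (s + \<bar>y\<bar>)) * exp (\<theta> * z))"
        using integrable_exp[OF \<theta>] by simp
      fix z
      have "\<bar>?r z\<bar> \<le> c * \<bar>y\<bar> ^ 3 * exp (\<theta> * (s + z + \<bar>y\<bar>))"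
        using b[of "s + z" y] by (simp only: add.assoc add.commute[of z y])
      moreover have "exp (\<theta> * (s + z + \<bar>y\<bar>)) = exp (\<theta> * (s + \<bar>y\<bar>)) * exp (\<theta> * z)"
        by (simp add: distrib_left exp_add)
      ultimately show "\<bar>?r z\<bar> \<le> c * \<bar>y\<bar> ^ 3 * exp (\<theta> * (s + \<bar>y\<bar>)) * exp (\<theta> * z)"
        by (simp only: mult.assoc)
    qed
    also have "\<dots> = c * \<bar>y\<bar> ^ 3 * exp (\<theta> * (s + \<bar>y\<bar>)) * expectation (\<lambda>z. exp (\<theta> * z))"
      by simp
    also have "\<dots> \<le> c * \<bar>y\<bar> ^ 3 * exp (\<theta> * (s + \<bar>y\<bar>)) * L"
      using c L by (intro mult_left_mono) auto
    finally show ?thesis unfolding expand by (simp only: mult_ac)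
  qed
  then show ?thesis
    unfolding taylor3_def using gr[THEN exp_growth_avg] by blast
qed

lemma taylor3_avg_funpow:
  assumes g: "taylor3 \<theta> c g" and \<theta>: "0 \<le> \<theta>" "\<theta> \<le> 1" and c: "c \<ge> 0"
    and L: "expectation (\<lambda>z. exp (\<theta> * z)) \<le> L" "0 \<le> L"
  shows "taylor3 \<theta> (c * L ^ n) ((translate_avg P ^^ n) g)"
proof (induction n)
  case (Suc n)
  have "taylor3 \<theta> (c * L ^ n * L) (translate_avg P ((translate_avg P ^^ n) g))"
    using taylor3_avg[OF Suc \<theta>] c L by simp
  then show ?case by (simp only: funpow.simps o_apply power_Suc2 mult.assoc)
qed (use g in simp)

text \<open>The linear term disappears because the mean is zero, and the quadratic one depends on
  the law only through v. Two laws with the same variance thus have the same main term, which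
  cancels in the swap.\<close>

lemma avg_taylor3:
  assumes b: "\<And>y. \<bar>g (s + y) - g s - y * d1 - y\<^sup>2 * d2\<bar> \<le> c * \<bar>y\<bar> ^ 3 * exp (\<theta> * (s + \<bar>y\<bar>))"
    and g: "exp_growth g" and c: "c \<ge> 0"
    and m1: "integrable P (\<lambda>y. y)" "expectation (\<lambda>y. y) = 0"
    and m2: "integrable P (\<lambda>y. y\<^sup>2)" "expectation (\<lambda>y. y\<^sup>2) = v"
    and m3: "integrable P (\<lambda>y. \<bar>y\<bar> ^ 3 * exp (\<theta> * \<bar>y\<bar>))"
      "expectation (\<lambda>y. \<bar>y\<bar> ^ 3 * exp (\<theta> * \<bar>y\<bar>)) \<le> B"
  shows "\<bar>translate_avg P g s - g s - v * d2\<bar> \<le> c * B * exp (\<theta> * s)"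
proof -
  note int = integrable_shift[OF g, of s] m1(1) m2(1)
  have exp_weight: "exp (\<theta> * (s + \<bar>y\<bar>)) = exp (\<theta> * s) * exp (\<theta> * \<bar>y\<bar>)" for y
    by (simp add: distrib_left exp_add)
  have expand: "translate_avg P g s - g s - v * d2 = (\<integral>y. g (s + y) - g s - y * d1 - y\<^sup>2 * d2 \<partial>P)"
    unfolding translate_avg_def using int m1 m2 prob_space by simp
  have "\<bar>\<integral>y. g (s + y) - g s - y * d1 - y\<^sup>2 * d2 \<partial>P\<bar> \<le> (\<integral>y. c * exp (\<theta> * s) * (\<bar>y\<bar> ^ 3 * exp (\<theta> * \<bar>y\<bar>)) \<partial>P)"
  proof (rule integral_abs_bound[THEN order_trans], rule integral_mono)
    show "integrable P (\<lambda>y. \<bar>g (s + y) - g s - y * d1 - y\<^sup>2 * d2\<bar>)" using int by simp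
    show "integrable P (\<lambda>y. c * exp (\<theta> * s) * (\<bar>y\<bar> ^ 3 * exp (\<theta> * \<bar>y\<bar>)))" using m3(1) by simp
    show "\<bar>g (s + y) - g s - y * d1 - y\<^sup>2 * d2\<bar> \<le> c * exp (\<theta> * s) * (\<bar>y\<bar> ^ 3 * exp (\<theta> * \<bar>y\<bar>))" for y
      using b[of y] by (simp only: exp_weight mult_ac)
  qed
  also have "\<dots> = c * exp (\<theta> * s) * expectation (\<lambda>y. \<bar>y\<bar> ^ 3 * exp (\<theta> * \<bar>y\<bar>))" by simp
  also have "\<dots> \<le> c * exp (\<theta> * s) * B" using c m3(2) by (intro mult_left_mono) auto
  finally show ?thesis unfolding expand by (simp only: mult_ac)
qed

end

text \<open>Lindeberg replacement; the exponential weight carries Chernoff's bound through it.\<close>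

lemma lindeberg_swap:
  fixes P Q :: "real measure"
  assumes P: "exp_dist P" and Q: "exp_dist Q"
    and g: "taylor3 \<theta> c g" and \<theta>: "0 \<le> \<theta>" "\<theta> \<le> 1" and c: "c \<ge> 0" and B: "B \<ge> 0"
    and L: "(\<integral>z. exp (\<theta> * z) \<partial>P) \<le> L" "(\<integral>z. exp (\<theta> * z) \<partial>Q) \<le> L" "1 \<le> L"
    and m: "\<And>R. R \<in> {P, Q} \<Longrightarrow> integrable R (\<lambda>y. y) \<and> (\<integral>y. y \<partial>R) = 0
      \<and> integrable R (\<lambda>y. y\<^sup>2) \<and> (\<integral>y. y\<^sup>2 \<partial>R) = v
      \<and> integrable R (\<lambda>y. \<bar>y\<bar> ^ 3 * exp (\<theta> * \<bar>y\<bar>)) \<and> (\<integral>y. \<bar>y\<bar> ^ 3 * exp (\<theta> * \<bar>y\<bar>) \<partial>R) \<le> B"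
  shows "\<bar>(translate_avg P ^^ n) g s - (translate_avg Q ^^ n) g s\<bar>
    \<le> real n * (2 * c * B * L ^ n) * exp (\<theta> * s)"
proof (induction n arbitrary: s)
  case (Suc n)
  interpret P: exp_dist P by (rule P)
  interpret Q: exp_dist Q by (rule Q)
  define f where "f = (translate_avg P ^^ n) g"
  define h where "h = (translate_avg Q ^^ n) g"
  have eg: "exp_growth g" using g by (simp add: taylor3_def)
  have ef: "exp_growth f" and eh: "exp_growth h"
    unfolding f_def h_def using eg by (auto intro: P.exp_growth_avg_funpow Q.exp_growth_avg_funpow)
  have L0: "0 \<le> L" using L(3) by simp
  have "taylor3 \<theta> (c * L ^ n) h"
    unfolding h_def using Q.taylor3_avg_funpow[OF g \<theta> c L(2) L0] .
  then obtain h1 h2 where hb: "\<And>s y. \<bar>h (s + y) - h s - y * h1 s - y\<^sup>2 * h2 s\<bar>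
      \<le> (c * L ^ n) * \<bar>y\<bar> ^ 3 * exp (\<theta> * (s + \<bar>y\<bar>))"
    unfolding taylor3_def by auto
  have cL: "0 \<le> c * L ^ n" using c L0 by simp
  have p: "\<bar>translate_avg P h s - h s - v * h2 s\<bar> \<le> (c * L ^ n) * B * exp (\<theta> * s)"
    using m[of P] by (intro P.avg_taylor3[OF hb eh cL]) auto
  have q: "\<bar>translate_avg Q h s - h s - v * h2 s\<bar> \<le> (c * L ^ n) * B * exp (\<theta> * s)"
    using m[of Q] by (intro Q.avg_taylor3[OF hb eh cL]) auto
  have pq: "\<bar>translate_avg P h s - translate_avg Q h s\<bar> \<le> 2 * ((c * L ^ n) * B * exp (\<theta> * s))"
    using p q by linarith
  \<comment> \<open>The swap telescopes: P^(n+1) - Q^(n+1) = P (P^n - Q^n) + (P - Q) Q^n.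
    \<open>pq\<close> bounds the second term; the induction hypothesis, averaged over P, bounds the
    first at the cost of one more factor L.\<close>
  let ?K = "real n * (2 * c * B * L ^ n)"
  have K0: "0 \<le> ?K" using c B L0 by simp
  have "\<bar>translate_avg P f s - translate_avg P h s\<bar> = \<bar>\<integral>y. f (s + y) - h (s + y) \<partial>P\<bar>"
    unfolding translate_avg_def using P.integrable_shift[OF ef] P.integrable_shift[OF eh] by simp
  also have "\<dots> \<le> (\<integral>y. ?K * exp (\<theta> * s) * exp (\<theta> * y) \<partial>P)"
  proof (rule integral_abs_bound[THEN order_trans], rule integral_mono)
    show "integrable P (\<lambda>y. \<bar>f (s + y) - h (s + y)\<bar>)"
      using P.integrable_shift[OF ef] P.integrable_shift[OF eh] by simp
    show "integrable P (\<lambda>y. ?K * exp (\<theta> * s) * exp (\<theta> * y))"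
      using P.integrable_exp[OF \<theta>] by simp
    show "\<bar>f (s + y) - h (s + y)\<bar> \<le> ?K * exp (\<theta> * s) * exp (\<theta> * y)" for y
      using Suc[of "s + y"] unfolding f_def h_def distrib_left exp_add
      by (simp only: mult.assoc)
  qed
  also have "\<dots> = ?K * exp (\<theta> * s) * (\<integral>y. exp (\<theta> * y) \<partial>P)" by simp
  also have "\<dots> \<le> ?K * exp (\<theta> * s) * L" using K0 L(1) by (intro mult_left_mono) auto
  also have "\<dots> = real n * (2 * c * B * L ^ Suc n) * exp (\<theta> * s)" by simp
  finally have 1: "\<bar>translate_avg P f s - translate_avg P h s\<bar> \<le> real n * (2 * c * B * L ^ Suc n) * exp (\<theta> * s)" .
  have "2 * ((c * L ^ n) * B * exp (\<theta> * s)) \<le> 2 * ((c * L ^ Suc n) * B * exp (\<theta> * s))"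
    using c B power_increasing[of n "Suc n" L] L(3) by (intro mult_left_mono mult_right_mono) auto
  then have "\<bar>translate_avg P f s - translate_avg Q h s\<bar>
      \<le> real n * (2 * c * B * L ^ Suc n) * exp (\<theta> * s) + 2 * ((c * L ^ Suc n) * B * exp (\<theta> * s))"
    using 1 pq by linarith
  then show ?case unfolding f_def h_def by (simp add: algebra_simps)
qed simp

text \<open>The second derivative \<open>6 * max 0 u\<close> is Lipschitz with constant 6, which
  gives the remainder |y|^3. If u + |y| <= 0, both points lie where the function vanishes and no
  remainder is left.\<close>

lemma cube_pos_part_taylor:
  fixes u y :: real
  shows "\<bar>(max 0 (u + y)) ^ 3 - (max 0 u) ^ 3 - y * (3 * (max 0 u)\<^sup>2) - y\<^sup>2 * (3 * max 0 u)\<bar>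
    \<le> (if 0 < u + \<bar>y\<bar> then \<bar>y\<bar> ^ 3 else 0)"
proof (cases "0 \<le> u")
  case u: True
  show ?thesis
  proof (cases "0 \<le> u + y")
    case True
    have e: "(u + y) ^ 3 - u ^ 3 - y * (3 * u\<^sup>2) - y\<^sup>2 * (3 * u) = y ^ 3"
      by (simp add: power3_eq_cube power2_eq_square algebra_simps)
    show ?thesis
    proof (cases "0 < u + \<bar>y\<bar>")
      case True then show ?thesis using u \<open>0 \<le> u + y\<close> e by (simp add: max_def power_abs)
    next
      case False then show ?thesis using u by auto
    qed
  next
    case False
    have e: "- (u ^ 3) - y * (3 * u\<^sup>2) - y\<^sup>2 * (3 * u) = (- (u + y)) ^ 3 - (- y) ^ 3"
      by (simp add: power3_eq_cube power2_eq_square algebra_simps)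
    have "(- (u + y)) ^ 3 \<le> (- y) ^ 3" "0 \<le> (- (u + y)) ^ 3"
      using False u by (auto intro!: power_mono zero_le_power simp del: power_minus_odd)
    then have "\<bar>(- (u + y)) ^ 3 - (- y) ^ 3\<bar> \<le> \<bar>y\<bar> ^ 3" using False u by (simp del: power_minus_odd)
    then show ?thesis using False u e by (simp add: max_def del: power_minus_odd)
  qed
next
  case u: False
  show ?thesis
  proof (cases "0 \<le> u + y")
    case True
    have "(u + y) ^ 3 \<le> \<bar>y\<bar> ^ 3" using True u by (intro power_mono) auto
    moreover have "0 \<le> (u + y) ^ 3" using True by simp
    ultimately show ?thesis using u True by (auto simp: max_def)
  qed (use u in \<open>auto simp: max_def\<close>)
qed

lemma power_le_fact_exp:
  fixes x :: real
  assumes "0 \<le> x"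
  shows "x ^ k \<le> fact k * exp x"
proof -
  have "x ^ k / fact k = (\<Sum>i\<in>{k}. inverse (fact i) * x ^ i)" by (simp add: field_simps)
  also have "\<dots> \<le> (\<Sum>i. inverse (fact i) * x ^ i)"
    using assms by (intro sum_le_suminf) (auto intro: summable_exp)
  also have "\<dots> = exp x" by (simp add: exp_def divide_inverse_commute)
  finally show ?thesis by (simp add: field_simps)
qed

lemma exp_growth_pos_part_power:
  "exp_growth (\<lambda>s. a * (max 0 (s - t)) ^ k)"
proof -
  have "\<bar>a * (max 0 (s - t)) ^ k\<bar> \<le> (\<bar>a\<bar> * fact k * exp \<bar>t\<bar>) * exp \<bar>s\<bar>" for s
  proof -
    let ?u = "max 0 (s - t)"
    have "?u ^ k \<le> fact k * exp ?u" by (rule power_le_fact_exp) simp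
    also have "\<dots> \<le> fact k * exp (\<bar>t\<bar> + \<bar>s\<bar>)" by (intro mult_left_mono) auto
    finally have "\<bar>a\<bar> * ?u ^ k \<le> \<bar>a\<bar> * (fact k * exp (\<bar>t\<bar> + \<bar>s\<bar>))" by (intro mult_left_mono) auto
    then show ?thesis by (simp add: abs_mult exp_add mult_ac)
  qed
  then show ?thesis unfolding exp_growth_def by (intro conjI exI allI) auto
qed

lemma taylor3_cube_pos_part:
  assumes "0 \<le> \<theta>"
  shows "taylor3 \<theta> (exp (- \<theta> * t)) (\<lambda>s. (max 0 (s - t)) ^ 3)"
proof -
  have "\<bar>(max 0 (s + y - t)) ^ 3 - (max 0 (s - t)) ^ 3 - y * (3 * (max 0 (s - t))\<^sup>2) - y\<^sup>2 * (3 * max 0 (s - t))\<bar>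
    \<le> exp (- \<theta> * t) * \<bar>y\<bar> ^ 3 * exp (\<theta> * (s + \<bar>y\<bar>))" for s y
  proof -
    have "(if 0 < s - t + \<bar>y\<bar> then \<bar>y\<bar> ^ 3 else 0) \<le> \<bar>y\<bar> ^ 3 * exp (\<theta> * (s - t + \<bar>y\<bar>))"
      using assms by (auto simp: mult_le_cancel_left1)
    also have "\<dots> = exp (- \<theta> * t) * \<bar>y\<bar> ^ 3 * exp (\<theta> * (s + \<bar>y\<bar>))"
      by (simp add: exp_add[symmetric] algebra_simps)
    finally show ?thesis using cube_pos_part_taylor[of "s - t" y] by (simp add: algebra_simps)
  qed
  then show ?thesis
    unfolding taylor3_def
    using exp_growth_pos_part_power[of 1 t 3] exp_growth_pos_part_power[of 3 t 2]
      exp_growth_pos_part_power[of 3 t 1]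
    by (intro conjI exI[of _ "\<lambda>s. 3 * (max 0 (s - t))\<^sup>2"] exI[of _ "\<lambda>s. 3 * max 0 (s - t)"]) simp_all
qed

section \<open>Sums of independent variables as operator powers\<close>

lemma exp_dist_convolution:
  assumes "exp_dist P" "exp_dist Q"
  shows "exp_dist (P \<star> Q)"
proof -
  interpret P: exp_dist P by fact
  interpret Q: exp_dist Q by fact
  interpret PQ: pair_prob_space P Q ..
  interpret conv: prob_space "P \<star> Q"
    unfolding convolution_def by (rule PQ.prob_space_distr) measurable
  have "integrable (P \<Otimes>\<^sub>M Q) (\<lambda>(x, y). exp \<bar>x\<bar> * exp \<bar>y\<bar>)"
    using P.integrable_exp_abs Q.integrable_exp_abs by (intro PQ.Fubini_integrable) simp_all
  then have "integrable (P \<Otimes>\<^sub>M Q) (\<lambda>(x, y). exp \<bar>x + y\<bar>)"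
    by (rule Bochner_Integration.integrable_bound) (auto simp: exp_add[symmetric])
  then have "integrable (P \<star> Q) (\<lambda>x. exp \<bar>x\<bar>)"
    unfolding convolution_def by (subst integrable_distr_eq) (auto simp: case_prod_unfold)
  then show ?thesis by unfold_locales auto
qed

lemma translate_avg_convolution:
  assumes P: "exp_dist P" and Q: "exp_dist Q" and g: "exp_growth g"
  shows "translate_avg (P \<star> Q) g = translate_avg P (translate_avg Q g)"
proof
  fix s
  interpret P: exp_dist P by fact
  interpret Q: exp_dist Q by fact
  interpret PQ: pair_prob_space P Q ..
  have [measurable]: "g \<in> borel_measurable borel" using g by (rule exp_growth_measurable)
  have int: "integrable (P \<Otimes>\<^sub>M Q) (\<lambda>(x, y). g (s + (x + y)))"
    using exp_dist.integrable_shift[OF exp_dist_convolution[OF P Q] g, of s]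
    unfolding convolution_def by (subst (asm) integrable_distr_eq) (auto simp: case_prod_unfold)
  have "translate_avg (P \<star> Q) g s = (\<integral>z. g (s + (fst z + snd z)) \<partial>(P \<Otimes>\<^sub>M Q))"
    unfolding translate_avg_def convolution_def by (subst integral_distr) (auto simp: case_prod_unfold)
  also have "\<dots> = (\<integral>x. (\<integral>y. g (s + (x + y)) \<partial>Q) \<partial>P)"
    using PQ.integral_fst'[OF int] by (simp add: case_prod_unfold)
  also have "\<dots> = translate_avg P (translate_avg Q g) s"
    unfolding translate_avg_def by (simp add: add.assoc)
  finally show "translate_avg (P \<star> Q) g s = translate_avg P (translate_avg Q g) s" .
qed

text \<open>Makes the operator estimates applicable to random variables: the empty sum is the point
  mass at 0, and each further independent summand convolves the law with P.\<close>

lemma (in prob_space) translate_avg_sum: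
  assumes I: "finite I" and indep: "indep_vars (\<lambda>_. borel) Y I" and P: "exp_dist P"
    and distr: "\<And>i. i \<in> I \<Longrightarrow> distr M borel (Y i) = P" and g: "exp_growth g"
  shows "exp_dist (distr M borel (\<lambda>\<omega>. \<Sum>i\<in>I. Y i \<omega>))"
    and "translate_avg (distr M borel (\<lambda>\<omega>. \<Sum>i\<in>I. Y i \<omega>)) g = (translate_avg P ^^ card I) g"
proof -
  have "exp_dist (distr M borel (\<lambda>\<omega>. \<Sum>i\<in>I. Y i \<omega>)) \<and>
    translate_avg (distr M borel (\<lambda>\<omega>. \<Sum>i\<in>I. Y i \<omega>)) g = (translate_avg P ^^ card I) g"
    using I indep distr
  proof (induction I)
    case empty
    interpret D: prob_space "distr M borel (\<lambda>\<omega>. 0::real)" by (rule prob_space_distr) simp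
    have [measurable]: "g \<in> borel_measurable borel" using g by (rule exp_growth_measurable)
    have "integrable (distr M borel (\<lambda>\<omega>. 0::real)) (\<lambda>y. exp \<bar>y\<bar>)"
      by (subst integrable_distr_eq) auto
    then have "exp_dist (distr M borel (\<lambda>\<omega>. 0::real))" by unfold_locales auto
    moreover have "translate_avg (distr M borel (\<lambda>\<omega>. 0::real)) g = g"
      unfolding translate_avg_def by (subst integral_distr) (auto simp: prob_space)
    ultimately show ?case by simp
  next
    case (insert i I)
    let ?D = "distr M borel (\<lambda>\<omega>. \<Sum>i\<in>I. Y i \<omega>)"
    have IH: "exp_dist ?D" "translate_avg ?D g = (translate_avg P ^^ card I) g"
      using insert indep_vars_subset[OF insert(4)] by auto
    have rv: "random_variable borel (Y j)" if "j \<in> insert i I" for j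
      using insert(4) that unfolding indep_vars_def by auto
    have "distr M borel (\<lambda>\<omega>. Y i \<omega> + (\<Sum>i\<in>I. Y i \<omega>)) = (distr M borel (Y i) \<star> ?D)"
      by (intro sum_indep_random_variable indep_vars_sum insert rv borel_measurable_sum) auto
    then have eq: "distr M borel (\<lambda>\<omega>. \<Sum>i\<in>insert i I. Y i \<omega>) = (P \<star> ?D)"
      using insert by simp
    show ?case unfolding eq
      using exp_dist_convolution[OF P IH(1)] translate_avg_convolution[OF P IH(1) g] IH(2) insert(1,2)
      by simp
  qed
  then show "exp_dist (distr M borel (\<lambda>\<omega>. \<Sum>i\<in>I. Y i \<omega>))"
    and "translate_avg (distr M borel (\<lambda>\<omega>. \<Sum>i\<in>I. Y i \<omega>)) g = (translate_avg P ^^ card I) g" by auto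
qed

section \<open>Moments and convolution powers of the standard normal law\<close>

lemma std_normal_mgf:
  "integrable std_normal_distribution (\<lambda>z. exp (a * z))"
  "(\<integral>z. exp (a * z) \<partial>std_normal_distribution) = exp (a\<^sup>2 / 2)"
proof -
  have eq: "std_normal_density x * exp (a * x) = exp (a\<^sup>2 / 2) * normal_density a 1 x" for x :: real
  proof -
    have "- x\<^sup>2 / 2 + a * x = a\<^sup>2 / 2 + - (x - a)\<^sup>2 / 2"
      by (simp add: power2_diff field_simps)
    then have "exp (- x\<^sup>2 / 2) * exp (a * x) = exp (a\<^sup>2 / 2) * exp (- (x - a)\<^sup>2 / 2)"
      by (simp only: exp_add[symmetric])
    then show ?thesis by (simp add: normal_density_def)
  qed
  show "integrable std_normal_distribution (\<lambda>z. exp (a * z))"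
    by (subst integrable_density) (simp_all add: eq)
  show "(\<integral>z. exp (a * z) \<partial>std_normal_distribution) = exp (a\<^sup>2 / 2)"
    by (subst integral_density) (simp_all add: eq)
qed

lemma integrable_std_normal_exp_abs:
  "integrable std_normal_distribution (\<lambda>z. exp (a * \<bar>z\<bar>))"
proof (rule Bochner_Integration.integrable_bound)
  show "integrable std_normal_distribution (\<lambda>z. exp (a * z) + exp ((- a) * z))"
    by (intro Bochner_Integration.integrable_add std_normal_mgf)
  show "AE x in std_normal_distribution. norm (exp (a * \<bar>x\<bar>)) \<le> norm (exp (a * x) + exp (- a * x))"
  proof (rule AE_I2)
    fix x
    have "0 \<le> exp (a * x) + exp (- a * x)" by (intro add_nonneg_nonneg) auto
    then have "norm (exp (a * x) + exp (- a * x)) = exp (a * x) + exp (- a * x)" by simp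
    then show "norm (exp (a * \<bar>x\<bar>)) \<le> norm (exp (a * x) + exp (- a * x))"
      by (cases "0 \<le> x") simp_all
  qed
qed simp

lemma exp_dist_std_normal: "exp_dist std_normal_distribution"
proof -
  interpret prob_space std_normal_distribution by (rule prob_space_normal_density) simp
  show ?thesis using integrable_std_normal_exp_abs[of 1] by unfold_locales simp_all
qed

lemma cube_le_exp: "0 \<le> x \<Longrightarrow> x ^ 3 \<le> 6 * exp x" for x :: real
  using power_le_fact_exp[of x 3] by (simp add: fact_numeral)

text \<open>Crude but explicit: |z|^3 <= 6 exp |z| and exp (2 |z|) <= exp (2 z) + exp (- 2 z), where
  each of the two last exponentials has mean exp 2.\<close>

lemma std_normal_exp_third_moment:
  assumes "0 \<le> \<theta>" "\<theta> \<le> 1"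
  shows "integrable std_normal_distribution (\<lambda>z. \<bar>z\<bar> ^ 3 * exp (\<theta> * \<bar>z\<bar>))"
    and "(\<integral>z. \<bar>z\<bar> ^ 3 * exp (\<theta> * \<bar>z\<bar>) \<partial>std_normal_distribution) \<le> 12 * exp 2"
proof -
  have bound: "\<bar>z\<bar> ^ 3 * exp (\<theta> * \<bar>z\<bar>) \<le> 6 * (exp (2 * z) + exp ((- 2) * z))" for z :: real
  proof -
    have "\<theta> * \<bar>z\<bar> \<le> 1 * \<bar>z\<bar>" using assms by (intro mult_right_mono) auto
    then have "\<bar>z\<bar> ^ 3 * exp (\<theta> * \<bar>z\<bar>) \<le> (6 * exp \<bar>z\<bar>) * exp \<bar>z\<bar>"
      using cube_le_exp[of "\<bar>z\<bar>"] by (intro mult_mono) auto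
    also have "\<dots> = 6 * exp (2 * \<bar>z\<bar>)" by (simp add: exp_add[symmetric])
    also have "\<dots> \<le> 6 * (exp (2 * z) + exp ((- 2) * z))" by (auto simp: abs_if)
    finally show ?thesis .
  qed
  have int: "integrable std_normal_distribution (\<lambda>z. 6 * (exp (2 * z) + exp ((- 2) * z)))"
    by (intro integrable_mult_right Bochner_Integration.integrable_add std_normal_mgf)
  show int3: "integrable std_normal_distribution (\<lambda>z. \<bar>z\<bar> ^ 3 * exp (\<theta> * \<bar>z\<bar>))"
  proof (rule Bochner_Integration.integrable_bound[OF int])
    show "AE z in std_normal_distribution. norm (\<bar>z\<bar> ^ 3 * exp (\<theta> * \<bar>z\<bar>))
        \<le> norm (6 * (exp (2 * z) + exp ((- 2) * z)))"
    proof (rule AE_I2)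
      fix z :: real
      have "norm (\<bar>z\<bar> ^ 3 * exp (\<theta> * \<bar>z\<bar>)) = \<bar>z\<bar> ^ 3 * exp (\<theta> * \<bar>z\<bar>)" by simp
      also note bound[of z]
      also have "6 * (exp (2 * z) + exp ((- 2) * z)) \<le> norm (6 * (exp (2 * z) + exp ((- 2) * z)))" by simp
      finally show "norm (\<bar>z\<bar> ^ 3 * exp (\<theta> * \<bar>z\<bar>)) \<le> norm (6 * (exp (2 * z) + exp ((- 2) * z)))" .
    qed
  qed simp
  have "(\<integral>z. \<bar>z\<bar> ^ 3 * exp (\<theta> * \<bar>z\<bar>) \<partial>std_normal_distribution)
      \<le> (\<integral>z. 6 * (exp (2 * z) + exp ((- 2) * z)) \<partial>std_normal_distribution)"
    by (rule integral_mono[OF int3 int bound])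
  also have "\<dots> = 12 * exp 2"
    using std_normal_mgf[of 2] std_normal_mgf[of "- 2"] by simp
  finally show "(\<integral>z. \<bar>z\<bar> ^ 3 * exp (\<theta> * \<bar>z\<bar>) \<partial>std_normal_distribution) \<le> 12 * exp 2" .
qed

lemma std_normal_moments:
  "integrable std_normal_distribution (\<lambda>y. y)" "(\<integral>y. y \<partial>std_normal_distribution) = 0"
  "integrable std_normal_distribution (\<lambda>y. y\<^sup>2)" "(\<integral>y. y\<^sup>2 \<partial>std_normal_distribution) = 1"
proof -
  show "integrable std_normal_distribution (\<lambda>y. y)"
    using integrable_std_normal_distribution_moment[of 1] by simp
  show "(\<integral>y. y \<partial>std_normal_distribution) = 0"
    using integral_std_normal_moment_odd[of 0] by (subst integral_density) simp_all
  show "integrable std_normal_distribution (\<lambda>y. y\<^sup>2)"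
    using integrable_std_normal_distribution_moment[of 2] by simp
  show "(\<integral>y. y\<^sup>2 \<partial>std_normal_distribution) = 1"
    using std_normal_distribution_even_moments(1)[of 1] by simp
qed

lemma distr_std_normal_scale:
  assumes "0 < a"
  shows "distr std_normal_distribution borel (\<lambda>z. a * z) = density lborel (normal_density 0 a)"
proof -
  interpret prob_space std_normal_distribution by (rule prob_space_normal_density) simp
  have "distributed std_normal_distribution lborel (\<lambda>x. x) std_normal_density"
    by (auto simp: distributed_def intro!: measure_eqI simp: emeasure_distr)
  then have "distributed std_normal_distribution lborel (\<lambda>x. 0 + a * x) (normal_density (0 + a * 0) (\<bar>a\<bar> * 1))"
    using assms by (intro normal_density_affine) auto
  then show ?thesis using assms
    by (auto simp: distributed_def cong: distr_cong)
qed

lemma translate_avg_std_normal_funpow: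
  assumes "n > 0" and g: "exp_growth g"
  shows "(translate_avg std_normal_distribution ^^ n) g s = (\<integral>z. g (s + sqrt (real n) * z) \<partial>std_normal_distribution)"
proof -
  interpret N: exp_dist std_normal_distribution by (rule exp_dist_std_normal)
  have [measurable]: "g \<in> borel_measurable borel" using g by (rule exp_growth_measurable)
  \<comment> \<open>The induction runs over \<open>Suc n\<close> because a normal density with
    standard deviation 0 cannot serve as a starting point. Each step adds variances by convolving
    centred normal densities.\<close>
  have step: "exp_dist (density lborel (normal_density 0 (sqrt (real (Suc n)))))
    \<and> (translate_avg std_normal_distribution ^^ Suc n) g
      = translate_avg (density lborel (normal_density 0 (sqrt (real (Suc n))))) g" for n
  proof (induction n)
    case 0
    then show ?case using exp_dist_std_normal by simp
  next
    case (Suc n)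
    let ?D = "\<lambda>n. density lborel (normal_density 0 (sqrt (real n)))"
    have "(translate_avg std_normal_distribution ^^ Suc (Suc n)) g
        = translate_avg std_normal_distribution (translate_avg (?D (Suc n)) g)"
      using Suc by simp
    also have "\<dots> = translate_avg (std_normal_distribution \<star> ?D (Suc n)) g"
      using Suc translate_avg_convolution[OF exp_dist_std_normal _ g] by simp
    also have eq: "(std_normal_distribution \<star> ?D (Suc n)) = ?D (Suc (Suc n))"
    proof -
      have fin: "finite_measure (density lborel (normal_density 0 (sqrt (real (Suc n)))))"
        using prob_space_normal_density[of "sqrt (real (Suc n))" 0]
        by (auto simp: prob_space_def)
      have "(std_normal_distribution \<star> ?D (Suc n)) = density lborel
          (\<lambda>x. \<integral>\<^sup>+y. ennreal (normal_density 0 1 (x - y)) * ennreal (normal_density 0 (sqrt (real (Suc n))) y) \<partial>lborel)"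
        using fin N.finite_measure_axioms by (intro convolution_density) auto
      also have "\<dots> = density lborel (normal_density 0 (sqrt (1\<^sup>2 + (sqrt (real (Suc n)))\<^sup>2)))"
        using fun_cong[OF conv_normal_density_zero_mean[of 1 "sqrt (real (Suc n))"]]
        by (simp add: ennreal_mult'[symmetric])
      finally show ?thesis by simp
    qed
    finally show ?case using exp_dist_convolution[OF exp_dist_std_normal, of "?D (Suc n)"] Suc eq by simp
  qed
  obtain k where n: "n = Suc k" using assms(1) gr0_implies_Suc by blast
  have "(translate_avg std_normal_distribution ^^ n) g s = translate_avg (distr std_normal_distribution borel (\<lambda>z. sqrt (real n) * z)) g s"
    using step[of k] unfolding n by (subst distr_std_normal_scale) auto
  also have "\<dots> = (\<integral>z. g (s + sqrt (real n) * z) \<partial>std_normal_distribution)"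
    unfolding translate_avg_def by (subst integral_distr) auto
  finally show ?thesis .
qed

lemma exp_taylor2_bound:
  fixes u :: real
  shows "exp u \<le> 1 + u + u\<^sup>2 / 2 + \<bar>u\<bar> ^ 3 * exp \<bar>u\<bar>"
proof -
  obtain t where t: "\<bar>t\<bar> \<le> \<bar>u\<bar>" and e: "exp u = (\<Sum>m<3. u ^ m / fact m) + exp t / fact 3 * u ^ 3"
    using Maclaurin_exp_le[of u 3] by auto
  have u3: "u ^ 3 \<le> \<bar>u\<bar> ^ 3" using abs_ge_self[of "u ^ 3"] by (simp only: power_abs)
  have t3: "exp t / fact 3 \<le> exp \<bar>u\<bar>"
  proof -
    have "exp t / fact 3 \<le> exp t / 1" by (intro divide_left_mono) (auto simp: fact_numeral)
    also have "\<dots> \<le> exp \<bar>u\<bar>" using t by simp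
    finally show ?thesis .
  qed
  have "exp t / fact 3 * u ^ 3 \<le> exp t / fact 3 * \<bar>u\<bar> ^ 3"
    by (rule mult_left_mono[OF u3]) simp
  also have "\<dots> \<le> exp \<bar>u\<bar> * \<bar>u\<bar> ^ 3"
    by (rule mult_right_mono[OF t3]) simp
  also have "\<dots> = \<bar>u\<bar> ^ 3 * exp \<bar>u\<bar>" by (rule mult.commute)
  finally have "exp t / fact 3 * u ^ 3 \<le> \<bar>u\<bar> ^ 3 * exp \<bar>u\<bar>" .
  moreover have "(\<Sum>m<3. u ^ m / fact m) = 1 + u + u\<^sup>2 / 2"
    by (simp add: numeral_3_eq_3 power2_eq_square)
  ultimately show ?thesis using e by linarith
qed

lemma exp_dist_bounded:
  assumes "prob_space P" "sets P = sets borel" "AE y in P. \<bar>y\<bar> \<le> K"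
  shows "exp_dist P"
proof -
  interpret prob_space P by fact
  note [measurable_cong] = assms(2)
  have "integrable P (\<lambda>y. exp \<bar>y\<bar>)"
    by (rule integrable_const_bound[of _ "exp K"]) (use assms(3) in auto)
  then show ?thesis using assms by unfold_locales auto
qed

text \<open>With m = K^3 exp K bounding the exponentially weighted third moment of a law on [-K, K],
  and 12 exp 2 that of the normal law, this is 2 (m + 12 exp 2) exp m. The factor exp m is what
  remains of the cubic part of L^n once n \<theta>^3 <= 1.\<close>

definition swap_const :: "real \<Rightarrow> real" where
  "swap_const K = 2 * (K ^ 3 * exp K + 12 * exp 2) * exp (K ^ 3 * exp K)"

text \<open>The exponent n \<theta>^2 / 2 - \<theta> t is that of Chernoff's bound for a Gaussian
  sum: minimal at \<theta> = t / n, where it equals - t^2 / (2 n). The condition n \<theta>^3 <= 1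
  keeps the third-order terms of the moment generating functions bounded over all n factors.\<close>

lemma cube_swap:
  assumes P: "prob_space P" "sets P = sets borel" "AE y in P. \<bar>y\<bar> \<le> K"
    and K: "0 \<le> K" and mean: "(\<integral>y. y \<partial>P) = 0" and var: "(\<integral>y. y\<^sup>2 \<partial>P) = 1"
    and \<theta>: "0 \<le> \<theta>" "\<theta> \<le> 1" "real n * \<theta> ^ 3 \<le> 1" and n: "n > 0"
  shows "\<bar>(translate_avg P ^^ n) (\<lambda>s. (max 0 (s - t)) ^ 3) 0
      - (\<integral>z. (max 0 (sqrt (real n) * z - t)) ^ 3 \<partial>std_normal_distribution)\<bar>
    \<le> real n * swap_const K * exp (real n * \<theta>\<^sup>2 / 2 - \<theta> * t)"
proof -
  let ?N = "std_normal_distribution"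
  define m where "m = K ^ 3 * exp K"
  define L where "L = exp (\<theta>\<^sup>2 / 2 + m * \<theta> ^ 3)"
  define b where "b = m + 12 * exp 2"
  interpret P: exp_dist P using P by (rule exp_dist_bounded)
  have m0: "0 \<le> m" using K by (simp add: m_def)
  have b0: "0 \<le> b" using m0 by (simp add: b_def)
  have "\<bar>y\<bar> ^ 3 * exp (\<theta> * \<bar>y\<bar>) \<le> m" if "\<bar>y\<bar> \<le> K" for y
  proof -
    have "\<theta> * \<bar>y\<bar> \<le> 1 * K" using \<theta> that by (intro mult_mono) auto
    then show ?thesis unfolding m_def using that K by (intro mult_mono power_mono) auto
  qed
  then have ae3: "AE y in P. \<bar>y\<bar> ^ 3 * exp (\<theta> * \<bar>y\<bar>) \<le> m" using P(3) by auto
  have int3: "integrable P (\<lambda>y. \<bar>y\<bar> ^ 3 * exp (\<theta> * \<bar>y\<bar>))"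
    by (rule P.integrable_const_bound[of _ m]) (use ae3 in auto)
  have int1: "integrable P (\<lambda>y. y)"
    by (rule P.integrable_const_bound[of _ K]) (use P(3) in auto)
  have "y\<^sup>2 \<le> K\<^sup>2" if "\<bar>y\<bar> \<le> K" for y using that by (intro abs_le_square_iff[THEN iffD1]) auto
  then have ae2: "AE y in P. y\<^sup>2 \<le> K\<^sup>2" using P(3) by auto
  have int2: "integrable P (\<lambda>y. y\<^sup>2)"
    by (rule P.integrable_const_bound[of _ "K\<^sup>2"]) (use ae2 in auto)
  have le3: "(\<integral>y. \<bar>y\<bar> ^ 3 * exp (\<theta> * \<bar>y\<bar>) \<partial>P) \<le> m"
    using ae3 int3 by (rule P.integral_le_const[rotated])
  have mgfP: "(\<integral>z. exp (\<theta> * z) \<partial>P) \<le> L"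
  proof -
    have bound: "exp (\<theta> * z) \<le> 1 + \<theta> * z + \<theta>\<^sup>2 / 2 * z\<^sup>2 + \<theta> ^ 3 * (\<bar>z\<bar> ^ 3 * exp (\<theta> * \<bar>z\<bar>))" for z
      using exp_taylor2_bound[of "\<theta> * z"] \<theta>
      by (simp add: power_mult_distrib abs_mult mult.assoc)
    have "(\<integral>z. exp (\<theta> * z) \<partial>P)
        \<le> (\<integral>z. 1 + \<theta> * z + \<theta>\<^sup>2 / 2 * z\<^sup>2 + \<theta> ^ 3 * (\<bar>z\<bar> ^ 3 * exp (\<theta> * \<bar>z\<bar>)) \<partial>P)"
      using int1 int2 int3 P.integrable_exp[OF \<theta>(1,2)] bound by (intro integral_mono) auto
    also have "\<dots> = 1 + \<theta> * (\<integral>y. y \<partial>P) + \<theta>\<^sup>2 / 2 * (\<integral>y. y\<^sup>2 \<partial>P)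
        + \<theta> ^ 3 * (\<integral>y. \<bar>y\<bar> ^ 3 * exp (\<theta> * \<bar>y\<bar>) \<partial>P)"
      using int1 int2 int3 P.prob_space by simp
    also have "\<dots> \<le> 1 + (\<theta>\<^sup>2 / 2 + \<theta> ^ 3 * m)"
      using mean var \<theta> le3 by (simp add: mult_left_mono)
    also have "\<dots> \<le> L" unfolding L_def using exp_ge_add_one_self[of "\<theta>\<^sup>2 / 2 + \<theta> ^ 3 * m"]
      by (simp add: mult.commute)
    finally show ?thesis .
  qed
  have mgfN: "(\<integral>z. exp (\<theta> * z) \<partial>?N) \<le> L"
    using m0 \<theta>(1) unfolding L_def std_normal_mgf by simp
  have L1: "1 \<le> L" using m0 \<theta>(1) by (simp add: L_def)
  have mom: "integrable R (\<lambda>y. y) \<and> (\<integral>y. y \<partial>R) = 0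
      \<and> integrable R (\<lambda>y. y\<^sup>2) \<and> (\<integral>y. y\<^sup>2 \<partial>R) = 1
      \<and> integrable R (\<lambda>y. \<bar>y\<bar> ^ 3 * exp (\<theta> * \<bar>y\<bar>)) \<and> (\<integral>y. \<bar>y\<bar> ^ 3 * exp (\<theta> * \<bar>y\<bar>) \<partial>R) \<le> b"
    if "R \<in> {P, ?N}" for R
  proof -
    consider "R = P" | "R = ?N" using \<open>R \<in> {P, ?N}\<close> by blast
    then show ?thesis
    proof cases
      case 1
      have "m \<le> b" by (simp add: b_def)
      with le3 have "(\<integral>y. \<bar>y\<bar> ^ 3 * exp (\<theta> * \<bar>y\<bar>) \<partial>P) \<le> b" by linarith
      then show ?thesis using 1 int1 int2 int3 mean var by simp
    next
      case 2
      have "12 * exp 2 \<le> b" using m0 by (simp add: b_def)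
      then have "(\<integral>y. \<bar>y\<bar> ^ 3 * exp (\<theta> * \<bar>y\<bar>) \<partial>?N) \<le> b"
        using std_normal_exp_third_moment(2)[OF \<theta>(1,2)] by linarith
      then show ?thesis
        unfolding 2 using std_normal_moments std_normal_exp_third_moment(1)[OF \<theta>(1,2)] by blast
    qed
  qed
  let ?f = "\<lambda>s. (max 0 (s - t)) ^ 3"
  have f: "taylor3 \<theta> (exp (- \<theta> * t)) ?f" using \<theta>(1) by (rule taylor3_cube_pos_part)
  have ef: "exp_growth ?f" using f by (simp add: taylor3_def)
  have "\<bar>(translate_avg P ^^ n) ?f 0 - (translate_avg ?N ^^ n) ?f 0\<bar>
      \<le> real n * (2 * exp (- \<theta> * t) * b * L ^ n) * exp (\<theta> * 0)"
    by (rule lindeberg_swap[OF P.exp_dist_axioms exp_dist_std_normal f \<theta>(1,2) _ b0 mgfP mgfN L1 mom]) auto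
  also have "\<dots> = real n * (2 * b * exp (- \<theta> * t) * L ^ n)" by simp
  also have "\<dots> \<le> real n * (2 * b * exp (- \<theta> * t) * (exp (real n * \<theta>\<^sup>2 / 2) * exp m))"
  proof -
    have "m * (real n * \<theta> ^ 3) \<le> m * 1" using m0 \<theta>(3) by (rule mult_left_mono[rotated])
    then have "L ^ n \<le> exp (real n * \<theta>\<^sup>2 / 2) * exp m"
      unfolding L_def exp_of_nat_mult[symmetric] exp_add[symmetric] by (simp add: algebra_simps)
    then show ?thesis using b0 by (intro mult_left_mono) auto
  qed
  also have "\<dots> = real n * swap_const K * exp (real n * \<theta>\<^sup>2 / 2 - \<theta> * t)"
  proof -
    have "exp (real n * \<theta>\<^sup>2 / 2 - \<theta> * t) = exp (real n * \<theta>\<^sup>2 / 2) * exp (- \<theta> * t)"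
      by (simp add: exp_add[symmetric])
    then show ?thesis unfolding swap_const_def b_def m_def by (simp only: mult_ac)
  qed
  finally show ?thesis using translate_avg_std_normal_funpow[OF n ef, of 0] by simp
qed

text \<open>Divided by 6 d^3, \<open>F\<close> is the distribution function at s of t plus three
  independent uniform variables on [0, d], that is, an integrated quadratic B-spline. Hence the
  passage from 0 to 1 over [t, t + 3 d]; the proof checks the cubic pieces directly.\<close>

lemma third_difference_cube:
  fixes d s t :: real
  defines "F \<equiv> (max 0 (s - t)) ^ 3 - 3 * (max 0 (s - (t + d))) ^ 3
      + 3 * (max 0 (s - (t + 2 * d))) ^ 3 - (max 0 (s - (t + 3 * d))) ^ 3"
  assumes "0 < d"
  shows "0 \<le> F" "F \<le> 6 * d ^ 3" "s \<le> t \<Longrightarrow> F = 0" "t + 3 * d \<le> s \<Longrightarrow> F = 6 * d ^ 3"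
proof -
  have zero: "F = 0" if "s \<le> t" using that assms by (simp add: max_def)
  have full: "F = 6 * d ^ 3" if "t + 3 * d \<le> s"
  proof -
    have "F = (s - t) ^ 3 - 3 * (s - (t + d)) ^ 3 + 3 * (s - (t + 2 * d)) ^ 3 - (s - (t + 3 * d)) ^ 3"
      using that assms by (simp add: max_def)
    also have "\<dots> = 6 * d ^ 3" by (simp add: power3_eq_cube algebra_simps)
    finally show ?thesis .
  qed
  have "0 \<le> F \<and> F \<le> 6 * d ^ 3"
  proof -
    consider "s \<le> t" | "t \<le> s" "s \<le> t + d" | "t + d \<le> s" "s \<le> t + 2 * d"
      | "t + 2 * d \<le> s" "s \<le> t + 3 * d" | "t + 3 * d \<le> s" by linarith
    then show ?thesis
    proof cases
      case 1 then show ?thesis using zero assms by simp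
    next
      case 2
      then have "F = (s - t) ^ 3" using assms by (simp add: max_def)
      moreover have "(s - t) ^ 3 \<le> d ^ 3" "0 \<le> (s - t) ^ 3" using 2 by (auto intro: power_mono)
      moreover have "0 \<le> d ^ 3" using assms by simp
      ultimately show ?thesis by linarith
    next
      case 3
      define w where "w = s - t - d"
      have w: "0 \<le> w" "w \<le> d" using 3 by (auto simp: w_def)
      have "F = (w + d) ^ 3 - 3 * w ^ 3" using 3 assms by (simp add: max_def w_def diff_diff_eq add.commute)
      moreover have low: "0 \<le> (v + d) ^ 3 - 3 * v ^ 3" if "0 \<le> v" "v \<le> d" for v
      proof -
        have "(2 * v) ^ 3 \<le> (v + d) ^ 3" using that by (intro power_mono) auto
        then have "8 * v ^ 3 \<le> (v + d) ^ 3" by (simp add: power_mult_distrib)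
        moreover have "0 \<le> v ^ 3" using that by simp
        ultimately show ?thesis by linarith
      qed
      \<comment> \<open>Point symmetry of the middle piece: replacing w by d - w turns
        \<open>F\<close> into 6 d^3 - \<open>F\<close>, so the upper bound follows from the lower
        one.\<close>
      moreover have "(w + d) ^ 3 - 3 * w ^ 3 = 6 * d ^ 3 - ((d - w + d) ^ 3 - 3 * (d - w) ^ 3)"
        by (simp add: power3_eq_cube algebra_simps)
      moreover note low[of w] low[of "d - w"] w
      ultimately show ?thesis by linarith
    next
      case 4
      have "F = (s - t) ^ 3 - 3 * (s - (t + d)) ^ 3 + 3 * (s - (t + 2 * d)) ^ 3"
        using 4 assms by (simp add: max_def)
      also have "\<dots> = 6 * d ^ 3 - (t + 3 * d - s) ^ 3" by (simp add: power3_eq_cube algebra_simps)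
      finally have "F = 6 * d ^ 3 - (t + 3 * d - s) ^ 3" .
      moreover have "(t + 3 * d - s) ^ 3 \<le> d ^ 3" "0 \<le> (t + 3 * d - s) ^ 3"
        using 4 by (auto intro: power_mono)
      moreover have "0 \<le> d ^ 3" using assms by simp
      ultimately show ?thesis by linarith
    next
      case 5 then show ?thesis using full assms by simp
    qed
  qed
  then show "0 \<le> F" "F \<le> 6 * d ^ 3" by auto
  show "s \<le> t \<Longrightarrow> F = 0" "t + 3 * d \<le> s \<Longrightarrow> F = 6 * d ^ 3" by (fact zero full)+
qed

subsection \<open>Gaussian tails\<close>

abbreviation "\<phi> \<equiv> std_normal_density"

lemma std_normal_cdf_diff_bounds:
  assumes "x \<le> y"
  shows "(\<And>z. x < z \<Longrightarrow> z \<le> y \<Longrightarrow> a \<le> \<phi> z) \<Longrightarrow> 0 \<le> a \<Longrightarrow> a * (y - x) \<le> \<Phi> y - \<Phi> x"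
    and "(\<And>z. x < z \<Longrightarrow> z \<le> y \<Longrightarrow> \<phi> z \<le> b) \<Longrightarrow> 0 \<le> b \<Longrightarrow> \<Phi> y - \<Phi> x \<le> b * (y - x)"
proof -
  interpret N: real_distribution std_normal_distribution by (rule real_dist_normal_dist)
  have diff: "ennreal (\<Phi> y - \<Phi> x) = (\<integral>\<^sup>+z. ennreal (\<phi> z) * indicator {x<..y} z \<partial>lborel)"
  proof (cases "x = y")
    case False
    then have "\<Phi> y - \<Phi> x = measure std_normal_distribution {x<..y}"
      using assms by (intro N.cdf_diff_eq) auto
    then show ?thesis by (simp add: N.emeasure_eq_measure[symmetric] emeasure_density)
  qed simp
  have nonneg: "0 \<le> \<Phi> y - \<Phi> x" using N.cdf_nondecreasing[OF assms] by simp
  have const: "(\<integral>\<^sup>+z. ennreal c * indicator {x<..y} z \<partial>lborel) = ennreal (c * (y - x))" if "0 \<le> c" for c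
    using that assms by (subst nn_integral_cmult_indicator) (auto simp: ennreal_mult')
  show "a * (y - x) \<le> \<Phi> y - \<Phi> x" if "\<And>z. x < z \<Longrightarrow> z \<le> y \<Longrightarrow> a \<le> \<phi> z" "0 \<le> a"
  proof -
    have "ennreal (a * (y - x)) \<le> ennreal (\<Phi> y - \<Phi> x)"
      unfolding diff const[OF that(2), symmetric]
      using that by (intro nn_integral_mono) (auto simp: indicator_def intro: ennreal_leI)
    then show ?thesis using nonneg by simp
  qed
  show "\<Phi> y - \<Phi> x \<le> b * (y - x)" if "\<And>z. x < z \<Longrightarrow> z \<le> y \<Longrightarrow> \<phi> z \<le> b" "0 \<le> b"
  proof -
    have "ennreal (\<Phi> y - \<Phi> x) \<le> ennreal (b * (y - x))"
      unfolding diff const[OF that(2), symmetric]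
      using that by (intro nn_integral_mono) (auto simp: indicator_def intro: ennreal_leI)
    then show ?thesis using that(2) assms by simp
  qed
qed

lemma std_normal_tail_nonneg: "0 \<le> 1 - \<Phi> x"
  using real_distribution.cdf_bounded_prob[OF real_dist_normal_dist, of x] by simp

lemma std_normal_tail:
  "measure std_normal_distribution {x<..} = 1 - \<Phi> x"
proof -
  interpret N: real_distribution std_normal_distribution by (rule real_dist_normal_dist)
  have "measure std_normal_distribution (UNIV - {..x}) = 1 - \<Phi> x"
    using N.prob_compl[of "{..x}"] by (simp add: cdf_def)
  moreover have "UNIV - {..x} = {x<..}" by auto
  ultimately show ?thesis by simp
qed

lemma exp_two_le_nine: "exp (2::real) \<le> 9"
proof -
  have "exp (2::real) = exp 1 * exp 1" by (simp add: exp_add[symmetric])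
  also have "\<dots> \<le> 3 * 3" using exp_le by (intro mult_mono) auto
  finally show ?thesis by simp
qed

lemma std_normal_density_decreasing:
  "0 \<le> x \<Longrightarrow> x \<le> y \<Longrightarrow> \<phi> y \<le> \<phi> x"
  unfolding std_normal_density_def by (intro mult_left_mono) (auto intro: power_mono)

text \<open>The ratio of the two density values is exp (- x d - d^2 / 2).\<close>

lemma std_normal_density_shift:
  assumes "- x * d - d\<^sup>2 / 2 \<ge> c"
  shows "exp c * \<phi> x \<le> \<phi> (x + d)"
proof -
  have "c + - x\<^sup>2 / 2 \<le> - (x + d)\<^sup>2 / 2" using assms by (simp add: power2_sum field_simps)
  then have "exp c * exp (- x\<^sup>2 / 2) \<le> exp (- (x + d)\<^sup>2 / 2)" by (simp only: exp_add[symmetric] exp_le_cancel_iff)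
  then have "1 / sqrt (2 * pi) * (exp c * exp (- x\<^sup>2 / 2)) \<le> 1 / sqrt (2 * pi) * exp (- (x + d)\<^sup>2 / 2)"
    by (rule mult_left_mono) simp
  then show ?thesis unfolding std_normal_density_def by (simp only: mult_ac)
qed

text \<open>A lower bound of Mills type. Over the interval [x, x + 1 / (1 + x)] the density falls at
  most by the factor exp 2 <= 9, so the tail is at least the length of that interval times \<phi> x
  / 9.\<close>

lemma std_normal_tail_lower_nonneg:
  assumes "0 \<le> x"
  shows "\<phi> x \<le> 9 * (1 + x) * (1 - \<Phi> x)"
proof -
  define d where "d = 1 / (1 + x)"
  have d: "0 < d" "d \<le> 1" "x * d \<le> 1" using assms by (auto simp: d_def field_simps)
  have "d\<^sup>2 \<le> 1" using d by (simp add: power_le_one)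
  then have "exp (- 2) * \<phi> x \<le> \<phi> (x + d)" using d by (intro std_normal_density_shift) auto
  moreover have "1 / 9 \<le> exp (- 2 :: real)" using exp_two_le_nine by (simp add: exp_minus field_simps)
  then have "1 / 9 * \<phi> x \<le> exp (- 2) * \<phi> x" by (intro mult_right_mono) auto
  ultimately have low: "1 / 9 * \<phi> x \<le> \<phi> (x + d)" by linarith
  have "\<phi> (x + d) * (x + d - x) \<le> \<Phi> (x + d) - \<Phi> x"
    using d assms by (intro std_normal_cdf_diff_bounds(1)) (auto intro: std_normal_density_decreasing)
  also have "\<dots> \<le> 1 - \<Phi> x" using std_normal_tail_nonneg[of "x + d"] by simp
  finally have "\<phi> (x + d) \<le> (1 + x) * (1 - \<Phi> x)" using assms by (simp add: d_def field_simps)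
  then show ?thesis using low by (simp only: mult.assoc)
qed

text \<open>For negative x the tail is at least the tail at 0, hence the truncation
  \<open>max x 0\<close> in the density.\<close>

lemma std_normal_tail_lower:
  "\<phi> (max x 0) \<le> 9 * (1 + \<bar>x\<bar>) * (1 - \<Phi> x)"
proof (cases "0 \<le> x")
  case True then show ?thesis using std_normal_tail_lower_nonneg[OF True] by simp
next
  case False
  interpret N: real_distribution std_normal_distribution by (rule real_dist_normal_dist)
  have "\<phi> 0 \<le> 9 * (1 - \<Phi> 0)" using std_normal_tail_lower_nonneg[of 0] by simp
  also have "\<dots> \<le> 9 * (1 - \<Phi> x)" using N.cdf_nondecreasing[of x 0] False by simp
  also have "\<dots> \<le> 9 * (1 + \<bar>x\<bar>) * (1 - \<Phi> x)"
    using std_normal_tail_nonneg by (intro mult_right_mono) auto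
  finally show ?thesis using False by simp
qed

text \<open>Within distance 1 / (1 + |x|) of x the density is at most 9 times its value at
  \<open>max x 0\<close>, and that value is at most 9 (1 + |x|) times the tail. The constant is 81 =
  9 * 9, and the change is relative to the tail, as needed where the tail itself is small.\<close>

lemma std_normal_cdf_perturb:
  assumes "(1 + \<bar>x\<bar>) * \<bar>d\<bar> \<le> 1"
  shows "\<bar>\<Phi> (x + d) - \<Phi> x\<bar> \<le> 81 * ((1 + \<bar>x\<bar>) * \<bar>d\<bar>) * (1 - \<Phi> x)"
proof -
  have d: "\<bar>d\<bar> \<le> 1" "\<bar>x\<bar> * \<bar>d\<bar> \<le> 1"
    using assms by (auto simp: algebra_simps intro: order_trans[rotated])
  have bound: "\<phi> z \<le> 9 * \<phi> (max x 0)" if z: "\<bar>z - x\<bar> \<le> \<bar>d\<bar>" for z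
  proof (cases "0 \<le> x")
    case True
    have "- z * (x - z) - (x - z)\<^sup>2 / 2 = x * (z - x) + (z - x)\<^sup>2 / 2"
      by (simp add: power2_eq_square algebra_simps)
    moreover have "- 1 \<le> x * (z - x)"
    proof -
      have "\<bar>x * (z - x)\<bar> \<le> \<bar>x\<bar> * \<bar>d\<bar>" unfolding abs_mult using z by (intro mult_left_mono) auto
      then show ?thesis using d(2) by linarith
    qed
    moreover have "0 \<le> (z - x)\<^sup>2 / 2" by simp
    ultimately have "exp (- 2) * \<phi> z \<le> \<phi> (z + (x - z))" by (intro std_normal_density_shift) linarith
    then have "\<phi> z \<le> exp 2 * \<phi> x" by (simp add: exp_minus field_simps)
    also have "\<dots> \<le> 9 * \<phi> x" using exp_two_le_nine by (intro mult_right_mono) auto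
    finally show ?thesis using True by simp
  next
    case False
    have "\<phi> z \<le> \<phi> 0" unfolding std_normal_density_def by (intro mult_left_mono) auto
    moreover have "0 \<le> \<phi> 0" by (rule normal_density_nonneg)
    ultimately have "\<phi> z \<le> 9 * \<phi> 0" by linarith
    then show ?thesis using False by simp
  qed
  define B where "B = 9 * \<phi> (max x 0)"
  have B0: "0 \<le> B" by (simp add: B_def)
  interpret N: real_distribution std_normal_distribution by (rule real_dist_normal_dist)
  have "\<bar>\<Phi> (x + d) - \<Phi> x\<bar> \<le> B * \<bar>d\<bar>"
  proof (cases "0 \<le> d")
    case True
    have "\<Phi> (x + d) - \<Phi> x \<le> B * (x + d - x)"
      using True B0 bound unfolding B_def by (intro std_normal_cdf_diff_bounds(2)) auto
    then show ?thesis using True N.cdf_nondecreasing[of x "x + d"] by simp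
  next
    case False
    have "\<Phi> x - \<Phi> (x + d) \<le> B * (x - (x + d))"
      using False B0 bound unfolding B_def by (intro std_normal_cdf_diff_bounds(2)) auto
    then show ?thesis using False N.cdf_nondecreasing[of "x + d" x] by simp
  qed
  also have "\<dots> \<le> 9 * (9 * (1 + \<bar>x\<bar>) * (1 - \<Phi> x)) * \<bar>d\<bar>"
    unfolding B_def using std_normal_tail_lower[of x] by (intro mult_right_mono mult_left_mono) auto
  finally show ?thesis by (simp add: algebra_simps)
qed

subsection \<open>Moderate deviations of bounded sums\<close>

text \<open>The third difference lies between 6 d^3 times the indicators of Z > t + 3 d and Z > t.
  Used at t and at t - 3 d, this turns bounds on truncated third moments into two-sided bounds on
  tails.\<close>

lemma (in prob_space) third_difference_bounds:
  fixes Z :: "'a \<Rightarrow> real"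
  assumes d: "0 < d" and Z [measurable]: "random_variable borel Z"
    and int: "\<And>t. integrable M (\<lambda>\<omega>. (max 0 (Z \<omega> - t)) ^ 3)"
  defines "J \<equiv> (\<lambda>t. expectation (\<lambda>\<omega>. (max 0 (Z \<omega> - t)) ^ 3))"
  shows "6 * d ^ 3 * prob {\<omega>\<in>space M. Z \<omega> > t + 3 * d} \<le> J t - 3 * J (t + d) + 3 * J (t + 2 * d) - J (t + 3 * d)"
    and "J t - 3 * J (t + d) + 3 * J (t + 2 * d) - J (t + 3 * d) \<le> 6 * d ^ 3 * prob {\<omega>\<in>space M. Z \<omega> > t}"
proof -
  let ?F = "\<lambda>\<omega>. (max 0 (Z \<omega> - t)) ^ 3 - 3 * (max 0 (Z \<omega> - (t + d))) ^ 3
      + 3 * (max 0 (Z \<omega> - (t + 2 * d))) ^ 3 - (max 0 (Z \<omega> - (t + 3 * d))) ^ 3"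
  have E: "J t - 3 * J (t + d) + 3 * J (t + 2 * d) - J (t + 3 * d) = expectation ?F"
    unfolding J_def using int by simp
  have intF: "integrable M ?F" using int by (intro Bochner_Integration.integrable_diff Bochner_Integration.integrable_add integrable_mult_right)
  have ind: "expectation (\<lambda>\<omega>. 6 * d ^ 3 * indicator {\<omega>\<in>space M. Z \<omega> > u} \<omega>) = 6 * d ^ 3 * prob {\<omega>\<in>space M. Z \<omega> > u}"
    "integrable M (\<lambda>\<omega>. 6 * d ^ 3 * indicator {\<omega>\<in>space M. Z \<omega> > u} \<omega> :: real)" for u
    by (auto simp: emeasure_eq_measure)
  show "6 * d ^ 3 * prob {\<omega>\<in>space M. Z \<omega> > t + 3 * d} \<le> J t - 3 * J (t + d) + 3 * J (t + 2 * d) - J (t + 3 * d)"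
    unfolding E ind(1)[symmetric]
  proof (rule integral_mono[OF ind(2) intF])
    fix \<omega> assume "\<omega> \<in> space M"
    then show "6 * d ^ 3 * indicator {\<omega>\<in>space M. Z \<omega> > t + 3 * d} \<omega> \<le> ?F \<omega>"
      using third_difference_cube(1,4)[OF d, where s = "Z \<omega>" and t = t] by (cases "Z \<omega> > t + 3 * d") (auto simp: indicator_def)
  qed
  show "J t - 3 * J (t + d) + 3 * J (t + 2 * d) - J (t + 3 * d) \<le> 6 * d ^ 3 * prob {\<omega>\<in>space M. Z \<omega> > t}"
    unfolding E ind(1)[symmetric]
  proof (rule integral_mono[OF intF ind(2)])
    fix \<omega> assume "\<omega> \<in> space M"
    then show "?F \<omega> \<le> 6 * d ^ 3 * indicator {\<omega>\<in>space M. Z \<omega> > t} \<omega>"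
      using third_difference_cube(2,3)[OF d, where s = "Z \<omega>" and t = t] by (cases "Z \<omega> > t") (auto simp: indicator_def)
  qed
qed

text \<open>243 = 3 * 81 is the cost of moving x by 3 / w in the normal tail. 324 covers the swap
  error with room: 8 from the coefficients 1, 3, 3, 1 of the third difference, 3 from exp 1, 27 from
  the tail bound, and division by 6 give 108.\<close>

definition md_const :: "real \<Rightarrow> real" where
  "md_const K = 243 + 324 * swap_const K"

lemma swap_const_nonneg: "0 \<le> K \<Longrightarrow> 0 \<le> swap_const K"
  by (simp add: swap_const_def)

text \<open>\<theta> = h / sqrt n is the optimal tilt for the level h sqrt n, with sqrt n = w^4.
  Lowering the level by the smoothing width 3 / w changes the exponent only by 3 h / w, which is
  bounded in the range of use.\<close>

lemma moderate_deviation_scaling: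
  fixes w h :: real
  assumes w: "0 < w" "n = w ^ 8"
  shows "n * C * exp (n * (h / w ^ 4)\<^sup>2 / 2 - h / w ^ 4 * ((h - 3 / w) * w ^ 4))
    = w ^ 8 * C * exp (- h\<^sup>2 / 2) * exp (3 * (h / w))"
proof -
  have "n * (h / w ^ 4)\<^sup>2 / 2 = h\<^sup>2 / 2"
    using w by (simp add: power_divide power_mult[symmetric])
  moreover have "h / w ^ 4 * ((h - 3 / w) * w ^ 4) = h\<^sup>2 - 3 * (h / w)"
    using w(1) by (simp add: power2_eq_square algebra_simps)
  ultimately have "n * (h / w ^ 4)\<^sup>2 / 2 - h / w ^ 4 * ((h - 3 / w) * w ^ 4) = - h\<^sup>2 / 2 + 3 * (h / w)" by simp
  then show ?thesis using w by (simp only: exp_add mult.assoc)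
qed

text \<open>With w = n^(1/8), the smoothing step d = w^3 has normalised width 3 d / sqrt n = 3 / w.
  The swap error is of order n exp (- h^2 / 2) = w^8 exp (- h^2 / 2) and gets divided by 6 d^3 = 6
  w^9, hence is of order 1 / w as well. This balance is the origin of the exponent 1/8.\<close>

lemma (in prob_space) moderate_deviation_bounded:
  fixes Y :: "nat \<Rightarrow> 'a \<Rightarrow> real"
  assumes I: "finite I" "card I = n" "n > 0" and indep: "indep_vars (\<lambda>_. borel) Y I"
    and distr: "\<And>i. i \<in> I \<Longrightarrow> distr M borel (Y i) = P"
    and P: "prob_space P" "sets P = sets borel" "AE y in P. \<bar>y\<bar> \<le> K"
    and K: "0 \<le> K" and mean: "(\<integral>y. y \<partial>P) = 0" and var: "(\<integral>y. y\<^sup>2 \<partial>P) = 1"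
    and x: "3 * (1 + \<bar>x\<bar>) \<le> real n powr (1 / 8)"
  shows "\<bar>prob {\<omega>\<in>space M. (\<Sum>i\<in>I. Y i \<omega>) > x * sqrt (real n)} - (1 - \<Phi> x)\<bar>
    \<le> md_const K * ((1 + \<bar>x\<bar>) * real n powr (- 1 / 8)) * (1 - \<Phi> x)"
proof -
  define w where "w = real n powr (1 / 8)"
  have "3 * 1 \<le> 3 * (1 + \<bar>x\<bar>)" by simp
  then have w: "3 \<le> w" using order_trans[OF _ x] unfolding w_def by simp
  have w8: "real n = w ^ 8" using I(3) by (simp add: w_def powr_power)
  have w4: "sqrt (real n) = w ^ 4"
  proof -
    have "real n = (w ^ 4)\<^sup>2" unfolding w8 by (simp add: power_mult[symmetric])
    then have "sqrt (real n) = \<bar>w ^ 4\<bar>" by (simp only: real_sqrt_abs)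
    then show ?thesis using w by simp
  qed
  have winv: "real n powr (- 1 / 8) = 1 / w" by (simp add: w_def powr_minus_divide)
  define h where "h = max x 0"
  define \<theta> where "\<theta> = h / w ^ 4"
  define Z where "Z = (\<lambda>\<omega>. \<Sum>i\<in>I. Y i \<omega>)"
  define d where "d = w ^ 3"
  define N where "N = std_normal_distribution"
  interpret N: exp_dist N unfolding N_def by (rule exp_dist_std_normal)
  have hw: "3 * h \<le> w" "0 \<le> h" using x by (auto simp: h_def w_def)
  have h3: "h / w \<le> 1 / 3" using hw w by (simp add: field_simps)
  have \<theta>: "0 \<le> \<theta>" "\<theta> \<le> 1" "real n * \<theta> ^ 3 \<le> 1"
  proof -
    show "0 \<le> \<theta>" using hw w by (simp add: \<theta>_def)
    have "h \<le> w" using hw w by linarith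
    also have "w \<le> w ^ 4" using w by (simp add: self_le_power)
    finally show "\<theta> \<le> 1" using w by (simp add: \<theta>_def)
    have "h ^ 3 \<le> w ^ 3" using hw \<open>h \<le> w\<close> by (intro power_mono)
    also have "w ^ 3 \<le> w ^ 4" using w by (intro power_increasing) auto
    finally have "h ^ 3 \<le> w ^ 4" .
    then have "w ^ 8 * h ^ 3 \<le> w ^ 8 * w ^ 4" using w by (intro mult_left_mono) auto
    also have "\<dots> = (w ^ 4) ^ 3" by (simp add: power_add[symmetric] power_mult[symmetric])
    finally show "real n * \<theta> ^ 3 \<le> 1" using w by (simp add: \<theta>_def w8 power_divide)
  qed
  have rvY: "random_variable borel (Y i)" if "i \<in> I" for i
    using indep that unfolding indep_vars_def by auto
  have rvZ [measurable]: "random_variable borel Z" unfolding Z_def using rvY by auto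
  have expP: "exp_dist P" using P by (rule exp_dist_bounded)
  define C where "C = swap_const K"
  have C0: "0 \<le> C" unfolding C_def using K by (rule swap_const_nonneg)
  define J where "J t = expectation (\<lambda>\<omega>. (max 0 (Z \<omega> - t)) ^ 3)" for t
  define JN where "JN t = N.expectation (\<lambda>z. (max 0 (w ^ 4 * z - t)) ^ 3)" for t
  have cube: "exp_growth (\<lambda>s. (max 0 (s - t)) ^ 3)" for t :: real
    using exp_growth_pos_part_power[of 1 t 3] by simp
  have sum: "exp_dist (distr M borel Z)"
      "translate_avg (distr M borel Z) (\<lambda>s. (max 0 (s - t)) ^ 3)
        = (translate_avg P ^^ n) (\<lambda>s. (max 0 (s - t)) ^ 3)" for t
    using translate_avg_sum[OF I(1) indep expP distr cube] unfolding Z_def I(2) by auto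
  have intZ: "integrable M (\<lambda>\<omega>. (max 0 (Z \<omega> - t)) ^ 3)" for t
    using exp_dist.integrable_shift[OF sum(1) cube[of t], of 0]
    by (subst (asm) integrable_distr_eq) auto
  have J: "J t = (translate_avg P ^^ n) (\<lambda>s. (max 0 (s - t)) ^ 3) 0" for t
    unfolding sum(2)[symmetric] translate_avg_def J_def by (subst integral_distr) auto
  have intN: "integrable N (\<lambda>z. (max 0 (w ^ 4 * z - t)) ^ 3)" for t
  proof -
    have "integrable N (\<lambda>z. \<bar>w ^ 4 * z - t\<bar> ^ 3)"
    proof (rule Bochner_Integration.integrable_bound)
      have "integrable N (\<lambda>z. exp (w ^ 4 * \<bar>z\<bar>))" unfolding N_def by (rule integrable_std_normal_exp_abs)
      then show "integrable N (\<lambda>z. 6 * exp \<bar>t\<bar> * exp (w ^ 4 * \<bar>z\<bar>))" by simp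
      show "AE z in N. norm (\<bar>w ^ 4 * z - t\<bar> ^ 3) \<le> norm (6 * exp \<bar>t\<bar> * exp (w ^ 4 * \<bar>z\<bar>))"
      proof (rule AE_I2)
        fix z
        have "\<bar>w ^ 4 * z - t\<bar> ^ 3 \<le> 6 * exp \<bar>w ^ 4 * z - t\<bar>" by (rule cube_le_exp) simp
        also have "\<dots> \<le> 6 * exp (\<bar>t\<bar> + w ^ 4 * \<bar>z\<bar>)"
          using abs_triangle_ineq4[of "w ^ 4 * z" t] w by (simp add: abs_mult)
        finally show "norm (\<bar>w ^ 4 * z - t\<bar> ^ 3) \<le> norm (6 * exp \<bar>t\<bar> * exp (w ^ 4 * \<bar>z\<bar>))"
          by (simp add: exp_add)
      qed
    qed (simp add: N_def)
    then show ?thesis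
      by (rule Bochner_Integration.integrable_bound) (auto simp: N_def intro!: power_mono)
  qed
  have swap: "\<bar>J t - JN t\<bar> \<le> real n * C * exp (real n * \<theta>\<^sup>2 / 2 - \<theta> * t)" for t
    using cube_swap[OF P K mean var \<theta> I(3), of t]
    unfolding J JN_def C_def N_def w4 by simp
  define D3 :: "(real \<Rightarrow> real) \<Rightarrow> real \<Rightarrow> real"
    where "D3 G t = G t - 3 * G (t + d) + 3 * G (t + 2 * d) - G (t + 3 * d)" for G t
  have d0: "0 < d" using w by (simp add: d_def)
  define err where "err = w ^ 8 * C * exp (- h\<^sup>2 / 2) * 3"
  \<comment> \<open>The swap bound does not increase with the level, so the lowest admissible level
    serves all four terms; the coefficients 1, 3, 3, 1 add up to 8.\<close>
  have err: "\<bar>D3 J t - D3 JN t\<bar> \<le> 8 * err" if "(h - 3 / w) * w ^ 4 \<le> t \<or> h = 0" for t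
  proof -
    have bd: "\<bar>J u - JN u\<bar> \<le> err" if u: "t \<le> u" for u
    proof -
      have "\<theta> * ((h - 3 / w) * w ^ 4) \<le> \<theta> * u"
      proof (cases "h = 0")
        case False
        then show ?thesis using \<open>_ \<or> h = 0\<close> u \<theta>(1) by (intro mult_left_mono) auto
      qed (simp add: \<theta>_def)
      then have "real n * C * exp (real n * \<theta>\<^sup>2 / 2 - \<theta> * u)
          \<le> real n * C * exp (real n * \<theta>\<^sup>2 / 2 - \<theta> * ((h - 3 / w) * w ^ 4))"
        using C0 by (intro mult_left_mono) auto
      also have "\<dots> = w ^ 8 * C * exp (- h\<^sup>2 / 2) * exp (3 * (h / w))"
        unfolding \<theta>_def using w w8 by (intro moderate_deviation_scaling) auto
      also have "\<dots> \<le> err"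
      proof -
        have "3 * (h / w) \<le> 1" using h3 by linarith
        then have "exp (3 * (h / w)) \<le> exp 1" by (simp only: exp_le_cancel_iff)
        then have "exp (3 * (h / w)) \<le> 3" using exp_le by linarith
        then show ?thesis unfolding err_def using C0 w by (intro mult_left_mono) auto
      qed
      finally show ?thesis using swap[of u] by linarith
    qed
    show ?thesis using bd[of t] bd[of "t + d"] bd[of "t + 2 * d"] bd[of "t + 3 * d"] d0
      unfolding D3_def by linarith
  qed
  have probN: "N.prob {z\<in>space N. w ^ 4 * z > u * w ^ 4} = 1 - \<Phi> u" for u
  proof -
    have "{z\<in>space N. w ^ 4 * z > u * w ^ 4} = {u<..}" using w by (auto simp: mult.commute N_def)
    then show ?thesis by (simp add: N_def std_normal_tail)
  qed
  note TZ = third_difference_bounds[OF d0 rvZ intZ, folded J_def, folded D3_def]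
  have rvN: "(\<lambda>z. w ^ 4 * z) \<in> borel_measurable N" by (simp add: N_def)
  note TN = N.third_difference_bounds[OF d0 rvN intN, folded JN_def, folded D3_def]
  have tail_up: "\<bar>\<Phi> (x + u) - \<Phi> x\<bar> \<le> 243 * ((1 + \<bar>x\<bar>) / w) * (1 - \<Phi> x)" if "\<bar>u\<bar> = 3 / w" for u
  proof -
    have "(1 + \<bar>x\<bar>) * \<bar>u\<bar> \<le> 1" unfolding that using x w by (simp add: w_def[symmetric] field_simps)
    from std_normal_cdf_perturb[OF this] show ?thesis unfolding that by (simp add: field_simps)
  qed
  define p where "p = prob {\<omega>\<in>space M. Z \<omega> > x * w ^ 4}"
  have dw: "3 * d = (3 / w) * w ^ 4" using w by (simp add: d_def power_def eval_nat_numeral)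
  \<comment> \<open>\<open>x * w ^ 4 - 3 * d\<close> is the lowest level at which a third difference
    is taken below; for x >= 0 it is exactly the level of the scaling lemma.\<close>
  have xh: "(h - 3 / w) * w ^ 4 \<le> x * w ^ 4 - 3 * d \<or> h = 0"
  proof (cases "0 \<le> x")
    case True
    then have "(h - 3 / w) * w ^ 4 = x * w ^ 4 - 3 * d" unfolding dw h_def by (simp only: left_diff_distrib max_absorb1)
    then show ?thesis by simp
  qed (simp add: h_def)
  have xh': "(h - 3 / w) * w ^ 4 \<le> x * w ^ 4 \<or> h = 0" using xh d0 by auto
  have shift: "x * w ^ 4 + 3 * d = (x + 3 / w) * w ^ 4" "x * w ^ 4 - 3 * d = (x - 3 / w) * w ^ 4"
    unfolding dw by (simp_all add: algebra_simps)
  \<comment> \<open>From below, the tail probability of Z bounds the third difference at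
    \<open>x * w ^ 4\<close>, whose normal version is at least the scaled tail at x + 3 / w. From
    above, the difference starts 3 d lower and the roles are exchanged.\<close>
  have lower: "6 * d ^ 3 * (1 - \<Phi> (x + 3 / w)) - 8 * err \<le> 6 * d ^ 3 * p"
    using TZ(2)[of "x * w ^ 4"] TN(1)[of "x * w ^ 4"] err[OF xh'] unfolding p_def shift probN by linarith
  have upper: "6 * d ^ 3 * p \<le> 6 * d ^ 3 * (1 - \<Phi> (x - 3 / w)) + 8 * err"
  proof -
    have "x * w ^ 4 - 3 * d + 3 * d = x * w ^ 4" by simp
    then show ?thesis
      using TZ(1)[of "x * w ^ 4 - 3 * d"] TN(2)[of "x * w ^ 4 - 3 * d"] err[OF xh]
      unfolding p_def shift probN by (simp only:)
  qed
  have errle: "8 * err \<le> 6 * d ^ 3 * (324 * C * ((1 + \<bar>x\<bar>) / w) * (1 - \<Phi> x))"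
  proof -
    have "exp (- h\<^sup>2 / 2) = sqrt (2 * pi) * \<phi> h" by (simp add: std_normal_density_def)
    also have "\<dots> \<le> 3 * (9 * (1 + \<bar>x\<bar>) * (1 - \<Phi> x))"
    proof (intro mult_mono)
      show "sqrt (2 * pi) \<le> 3" using pi_less_4 by (intro real_le_lsqrt) auto
    qed (use std_normal_tail_lower[of x] in \<open>auto simp: h_def\<close>)
    finally have e: "exp (- h\<^sup>2 / 2) \<le> 27 * ((1 + \<bar>x\<bar>) * (1 - \<Phi> x))" by (simp add: algebra_simps)
    have "8 * err = 24 * w ^ 8 * C * exp (- h\<^sup>2 / 2)" by (simp add: err_def)
    also have "\<dots> \<le> 24 * w ^ 8 * C * (27 * ((1 + \<bar>x\<bar>) * (1 - \<Phi> x)))"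
      using e C0 w by (intro mult_left_mono) auto
    also have "\<dots> \<le> 6 * d ^ 3 * (324 * C * ((1 + \<bar>x\<bar>) / w) * (1 - \<Phi> x))"
    proof -
      have "d ^ 3 = w ^ 8 * w" by (simp add: d_def power_mult[symmetric] power_Suc2[symmetric])
      then have "6 * d ^ 3 * (324 * C * ((1 + \<bar>x\<bar>) / w) * (1 - \<Phi> x))
          = 1944 * (w ^ 8 * C * ((1 + \<bar>x\<bar>) * (1 - \<Phi> x)))" using w by simp
      moreover have "0 \<le> w ^ 8 * C * ((1 + \<bar>x\<bar>) * (1 - \<Phi> x))"
        using w C0 std_normal_tail_nonneg[of x] by (intro mult_nonneg_nonneg) auto
      moreover have "24 * w ^ 8 * C * (27 * ((1 + \<bar>x\<bar>) * (1 - \<Phi> x)))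
          = 648 * (w ^ 8 * C * ((1 + \<bar>x\<bar>) * (1 - \<Phi> x)))" by (simp only: mult_ac)
      ultimately show ?thesis by linarith
    qed
    finally show ?thesis .
  qed
  have d3: "0 < 6 * d ^ 3" using d0 by simp
  define E where "E = 324 * C * ((1 + \<bar>x\<bar>) / w) * (1 - \<Phi> x)"
  have up: "p \<le> 1 - \<Phi> (x - 3 / w) + E"
  proof -
    have "6 * d ^ 3 * p \<le> 6 * d ^ 3 * (1 - \<Phi> (x - 3 / w) + E)"
      using upper errle unfolding E_def distrib_left by linarith
    then show ?thesis using d3 by (simp only: mult_le_cancel_left_pos)
  qed
  have lo: "1 - \<Phi> (x + 3 / w) - E \<le> p"
  proof -
    have "6 * d ^ 3 * (1 - \<Phi> (x + 3 / w) - E) \<le> 6 * d ^ 3 * p"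
      using lower errle unfolding E_def right_diff_distrib by linarith
    then show ?thesis using d3 by (simp only: mult_le_cancel_left_pos)
  qed
  have "\<bar>p - (1 - \<Phi> x)\<bar> \<le> 243 * ((1 + \<bar>x\<bar>) / w) * (1 - \<Phi> x) + E"
    using up lo tail_up[of "3 / w"] tail_up[of "- 3 / w"] w by simp
  also have "\<dots> = md_const K * ((1 + \<bar>x\<bar>) / w) * (1 - \<Phi> x)"
    unfolding E_def md_const_def C_def by (simp add: algebra_simps)
  finally show ?thesis unfolding p_def Z_def w4 winv by simp
qed

section \<open>Symmetry of the normal law and transfer to perturbed statistics\<close>

lemma std_normal_cdf_minus: "\<Phi> (- x) = 1 - \<Phi> x"
proof -
  interpret N: real_distribution std_normal_distribution by (rule real_dist_normal_dist)
  have "distr std_normal_distribution borel uminus = std_normal_distribution"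
  proof (rule measure_eqI)
    fix A assume "A \<in> sets (distr std_normal_distribution borel uminus)"
    then have [measurable]: "A \<in> sets borel" by simp
    have [measurable]: "uminus -` A \<in> sets borel"
      using measurable_sets_borel[of uminus borel A] by simp
    have "emeasure (distr std_normal_distribution borel uminus) A
        = (\<integral>\<^sup>+z. ennreal (\<phi> z) * indicator (uminus -` A) z \<partial>lborel)"
      by (subst emeasure_distr) (auto simp: emeasure_density)
    also have "\<dots> = (\<integral>\<^sup>+z. ennreal (\<phi> (- z)) * indicator (uminus -` A) (- z) \<partial>lborel)"
      by (subst nn_integral_real_affine[of _ "- 1" 0]) auto
    also have "\<dots> = (\<integral>\<^sup>+z. ennreal (\<phi> z) * indicator A z \<partial>lborel)"
      by (intro nn_integral_cong) (simp add: std_normal_density_def indicator_def)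
    also have "\<dots> = emeasure std_normal_distribution A" by (simp add: emeasure_density)
    finally show "emeasure (distr std_normal_distribution borel uminus) A = emeasure std_normal_distribution A" .
  qed simp
  then have "\<Phi> (- x) = measure (distr std_normal_distribution borel uminus) {..- x}" by (simp add: cdf_def)
  also have "\<dots> = measure std_normal_distribution {x..}"
    by (subst measure_distr) (auto intro!: arg_cong[where f = "measure _"])
  also have "\<dots> = measure std_normal_distribution {x<..}"
  proof (rule measure_eq_AE)
    have "AE z in lborel. z \<noteq> x" by (rule AE_lborel_singleton)
    then show "AE z in std_normal_distribution. z \<in> {x..} \<longleftrightarrow> z \<in> {x<..}"
      by (subst AE_density) auto
  qed auto
  finally show ?thesis by (simp add: std_normal_tail)
qed

text \<open>The tail \<open>1 - \<Phi> x\<close> decays at most polynomially in \<open>n\<close> on the range considered, so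
  events of probability \<open>O(n powr - r)\<close> with \<open>r\<close> large are negligible there.\<close>

lemma (in prob_space) moderate_deviation_transfer:
  fixes S Z :: "nat \<Rightarrow> 'a \<Rightarrow> real" and \<rho> :: "nat \<Rightarrow> real"
  assumes rv: "\<forall>\<^sub>F n in sequentially. random_variable borel (S n) \<and> random_variable borel (Z n)"
    and S: "\<forall>\<^sub>F n in sequentially. \<forall>x. 3 * (1 + \<bar>x\<bar>) \<le> real n powr (1 / 8) \<longrightarrow>
      \<bar>prob {\<omega>\<in>space M. S n \<omega> > x} - (1 - \<Phi> x)\<bar> \<le> \<kappa> * ((1 + \<bar>x\<bar>) * real n powr (- 1 / 8)) * (1 - \<Phi> x)"
    and \<kappa>: "0 \<le> \<kappa>"
    and \<rho>: "(\<lambda>n. \<bar>\<rho> n - 1\<bar> * ln (real n)) \<longlonglongrightarrow> 0"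
    and close: "\<And>r. 0 \<le> r \<Longrightarrow> \<exists>\<eta>. (\<lambda>n. \<eta> n * sqrt (ln (real n))) \<longlonglongrightarrow> 0 \<and>
      (\<forall>\<^sub>F n in sequentially. 0 \<le> \<eta> n \<and> prob {\<omega>\<in>space M. \<bar>Z n \<omega> - \<rho> n * S n \<omega>\<bar> > \<eta> n} \<le> 16 * real n powr (- r))"
    and cA: "0 < c" "0 < A"
  shows "uniform_asymp_equiv (\<lambda>n. {- A..c * sqrt (ln (real n))}) (\<lambda>n x. \<P>(\<omega> in M. Z n \<omega> > x)) (\<lambda>x. 1 - \<Phi> x)"
  unfolding uniform_asymp_equiv_def
proof (intro allI impI)
  fix e :: real assume e: "0 < e"
  \<comment> \<open>At x = c sqrt(log n) the normal tail is of order n^(-c^2/2) up to a logarithmic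
    factor; the extra 1 makes n^(-r) smaller by almost a full power of n.\<close>
  define r where "r = c\<^sup>2 / 2 + 1"
  have r0: "0 \<le> r" by (simp add: r_def)
  obtain \<eta> where \<eta>: "(\<lambda>n. \<eta> n * sqrt (ln (real n))) \<longlonglongrightarrow> 0"
    and bad: "\<forall>\<^sub>F n in sequentially. 0 \<le> \<eta> n \<and> prob {\<omega>\<in>space M. \<bar>Z n \<omega> - \<rho> n * S n \<omega>\<bar> > \<eta> n} \<le> 16 * real n powr (- r)"
    using close[OF r0] by blast
  define l where "l n = sqrt (ln (real n))" for n :: nat
  \<comment> \<open>\<open>B n\<close> dominates 1 + |x| over the whole range, and
    \<open>\<theta> n\<close> bounds the shift of x caused by the scale \<rho> and the error \<eta>,
    the factor 2 coming from \<rho> >= 1/2. Uniformity in x thus reduces to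
    \<open>B n * \<theta> n\<close> tending to 0.\<close>
  define B where "B n = c * l n + A + 1" for n
  define \<theta> where "\<theta> n = 2 * (B n * \<bar>\<rho> n - 1\<bar> + \<eta> n)" for n
  define h where "h = c + A + 1"
  have l1: "\<forall>\<^sub>F n in sequentially. 1 \<le> l n"
  proof -
    have "\<forall>\<^sub>F n::nat in sequentially. 1 \<le> ln (real n)" by real_asymp
    then show ?thesis by eventually_elim (simp add: l_def)
  qed
  have Bl: "\<forall>\<^sub>F n in sequentially. 1 \<le> B n \<and> B n \<le> h * l n"
    using l1
  proof eventually_elim
    case (elim n)
    have "A + 1 \<le> (A + 1) * l n" "0 \<le> c * l n"
      using elim cA mult_left_mono[of 1 "l n" "A + 1"] by auto
    then show ?case using cA by (simp add: B_def h_def algebra_simps)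
  qed
  have lim\<theta>: "(\<lambda>n. B n * \<theta> n) \<longlonglongrightarrow> 0"
  proof (rule Lim_null_comparison)
    show "\<forall>\<^sub>F n in sequentially. norm (B n * \<theta> n)
        \<le> 2 * (h\<^sup>2 * (\<bar>\<rho> n - 1\<bar> * ln (real n)) + h * (\<eta> n * sqrt (ln (real n))))"
      using Bl l1 bad
    proof eventually_elim
      case (elim n)
      have l2: "l n * l n = ln (real n)" using elim unfolding l_def by simp
      have "B n * B n \<le> (h * l n) * (h * l n)" using elim by (intro mult_mono) auto
      then have "B n * B n \<le> h\<^sup>2 * ln (real n)" unfolding l2[symmetric] by (simp add: power2_eq_square mult_ac)
      then have "B n * B n * \<bar>\<rho> n - 1\<bar> \<le> h\<^sup>2 * ln (real n) * \<bar>\<rho> n - 1\<bar>" by (intro mult_right_mono) auto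
      moreover have "B n * \<eta> n \<le> h * l n * \<eta> n" using elim by (intro mult_right_mono) auto
      moreover have "0 \<le> B n * \<theta> n" unfolding \<theta>_def using elim by simp
      ultimately show ?case unfolding \<theta>_def l_def by (simp add: algebra_simps)
    qed
    have "(\<lambda>n. 2 * (h\<^sup>2 * (\<bar>\<rho> n - 1\<bar> * ln (real n)) + h * (\<eta> n * sqrt (ln (real n))))) \<longlonglongrightarrow> 2 * (h\<^sup>2 * 0 + h * 0)"
      by (intro tendsto_intros \<rho> \<eta>)
    then show "(\<lambda>n. 2 * (h\<^sup>2 * (\<bar>\<rho> n - 1\<bar> * ln (real n)) + h * (\<eta> n * sqrt (ln (real n))))) \<longlonglongrightarrow> 0" by simp
  qed
  have limn: "(\<lambda>n. B n * real n powr (- 1 / 8)) \<longlonglongrightarrow> 0"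
    unfolding B_def l_def by real_asymp
  have limn1: "(\<lambda>n. B n * real n powr (- 1)) \<longlonglongrightarrow> 0"
    unfolding B_def l_def by real_asymp
  \<comment> \<open>81 is the relative cost of moving x by d. 164 = 2 * 82, since 1 + |x + d| <= 2 B
    and the tail at x + d is at most 1 + 81 times the tail at x. 432 = 16 * 27 stems from the
    exceptional event.\<close>
  have "(\<lambda>n. 81 * (B n * \<theta> n) + 164 * \<kappa> * (B n * real n powr (- 1 / 8)) + 432 * (B n * real n powr (- 1))) \<longlonglongrightarrow> 81 * 0 + 164 * \<kappa> * 0 + 432 * 0"
    by (intro tendsto_intros lim\<theta> limn limn1)
  then have err: "\<forall>\<^sub>F n in sequentially.
      81 * (B n * \<theta> n) + 164 * \<kappa> * (B n * real n powr (- 1 / 8)) + 432 * (B n * real n powr (- 1)) < e"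
    using e by (intro order_tendstoD(2)) simp_all
  have \<rho>lim: "\<forall>\<^sub>F n in sequentially. \<bar>\<rho> n - 1\<bar> * ln (real n) < 1 / 2"
    using \<rho> by (rule order_tendstoD(2)) simp
  have small8: "\<forall>\<^sub>F n in sequentially. B n * real n powr (- 1 / 8) < 1 / 6"
    using limn by (rule order_tendstoD(2)) simp
  have small\<theta>: "\<forall>\<^sub>F n in sequentially. B n * \<theta> n < 1"
    using lim\<theta> by (rule order_tendstoD(2)) simp
  show "\<forall>\<^sub>F n in sequentially. \<forall>x\<in>{- A..c * sqrt (ln (real n))}.
      \<bar>\<P>(\<omega> in M. Z n \<omega> > x) - (1 - \<Phi> x)\<bar> \<le> e * \<bar>1 - \<Phi> x\<bar>"
    using rv S bad l1 Bl err \<rho>lim small8 small\<theta> eventually_gt_at_top[of 1]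
  proof eventually_elim
    case (elim n)
    have [measurable]: "random_variable borel (S n)" "random_variable borel (Z n)" using elim by auto
    have n: "real n > 1" using elim by simp
    have ln1: "1 \<le> ln (real n)" using elim unfolding l_def by simp
    have "\<bar>\<rho> n - 1\<bar> * 1 \<le> \<bar>\<rho> n - 1\<bar> * ln (real n)" using ln1 by (intro mult_left_mono) auto
    then have "\<bar>\<rho> n - 1\<bar> < 1 / 2" using elim(7) by simp
    then have \<rho>h: "1 / 2 \<le> \<rho> n" unfolding abs_less_iff by simp
    have B1: "1 \<le> B n" and \<eta>0: "0 \<le> \<eta> n" using elim(3,5) by auto
    have \<rho>0: "0 < \<rho> n" using \<rho>h by simp
    show ?case
    proof
      fix x assume x: "x \<in> {- A..c * sqrt (ln (real n))}"
      have xB: "1 + \<bar>x\<bar> \<le> B n" 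
      proof -
        have "0 \<le> c * l n" using cA elim(4) by simp
        then show ?thesis using x cA unfolding B_def l_def[symmetric] by (auto simp: abs_if)
      qed
      define \<Psi> where "\<Psi> = 1 - \<Phi> x"
      have \<Psi>0: "0 \<le> \<Psi>" unfolding \<Psi>_def by (rule std_normal_tail_nonneg)
      have \<theta>0: "0 \<le> \<theta> n" using B1 \<eta>0 by (simp add: \<theta>_def)
      have \<theta>1: "\<theta> n \<le> 1"
      proof -
        have "1 * \<theta> n \<le> B n * \<theta> n" using \<theta>0 B1 by (intro mult_right_mono) auto
        then show ?thesis using elim(9) by linarith
      qed
      \<comment> \<open>Up to the exceptional event, Z > x is enclosed between S > (x + \<eta>) /
        \<rho> and S > (x - \<eta>) / \<rho>. Both thresholds have the form x + d with |d| <=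
        \<open>\<theta> n\<close>.\<close>
      have approx: "\<bar>prob {\<omega>\<in>space M. S n \<omega> > (x + s) / \<rho> n} - \<Psi>\<bar>
          \<le> (81 * (B n * \<theta> n) + 164 * \<kappa> * (B n * real n powr (- 1 / 8))) * \<Psi>"
        if s: "\<bar>s\<bar> = \<eta> n" for s
      proof -
        define d where "d = (x * (1 - \<rho> n) + s) / \<rho> n"
        have xd: "(x + s) / \<rho> n = x + d" using \<rho>0 by (simp add: d_def field_simps)
        have "\<bar>d\<bar> = \<bar>x * (1 - \<rho> n) + s\<bar> / \<rho> n" using \<rho>0 by (simp add: d_def)
        also have "\<dots> \<le> \<bar>x * (1 - \<rho> n) + s\<bar> / (1 / 2)" using \<rho>h by (intro divide_left_mono) auto
        also have "\<dots> \<le> 2 * (\<bar>x\<bar> * \<bar>\<rho> n - 1\<bar> + \<eta> n)"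
          using abs_triangle_ineq[of "x * (1 - \<rho> n)" s] s by (simp add: abs_mult abs_minus_commute)
        also have "\<dots> \<le> \<theta> n" unfolding \<theta>_def using xB by (intro mult_left_mono add_right_mono mult_right_mono) auto
        finally have d\<theta>: "\<bar>d\<bar> \<le> \<theta> n" .
        have xd\<theta>: "(1 + \<bar>x\<bar>) * \<bar>d\<bar> \<le> B n * \<theta> n" using xB d\<theta> B1 by (intro mult_mono) auto
        have "\<bar>\<Phi> (x + d) - \<Phi> x\<bar> \<le> 81 * ((1 + \<bar>x\<bar>) * \<bar>d\<bar>) * \<Psi>"
          unfolding \<Psi>_def using xd\<theta> elim(9) by (intro std_normal_cdf_perturb) linarith
        also have "\<dots> \<le> 81 * (B n * \<theta> n) * \<Psi>" using xd\<theta> \<Psi>0 by (intro mult_right_mono mult_left_mono) auto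
        finally have 1: "\<bar>\<Phi> (x + d) - \<Phi> x\<bar> \<le> 81 * (B n * \<theta> n) * \<Psi>" .
        also have "\<dots> \<le> 81 * 1 * \<Psi>" using elim(9) \<Psi>0 by (intro mult_right_mono mult_left_mono) auto
        finally have "\<bar>\<Phi> (x + d) - \<Phi> x\<bar> \<le> 81 * \<Psi>" by simp
        then have tail: "1 - \<Phi> (x + d) \<le> 82 * \<Psi>" unfolding \<Psi>_def abs_le_iff by argo
        have xd2: "1 + \<bar>x + d\<bar> \<le> 2 * B n"
        proof -
          have "\<bar>x + d\<bar> \<le> \<bar>x\<bar> + 1" using d\<theta> \<theta>1 by linarith
          then show ?thesis using xB by linarith
        qed
        have "3 * (1 + \<bar>x + d\<bar>) \<le> 6 * B n" using xd2 by argo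
        also have "\<dots> \<le> real n powr (1 / 8)"
        proof -
          have "6 * (B n * real n powr (- 1 / 8)) \<le> 1" using elim(8) by linarith
          then have "6 * (B n * real n powr (- 1 / 8)) * real n powr (1 / 8) \<le> 1 * real n powr (1 / 8)"
            by (intro mult_right_mono) auto
          moreover have "real n powr (- 1 / 8) * real n powr (1 / 8) = 1"
            using n by (simp add: powr_add[symmetric])
          ultimately show ?thesis by (simp add: mult.assoc)
        qed
        finally have "\<bar>prob {\<omega>\<in>space M. S n \<omega> > x + d} - (1 - \<Phi> (x + d))\<bar>
            \<le> \<kappa> * ((1 + \<bar>x + d\<bar>) * real n powr (- 1 / 8)) * (1 - \<Phi> (x + d))"
          using elim(2) by blast
        also have "\<dots> \<le> \<kappa> * (2 * B n * real n powr (- 1 / 8)) * (82 * \<Psi>)"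
          using \<kappa> xd2 tail std_normal_tail_nonneg[of "x + d"] B1
          by (intro mult_mono mult_left_mono mult_right_mono) auto
        finally have 2: "\<bar>prob {\<omega>\<in>space M. S n \<omega> > x + d} - (1 - \<Phi> (x + d))\<bar>
            \<le> 164 * \<kappa> * (B n * real n powr (- 1 / 8)) * \<Psi>" by (simp add: mult_ac)
        have "\<bar>prob {\<omega>\<in>space M. S n \<omega> > x + d} - \<Psi>\<bar>
            \<le> \<bar>prob {\<omega>\<in>space M. S n \<omega> > x + d} - (1 - \<Phi> (x + d))\<bar> + \<bar>\<Phi> (x + d) - \<Phi> x\<bar>"
          unfolding \<Psi>_def by simp
        then show ?thesis unfolding xd distrib_right using 1 2 by linarith
      qed
      define bp where "bp = prob {\<omega>\<in>space M. \<bar>Z n \<omega> - \<rho> n * S n \<omega>\<bar> > \<eta> n}"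
      have bp: "bp \<le> 432 * (B n * real n powr (- 1)) * \<Psi>"
      proof -
        define y where "y = max x 0"
        have "y\<^sup>2 \<le> (c * sqrt (ln (real n)))\<^sup>2" using x cA ln1 unfolding y_def by (intro power_mono) (auto simp: max_def)
        also have "\<dots> = c\<^sup>2 * ln (real n)" using ln1 by (simp add: power_mult_distrib)
        finally have "- (c\<^sup>2 / 2) * ln (real n) \<le> - y\<^sup>2 / 2" by simp
        then have "real n powr (- (c\<^sup>2 / 2)) \<le> exp (- y\<^sup>2 / 2)" using n by (simp add: powr_def)
        also have "\<dots> = sqrt (2 * pi) * \<phi> y" by (simp add: std_normal_density_def)
        also have "\<dots> \<le> 3 * (9 * (1 + \<bar>x\<bar>) * (1 - \<Phi> x))"
        proof (intro mult_mono)
          show "sqrt (2 * pi) \<le> 3" using pi_less_4 by (intro real_le_lsqrt) auto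
        qed (use std_normal_tail_lower[of x] in \<open>auto simp: y_def\<close>)
        also have "\<dots> \<le> 27 * (B n * \<Psi>)"
        proof -
          have "(1 + \<bar>x\<bar>) * \<Psi> \<le> B n * \<Psi>" using xB \<Psi>0 by (intro mult_right_mono) auto
          then show ?thesis unfolding \<Psi>_def by (simp add: algebra_simps)
        qed
        finally have low: "real n powr (- (c\<^sup>2 / 2)) \<le> 27 * (B n * \<Psi>)" .
        have "bp \<le> 16 * real n powr (- r)" using elim(3) by (simp add: bp_def)
        also have "real n powr (- r) = real n powr (- (c\<^sup>2 / 2)) * real n powr (- 1)"
        proof -
          have "- r = - (c\<^sup>2 / 2) + - 1" by (simp add: r_def)
          then show ?thesis by (simp only: powr_add)
        qed
        also have "16 * \<dots> \<le> 16 * (27 * (B n * \<Psi>) * real n powr (- 1))"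
          using low by (intro mult_left_mono mult_right_mono) auto
        finally show ?thesis by (simp add: mult_ac)
      qed
      have "prob {\<omega>\<in>space M. Z n \<omega> > x}
          \<le> prob ({\<omega>\<in>space M. S n \<omega> > (x + - \<eta> n) / \<rho> n} \<union> {\<omega>\<in>space M. \<bar>Z n \<omega> - \<rho> n * S n \<omega>\<bar> > \<eta> n})"
        using \<rho>0 by (intro finite_measure_mono) (auto simp: field_simps abs_if)
      also have "\<dots> \<le> prob {\<omega>\<in>space M. S n \<omega> > (x + - \<eta> n) / \<rho> n} + bp"
        unfolding bp_def by (intro measure_Un_le) measurable
      finally have up: "prob {\<omega>\<in>space M. Z n \<omega> > x} \<le> prob {\<omega>\<in>space M. S n \<omega> > (x + - \<eta> n) / \<rho> n} + bp" .
      have "prob {\<omega>\<in>space M. S n \<omega> > (x + \<eta> n) / \<rho> n}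
          \<le> prob ({\<omega>\<in>space M. Z n \<omega> > x} \<union> {\<omega>\<in>space M. \<bar>Z n \<omega> - \<rho> n * S n \<omega>\<bar> > \<eta> n})"
        using \<rho>0 by (intro finite_measure_mono) (auto simp: field_simps abs_if)
      also have "\<dots> \<le> prob {\<omega>\<in>space M. Z n \<omega> > x} + bp"
        unfolding bp_def by (intro measure_Un_le) measurable
      finally have lo: "prob {\<omega>\<in>space M. S n \<omega> > (x + \<eta> n) / \<rho> n} \<le> prob {\<omega>\<in>space M. Z n \<omega> > x} + bp" .
      have "\<bar>prob {\<omega>\<in>space M. Z n \<omega> > x} - \<Psi>\<bar>
          \<le> (81 * (B n * \<theta> n) + 164 * \<kappa> * (B n * real n powr (- 1 / 8))) * \<Psi> + 432 * (B n * real n powr (- 1)) * \<Psi>"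
        using up lo bp approx[of "\<eta> n"] approx[of "- \<eta> n"] \<eta>0 by simp
      also have "\<dots> = (81 * (B n * \<theta> n) + 164 * \<kappa> * (B n * real n powr (- 1 / 8)) + 432 * (B n * real n powr (- 1))) * \<Psi>"
        by (simp only: distrib_right)
      also have "\<dots> \<le> e * \<Psi>" using elim(6) \<Psi>0 by (intro mult_right_mono) auto
      finally show "\<bar>\<P>(\<omega> in M. Z n \<omega> > x) - (1 - \<Phi> x)\<bar> \<le> e * \<bar>1 - \<Phi> x\<bar>"
        using \<Psi>0 unfolding \<Psi>_def by simp
    qed
  qed
qed

subsection \<open>Quantiles and second moments\<close>

context cdf_distribution
begin

lemma quantile_eq_pseudoinverse: "u \<noteq> 0 \<Longrightarrow> quantile C u = I u"
  by (simp add: quantile_def)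

lemma quantile_le_iff:
  assumes "0 < u" "u < 1"
  shows "quantile C u \<le> x \<longleftrightarrow> u \<le> C x"
proof -
  have "quantile C u = I u" using assms by (intro quantile_eq_pseudoinverse) auto
  then show ?thesis using pseudoinverse[OF assms, of x] by (simp only:)
qed

lemma le_cdf_quantile: "0 < u \<Longrightarrow> u < 1 \<Longrightarrow> u \<le> C (quantile C u)"
  by (rule quantile_le_iff[THEN iffD1]) auto

lemma quantile_mono:
  assumes "0 < u" "u \<le> v" "v < 1"
  shows "quantile C u \<le> quantile C v"
proof -
  have "u \<le> C (quantile C v)" using le_cdf_quantile[of v] assms by linarith
  then show ?thesis using quantile_le_iff[of u] assms by auto
qed

text \<open>Companion of \<open>le_cdf_quantile\<close>: for the u-quantile q, P(X < q) <= u <= P(X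
  <= q). If q is an atom, the two probabilities differ, which is why both kinds of counts occur
  later. The bound is a left limit of the distribution function.\<close>

lemma measure_less_quantile:
  assumes "0 < u" "u < 1"
  shows "prob {..<quantile C u} \<le> u"
proof (rule tendsto_upperbound)
  show "(C \<longlongrightarrow> prob {..<quantile C u}) (at_left (quantile C u))" by (rule cdf_at_left)
  have "C x \<le> u" if "x < quantile C u" for x
    using quantile_le_iff[OF assms, of x] that by linarith
  then show "\<forall>\<^sub>F x in at_left (quantile C u). C x \<le> u"
    by (auto simp: eventually_at_left_field intro!: exI[of _ "quantile C u - 1"])
qed simp

text \<open>Inverse transform sampling: the quantile function applied to a uniform variable has the
  given law.\<close>

lemma integral_quantile_transform:
  fixes g :: "real \<Rightarrow> real"
  assumes [measurable]: "g \<in> borel_measurable borel"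
  shows "expectation g = (\<integral>u. indicator {0<..<1} u * g (quantile C u) \<partial>lborel)"
proof -
  have "expectation g = (\<integral>u. g (I u) \<partial>restrict_space lborel {0<..<1})"
  proof -
    have "expectation g = (\<integral>x. g x \<partial>distr (restrict_space lborel {0<..<1::real}) borel I)"
      unfolding distr_I_eq_M ..
    also have "\<dots> = (\<integral>u. g (I u) \<partial>restrict_space lborel {0<..<1})"
      by (rule integral_distr) simp_all
    finally show ?thesis .
  qed
  also have "\<dots> = (\<integral>u. indicator {0<..<1} u *\<^sub>R g (I u) \<partial>lborel)"
    by (rule integral_restrict_space) simp
  also have "\<dots> = (\<integral>u. indicator {0<..<1} u * g (quantile C u) \<partial>lborel)"
    by (intro Bochner_Integration.integral_cong) (auto simp: indicator_def quantile_eq_pseudoinverse)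
  finally show ?thesis .
qed

lemma borel_measurable_winsorize: "winsorize a b \<in> borel_measurable borel"
  unfolding winsorize_def by measurable

text \<open>Evaluated at the u-quantile, the Winsorized value is a for u <= \<alpha>, the quantile
  itself in between, and b for u >= 1 - \<beta>. This needs only monotonicity, so jumps and flat
  stretches of the distribution function cause no correction term.\<close>

lemma expectation_winsorized:
  assumes "0 < \<alpha>" "\<alpha> < 1 - \<beta>" "1 - \<beta> < 1"
  defines "a \<equiv> quantile C \<alpha>" and "b \<equiv> quantile C (1 - \<beta>)"
  shows "expectation (winsorize a b) = \<alpha> * a + trimmed_centering C \<alpha> \<beta> + \<beta> * b"
proof -
  let ?q = "quantile C"
  have ab: "a \<le> b" unfolding a_def b_def using assms by (intro quantile_mono) auto
  have low: "winsorize a b (?q u) = a" if "0 < u" "u \<le> \<alpha>" for u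
    using that quantile_mono[of u \<alpha>] assms(1-3) unfolding winsorize_def a_def by auto
  have high: "winsorize a b (?q u) = b" if "1 - \<beta> \<le> u" "u < 1" for u
    using that quantile_mono[of "1 - \<beta>" u] ab assms(1-3) unfolding winsorize_def b_def by auto
  have mid: "winsorize a b (?q u) = ?q u" if "\<alpha> < u" "u < 1 - \<beta>" for u
    using that quantile_mono[of \<alpha> u] quantile_mono[of u "1 - \<beta>"] assms(1-3)
    unfolding winsorize_def a_def b_def by auto
  have split: "indicator {0<..<1} u * winsorize a b (?q u)
      = a * indicator {0<..\<alpha>} u + indicator {\<alpha><..<1 - \<beta>} u * ?q u + b * indicator {1 - \<beta>..<1} u" for u
  proof -
    consider "u \<le> 0" | "0 < u" "u \<le> \<alpha>" | "\<alpha> < u" "u < 1 - \<beta>" | "1 - \<beta> \<le> u" "u < 1" | "1 \<le> u"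
      by linarith
    then show ?thesis
      using low[of u] high[of u] mid[of u] assms(1-3) by cases (simp_all add: indicator_def)
  qed
  \<comment> \<open>The available measurability fact concerns \<open>I\<close> on (0, 1) only, so it
    is used for the product with the indicator of a subinterval.\<close>
  have "(\<lambda>u. indicator {0<..<1} u *\<^sub>R I u) \<in> borel_measurable borel"
    using measurable_CI by (subst (asm) borel_measurable_restrict_space_iff) simp_all
  then have "(\<lambda>u. indicator {\<alpha><..<1 - \<beta>} u * (indicator {0<..<1} u *\<^sub>R I u)) \<in> borel_measurable borel"
    by simp
  moreover have "indicator {\<alpha><..<1 - \<beta>} u * (indicator {0<..<1} u *\<^sub>R I u)
      = indicator {\<alpha><..<1 - \<beta>} u * ?q u" for u
    using assms(1-3) quantile_eq_pseudoinverse[of u] by (simp add: indicator_def)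
  ultimately have meas: "(\<lambda>u. indicator {\<alpha><..<1 - \<beta>} u * ?q u) \<in> borel_measurable borel"
    by (simp only:)
  have int: "integrable lborel (\<lambda>u. indicator {\<alpha><..<1 - \<beta>} u * ?q u)"
  proof (rule Bochner_Integration.integrable_bound)
    show "integrable lborel (\<lambda>u. (\<bar>a\<bar> + \<bar>b\<bar>) * indicator {\<alpha><..<1 - \<beta>} u)"
      using assms(1-3) by (intro integrable_mult_right integrable_real_indicator) auto
    have "\<bar>?q u\<bar> \<le> \<bar>a\<bar> + \<bar>b\<bar>" if "\<alpha> < u" "u < 1 - \<beta>" for u
      using that quantile_mono[of \<alpha> u] quantile_mono[of u "1 - \<beta>"] assms(1-3)
      unfolding a_def b_def by auto
    then show "AE u in lborel. norm (indicator {\<alpha><..<1 - \<beta>} u * ?q u)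
        \<le> norm ((\<bar>a\<bar> + \<bar>b\<bar>) * indicator {\<alpha><..<1 - \<beta>} u)"
      by (intro AE_I2) (auto simp: indicator_def)
  qed (use meas in simp)
  have inta: "integrable lborel (\<lambda>u. a * indicator {0<..\<alpha>} u)" "integrable lborel (\<lambda>u. b * indicator {1 - \<beta>..<1} u)"
    using assms(1-3) by (intro integrable_mult_right integrable_real_indicator; simp)+
  have "expectation (winsorize a b) = (\<integral>u. a * indicator {0<..\<alpha>} u \<partial>lborel)
      + (\<integral>u. indicator {\<alpha><..<1 - \<beta>} u * ?q u \<partial>lborel) + (\<integral>u. b * indicator {1 - \<beta>..<1} u \<partial>lborel)"
    unfolding integral_quantile_transform[OF borel_measurable_winsorize] split using int inta by simp
  also have "\<dots> = \<alpha> * a + trimmed_centering C \<alpha> \<beta> + \<beta> * b"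
    using assms(1-3) unfolding trimmed_centering_def
    by (simp add: interval_lebesgue_integral_def set_lebesgue_integral_def)
  finally show ?thesis .
qed

end

section \<open>Second moments and standard deviations\<close>

context prob_space
begin

lemma integrable_mult_of_squares:
  fixes X Y :: "'a \<Rightarrow> real"
  assumes [measurable]: "random_variable borel X" "random_variable borel Y"
    and "integrable M (\<lambda>\<omega>. (X \<omega>)\<^sup>2)" "integrable M (\<lambda>\<omega>. (Y \<omega>)\<^sup>2)"
  shows "integrable M (\<lambda>\<omega>. X \<omega> * Y \<omega>)"
proof (rule Bochner_Integration.integrable_bound)
  show "integrable M (\<lambda>\<omega>. (X \<omega>)\<^sup>2 + (Y \<omega>)\<^sup>2)" using assms by simp
  have "\<bar>X \<omega> * Y \<omega>\<bar> \<le> (X \<omega>)\<^sup>2 + (Y \<omega>)\<^sup>2" for \<omega>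
  proof -
    have "2 * (\<bar>X \<omega>\<bar> * \<bar>Y \<omega>\<bar>) \<le> (X \<omega>)\<^sup>2 + (Y \<omega>)\<^sup>2"
      using sum_squares_bound[of "\<bar>X \<omega>\<bar>" "\<bar>Y \<omega>\<bar>"] by (simp add: mult.assoc)
    moreover have "0 \<le> \<bar>X \<omega>\<bar> * \<bar>Y \<omega>\<bar>" by simp
    ultimately show ?thesis unfolding abs_mult by linarith
  qed
  then show "AE \<omega> in M. norm (X \<omega> * Y \<omega>) \<le> norm ((X \<omega>)\<^sup>2 + (Y \<omega>)\<^sup>2)" by simp
qed simp

lemma integrable_of_square:
  fixes X :: "'a \<Rightarrow> real"
  assumes [measurable]: "random_variable borel X" and "integrable M (\<lambda>\<omega>. (X \<omega>)\<^sup>2)"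
  shows "integrable M X"
  using integrable_mult_of_squares[of X "\<lambda>_. 1"] assms by simp

lemma integrable_square_add:
  fixes X Y :: "'a \<Rightarrow> real"
  assumes [measurable]: "random_variable borel X" "random_variable borel Y"
    and "integrable M (\<lambda>\<omega>. (X \<omega>)\<^sup>2)" "integrable M (\<lambda>\<omega>. (Y \<omega>)\<^sup>2)"
  shows "integrable M (\<lambda>\<omega>. (X \<omega> + Y \<omega>)\<^sup>2)"
  unfolding power2_sum using assms integrable_mult_of_squares[OF assms]
  by (simp add: mult.assoc)

lemma variance_sum_indep:
  fixes Y :: "'i \<Rightarrow> 'a \<Rightarrow> real"
  assumes "finite I" "indep_vars (\<lambda>_. borel) Y I" "\<And>i. i \<in> I \<Longrightarrow> integrable M (\<lambda>\<omega>. (Y i \<omega>)\<^sup>2)"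
  shows "integrable M (\<lambda>\<omega>. (\<Sum>i\<in>I. Y i \<omega>)\<^sup>2) \<and> variance (\<lambda>\<omega>. \<Sum>i\<in>I. Y i \<omega>) = (\<Sum>i\<in>I. variance (Y i))"
  using assms
proof (induction I)
  case (insert i I)
  let ?S = "\<lambda>\<omega>. \<Sum>i\<in>I. Y i \<omega>"
  have rv: "random_variable borel (Y j)" if "j \<in> insert i I" for j
    using insert(4) that unfolding indep_vars_def by auto
  have IH: "integrable M (\<lambda>\<omega>. (?S \<omega>)\<^sup>2)" "variance ?S = (\<Sum>i\<in>I. variance (Y i))"
    using insert indep_vars_subset[OF insert(4)] by auto
  have Yi [measurable]: "random_variable borel (Y i)" and S [measurable]: "random_variable borel ?S"
    using rv by auto
  have Y2: "integrable M (\<lambda>\<omega>. (Y i \<omega>)\<^sup>2)" using insert by auto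
  note intY = integrable_of_square[OF Yi Y2] and intS = integrable_of_square[OF S IH(1)]
  have ind: "indep_var borel (Y i) borel ?S" using insert by (intro indep_vars_sum) auto
  have prod: "expectation (\<lambda>\<omega>. Y i \<omega> * ?S \<omega>) = expectation (Y i) * expectation ?S"
    using indep_var_lebesgue_integral[OF ind intY intS] .
  have sq: "integrable M (\<lambda>\<omega>. (Y i \<omega> + ?S \<omega>)\<^sup>2)" by (rule integrable_square_add[OF Yi S Y2 IH(1)])
  have "expectation (\<lambda>\<omega>. (Y i \<omega> + ?S \<omega>)\<^sup>2)
      = expectation (\<lambda>\<omega>. (Y i \<omega>)\<^sup>2) + expectation (\<lambda>\<omega>. (?S \<omega>)\<^sup>2) + 2 * (expectation (Y i) * expectation ?S)"
    unfolding power2_sum prod[symmetric]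
    using integrable_mult_of_squares[OF Yi S Y2 IH(1)] Y2 IH(1) by (simp add: mult.assoc)
  then have "variance (\<lambda>\<omega>. Y i \<omega> + ?S \<omega>) = variance (Y i) + variance ?S"
    using variance_eq[OF Bochner_Integration.integrable_add[OF intY intS] sq] variance_eq[OF intY Y2] variance_eq[OF intS IH(1)]
      intY intS
    by (simp add: power2_sum)
  then show ?case using sq IH(2) insert(1,2) by simp
qed simp

text \<open>Minkowski's inequality in L2 for the centred variables, together with Var Y <= E Y^2. No
  independence of X and Y is involved, as the remainder depends on the whole sample. Comparing
  standard deviations rather than variances gives the rate of their ratio directly.\<close>

lemma sd_add_bound:
  fixes X Y :: "'a \<Rightarrow> real"
  assumes X: "random_variable borel X" and Y: "random_variable borel Y"
    and X2: "integrable M (\<lambda>\<omega>. (X \<omega>)\<^sup>2)" and Y2: "integrable M (\<lambda>\<omega>. (Y \<omega>)\<^sup>2)"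
  shows "\<bar>sqrt (variance (\<lambda>\<omega>. X \<omega> + Y \<omega>)) - sqrt (variance X)\<bar> \<le> sqrt (expectation (\<lambda>\<omega>. (Y \<omega>)\<^sup>2))"
proof -
  define U where "U \<omega> = X \<omega> - expectation X" for \<omega>
  define V where "V \<omega> = Y \<omega> - expectation Y" for \<omega>
  have mX: "integrable M X" and mY: "integrable M Y" using assms by (auto intro: integrable_of_square)
  have rU: "random_variable borel U" and rV: "random_variable borel V"
    unfolding U_def V_def using X Y by auto
  have U2: "integrable M (\<lambda>\<omega>. (U \<omega>)\<^sup>2)"
    unfolding U_def using integrable_square_add[OF X _ X2, of "\<lambda>_. - expectation X"] by simp
  have V2: "integrable M (\<lambda>\<omega>. (V \<omega>)\<^sup>2)"
    unfolding V_def using integrable_square_add[OF Y _ Y2, of "\<lambda>_. - expectation Y"] by simp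
  have UV: "integrable M (\<lambda>\<omega>. U \<omega> * V \<omega>)" by (rule integrable_mult_of_squares[OF rU rV U2 V2])
  define A where "A = expectation (\<lambda>\<omega>. (U \<omega>)\<^sup>2)"
  define B where "B = expectation (\<lambda>\<omega>. (V \<omega>)\<^sup>2)"
  define P where "P = expectation (\<lambda>\<omega>. U \<omega> * V \<omega>)"
  have A0: "0 \<le> A" and B0: "0 \<le> B" unfolding A_def B_def by (auto intro: integral_nonneg_AE)
  \<comment> \<open>Cauchy-Schwarz will follow from this quadratic form: with s = P, t = - A if A >
    0, and with s = - (B + 1) / P, t = 1 to refute A = 0 with P nonzero.\<close>
  have quad: "0 \<le> s\<^sup>2 * A + 2 * s * t * P + t\<^sup>2 * B" for s t
  proof -
    have "0 \<le> expectation (\<lambda>\<omega>. (s * U \<omega> + t * V \<omega>)\<^sup>2)" by (intro integral_nonneg_AE) auto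
    also have "(\<lambda>\<omega>. (s * U \<omega> + t * V \<omega>)\<^sup>2) = (\<lambda>\<omega>. s\<^sup>2 * (U \<omega>)\<^sup>2 + 2 * s * t * (U \<omega> * V \<omega>) + t\<^sup>2 * (V \<omega>)\<^sup>2)"
      by (auto simp: power2_eq_square algebra_simps)
    also have "expectation \<dots> = s\<^sup>2 * A + 2 * s * t * P + t\<^sup>2 * B"
      unfolding A_def B_def P_def using U2 V2 UV by simp
    finally show ?thesis .
  qed
  have CS: "\<bar>P\<bar> \<le> sqrt A * sqrt B"
  proof -
    have "P\<^sup>2 \<le> A * B"
    proof (cases "A = 0")
      case False
      then have "0 < A" using A0 by simp
      have "0 \<le> P\<^sup>2 * A + 2 * P * (- A) * P + (- A)\<^sup>2 * B" by (rule quad)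
      also have "\<dots> = A * (A * B - P\<^sup>2)" by (simp add: power2_eq_square algebra_simps)
      finally show ?thesis using \<open>0 < A\<close> by (simp add: zero_le_mult_iff)
    next
      case True
      have "P = 0"
      proof (rule ccontr)
        assume "P \<noteq> 0"
        have "0 \<le> 2 * (- (B + 1) / P) * 1 * P + B"
          using quad[of "- (B + 1) / P" 1] True by simp
        then show False using \<open>P \<noteq> 0\<close> B0 by simp
      qed
      then show ?thesis using True by simp
    qed
    then have "sqrt (P\<^sup>2) \<le> sqrt (A * B)" by (rule real_sqrt_le_mono)
    then show ?thesis by (simp add: real_sqrt_mult)
  qed
  have var: "variance (\<lambda>\<omega>. X \<omega> + Y \<omega>) = A + 2 * P + B"
  proof -
    have "variance (\<lambda>\<omega>. X \<omega> + Y \<omega>) = expectation (\<lambda>\<omega>. (U \<omega>)\<^sup>2 + 2 * (U \<omega> * V \<omega>) + (V \<omega>)\<^sup>2)"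
      unfolding U_def V_def using mX mY
      by (intro Bochner_Integration.integral_cong) (auto simp: power2_eq_square algebra_simps)
    also have "\<dots> = A + 2 * P + B" unfolding A_def B_def P_def using U2 V2 UV by simp
    finally show ?thesis .
  qed
  have varX: "variance X = A" by (simp add: A_def U_def)
  have "(sqrt A - sqrt B)\<^sup>2 \<le> A + 2 * P + B" "A + 2 * P + B \<le> (sqrt A + sqrt B)\<^sup>2"
    using CS A0 B0 by (auto simp: power2_sum power2_diff)
  then have "sqrt (A + 2 * P + B) \<le> sqrt A + sqrt B" "\<bar>sqrt A - sqrt B\<bar> \<le> sqrt (A + 2 * P + B)"
  proof -
    have "sqrt (A + 2 * P + B) \<le> sqrt ((sqrt A + sqrt B)\<^sup>2)"
      using \<open>A + 2 * P + B \<le> _\<close> by (rule real_sqrt_le_mono)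
    then show "sqrt (A + 2 * P + B) \<le> sqrt A + sqrt B" using A0 B0 by simp
    have "sqrt ((sqrt A - sqrt B)\<^sup>2) \<le> sqrt (A + 2 * P + B)"
      using \<open>_ \<le> A + 2 * P + B\<close> by (rule real_sqrt_le_mono)
    then show "\<bar>sqrt A - sqrt B\<bar> \<le> sqrt (A + 2 * P + B)" by simp
  qed
  then have "\<bar>sqrt (A + 2 * P + B) - sqrt A\<bar> \<le> sqrt B" by linarith
  moreover have "B \<le> expectation (\<lambda>\<omega>. (Y \<omega>)\<^sup>2)"
    using variance_eq[OF mY Y2] unfolding B_def V_def by simp
  then have "sqrt B \<le> sqrt (expectation (\<lambda>\<omega>. (Y \<omega>)\<^sup>2))" by (rule real_sqrt_le_mono)
  ultimately show ?thesis unfolding var varX by linarith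
qed

end

subsection \<open>Order statistics\<close>

lemma order_stat_mono:
  assumes "1 \<le> i" "i \<le> j" "j \<le> n"
  shows "order_stat X n i \<omega> \<le> order_stat X n j \<omega>"
  unfolding order_stat_def using assms by (intro sorted_nth_mono) auto

lemma sum_order_stat:
  fixes g :: "real \<Rightarrow> 'b::comm_monoid_add"
  shows "(\<Sum>i = 1..n. g (order_stat X n i \<omega>)) = (\<Sum>i = 1..n. g (X i \<omega>))"
proof -
  let ?xs = "map (\<lambda>j. X j \<omega>) [1..<n + 1]"
  have "(\<Sum>i = 1..n. g (order_stat X n i \<omega>)) = (\<Sum>i<n. g (sort ?xs ! i))"
    unfolding order_stat_def by (rule sum.reindex_bij_witness[of _ Suc "\<lambda>i. i - 1"]) auto
  also have "\<dots> = sum_list (map g (sort ?xs))"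
    by (simp add: sum_list_sum_nth atLeast0LessThan del: upt_Suc)
  also have "\<dots> = sum_mset (image_mset g (mset (sort ?xs)))"
    by (simp only: mset_map[symmetric] sum_mset_sum_list)
  also have "\<dots> = sum_mset (image_mset g (mset ?xs))" by (simp only: mset_sort)
  also have "\<dots> = sum_list (map g ?xs)" by (simp only: mset_map[symmetric] sum_mset_sum_list)
  also have "\<dots> = (\<Sum>i = 1..n. g (X i \<omega>))"
    by (simp add: interv_sum_list_conv_sum_set_nat o_def atLeastLessThanSuc_atLeastAtMost del: upt_Suc)
  finally show ?thesis .
qed

definition count_le :: "(nat \<Rightarrow> 'a \<Rightarrow> real) \<Rightarrow> nat \<Rightarrow> real \<Rightarrow> 'a \<Rightarrow> real" where
  "count_le X n u \<omega> = (\<Sum>i = 1..n. indicator {..u} (X i \<omega>))"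

definition count_less :: "(nat \<Rightarrow> 'a \<Rightarrow> real) \<Rightarrow> nat \<Rightarrow> real \<Rightarrow> 'a \<Rightarrow> real" where
  "count_less X n u \<omega> = (\<Sum>i = 1..n. indicator {..<u} (X i \<omega>))"

text \<open>Stated for an arbitrary lower set so that \<open>{..u}\<close> and \<open>{..<u}\<close>
  are both instances; the sorted values inside a lower set form an initial segment, so only their
  number matters.\<close>

lemma order_stat_in_lower_set_iff:
  assumes j: "1 \<le> j" "j \<le> n" and A: "\<And>x y. x \<le> y \<Longrightarrow> y \<in> A \<Longrightarrow> x \<in> A"
  shows "order_stat X n j \<omega> \<in> A \<longleftrightarrow> real j \<le> (\<Sum>i = 1..n. indicator A (X i \<omega>))"
proof -
  let ?q = "\<lambda>i. order_stat X n i \<omega>"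
  let ?N = "\<Sum>i = 1..n. indicator A (X i \<omega>) :: real"
  have count: "?N = (\<Sum>i = 1..n. indicator A (?q i))"
    by (rule sum_order_stat[symmetric])
  show ?thesis
  proof
    assume q: "?q j \<in> A"
    have "real j = (\<Sum>i = 1..j. 1)" by simp
    also have "\<dots> \<le> (\<Sum>i = 1..j. indicator A (?q i))"
    proof (rule sum_mono)
      fix i assume "i \<in> {1..j}"
      then have "?q i \<in> A" using A[OF order_stat_mono[of i j n X \<omega>] q] j by simp
      then show "1 \<le> (indicator A (?q i) :: real)" by simp
    qed
    also have "\<dots> \<le> (\<Sum>i = 1..n. indicator A (?q i))"
      using j by (intro sum_mono2) auto
    finally show "real j \<le> ?N" unfolding count .
  next
    assume c: "real j \<le> ?N"
    show "?q j \<in> A"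
    proof (rule ccontr)
      assume "?q j \<notin> A"
      then have out: "?q i \<notin> A" if "j \<le> i" "i \<le> n" for i
        using A[OF order_stat_mono[of j i n X \<omega>]] j that by auto
      have "?N = (\<Sum>i \<in> {1..<j}. indicator A (?q i))"
        unfolding count
      proof (rule sum.mono_neutral_right)
        show "\<forall>i\<in>{1..n} - {1..<j}. (indicator A (?q i) :: real) = 0"
          using out by (auto simp: indicator_def)
      qed (use j in auto)
      also have "\<dots> \<le> (\<Sum>i \<in> {1..<j}. 1)" by (intro sum_mono) (auto simp: indicator_def)
      also have "\<dots> < real j" using j by simp
      finally show False using c by simp
    qed
  qed
qed

lemma order_stat_le_iff:
  "1 \<le> j \<Longrightarrow> j \<le> n \<Longrightarrow> order_stat X n j \<omega> \<le> u \<longleftrightarrow> real j \<le> count_le X n u \<omega>"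
  using order_stat_in_lower_set_iff[of j n "{..u}" X \<omega>] by (simp add: count_le_def)

lemma order_stat_less_iff:
  "1 \<le> j \<Longrightarrow> j \<le> n \<Longrightarrow> order_stat X n j \<omega> < u \<longleftrightarrow> real j \<le> count_less X n u \<omega>"
  using order_stat_in_lower_set_iff[of j n "{..<u}" X \<omega>] by (simp add: count_less_def)

lemma borel_measurable_order_stat:
  assumes "\<And>i. 1 \<le> i \<Longrightarrow> i \<le> n \<Longrightarrow> X i \<in> borel_measurable M" and j: "1 \<le> j" "j \<le> n"
  shows "order_stat X n j \<in> borel_measurable M"
proof (rule borel_measurableI_le)
  fix u
  have [measurable]: "(\<lambda>\<omega>. count_le X n u \<omega>) \<in> borel_measurable M"
    unfolding count_le_def using assms(1) by (intro borel_measurable_sum) auto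
  show "{\<omega> \<in> space M. order_stat X n j \<omega> \<le> u} \<in> sets M"
    unfolding order_stat_le_iff[OF j] by measurable
qed

definition excess :: "(nat \<Rightarrow> 'a \<Rightarrow> real) \<Rightarrow> nat \<Rightarrow> nat \<Rightarrow> real \<Rightarrow> 'a \<Rightarrow> real" where
  "excess X n j a \<omega> = (\<Sum>i = 1..j. order_stat X n i \<omega>) - (real j * a - (\<Sum>i = 1..n. max 0 (a - X i \<omega>)))"

text \<open>The sum of the \<open>j\<close> smallest values is the maximum over \<open>a\<close> of the concave function
  \<open>j a - (\<Sum>i. (a - X\<^sub>i)\<^sup>+)\<close>, attained at the \<open>j\<close>-th order statistic; its one-sided
  derivatives at \<open>a\<close> are \<open>j\<close> minus the two counts.\<close>

lemma excess_bounds: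
  assumes j: "1 \<le> j" "j \<le> n"
  shows "0 \<le> excess X n j a \<omega>"
    and "excess X n j a \<omega> \<le> max 0 (max (real j - count_le X n a \<omega>) (count_less X n a \<omega> - real j))
      * \<bar>order_stat X n j \<omega> - a\<bar>"
proof -
  let ?q = "\<lambda>i. order_stat X n i \<omega>"
  have pos: "(\<Sum>i = 1..n. max 0 (b - X i \<omega>)) = (\<Sum>i = 1..n. max 0 (b - ?q i))" for b
    by (rule sum_order_stat[symmetric])
  have "real j * a - (\<Sum>i = 1..j. ?q i) = (\<Sum>i = 1..j. a - ?q i)" by (simp add: sum_subtractf)
  also have "\<dots> \<le> (\<Sum>i = 1..j. max 0 (a - ?q i))" by (intro sum_mono) auto
  also have "\<dots> \<le> (\<Sum>i = 1..n. max 0 (a - ?q i))" using j by (intro sum_mono2) auto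
  finally show "0 \<le> excess X n j a \<omega>" unfolding excess_def pos by simp
  let ?r = "?q j"
  \<comment> \<open>At the level r only the first j sorted values contribute and none is truncated,
    so the variational formula is exact there. The excess at a becomes the difference of its values
    at r and at a.\<close>
  have "(\<Sum>i = 1..n. max 0 (?r - ?q i)) = (\<Sum>i = 1..j. max 0 (?r - ?q i))"
    using j order_stat_mono[of j _ n X \<omega>] by (intro sum.mono_neutral_right) auto
  also have "\<dots> = (\<Sum>i = 1..j. ?r - ?q i)"
    using j order_stat_mono[of _ j n X \<omega>] by (intro sum.cong) auto
  finally have "(\<Sum>i = 1..j. ?q i) = real j * ?r - (\<Sum>i = 1..n. max 0 (?r - X i \<omega>))"
    unfolding pos by (simp add: sum_subtractf)
  then have R: "excess X n j a \<omega> = real j * (?r - a) - (\<Sum>i = 1..n. max 0 (?r - X i \<omega>) - max 0 (a - X i \<omega>))"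
    unfolding excess_def by (simp add: sum_subtractf algebra_simps)
  show "excess X n j a \<omega> \<le> max 0 (max (real j - count_le X n a \<omega>) (count_less X n a \<omega> - real j))
      * \<bar>order_stat X n j \<omega> - a\<bar>"
  proof (cases "a \<le> ?r")
    case True
    \<comment> \<open>From a up to r, the hinge max 0 (b - x), as a function of b, grows at full
      rate whenever x <= a. In the other case b moves down from a, and the hinge drops by at most a
      - r, and only if x < a; hence the strict count there.\<close>
    have "(\<Sum>i = 1..n. indicator {..a} (X i \<omega>) * (?r - a)) \<le> (\<Sum>i = 1..n. max 0 (?r - X i \<omega>) - max 0 (a - X i \<omega>))"
      using True by (intro sum_mono) (auto simp: indicator_def)
    then have "excess X n j a \<omega> \<le> (real j - count_le X n a \<omega>) * \<bar>?r - a\<bar>"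
      unfolding R count_le_def using True
      by (simp add: sum_distrib_right[symmetric] left_diff_distrib)
    also have "\<dots> \<le> max 0 (max (real j - count_le X n a \<omega>) (count_less X n a \<omega> - real j)) * \<bar>?r - a\<bar>"
      by (intro mult_right_mono) auto
    finally show ?thesis .
  next
    case False
    have "(\<Sum>i = 1..n. indicator {..<a} (X i \<omega>) * (?r - a)) \<le> (\<Sum>i = 1..n. max 0 (?r - X i \<omega>) - max 0 (a - X i \<omega>))"
      using False by (intro sum_mono) (auto simp: indicator_def)
    moreover have "(\<Sum>i = 1..n. indicator {..<a} (X i \<omega>) * (?r - a)) = count_less X n a \<omega> * (?r - a)"
      unfolding count_less_def by (simp only: sum_distrib_right)
    ultimately have "excess X n j a \<omega> \<le> real j * (?r - a) - count_less X n a \<omega> * (?r - a)"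
      unfolding R by linarith
    also have "\<dots> = (count_less X n a \<omega> - real j) * \<bar>?r - a\<bar>"
      using False by (simp add: algebra_simps)
    also have "\<dots> \<le> max 0 (max (real j - count_le X n a \<omega>) (count_less X n a \<omega> - real j)) * \<bar>?r - a\<bar>"
      by (intro mult_right_mono) auto
    finally show ?thesis .
  qed
qed

text \<open>Winsorizing is a difference of two hinges, the same hinges that occur in the formula for
  sums of smallest values. This is what links trimmed and Winsorized sums.\<close>

lemma winsorize_eq:
  "a \<le> b \<Longrightarrow> winsorize a b x = b - max 0 (b - x) + max 0 (a - x)"
  unfolding winsorize_def by auto

text \<open>A pointwise identity for arbitrary levels a <= b; quantiles enter only later, to make
  the two excesses small.\<close>

lemma trimmed_mean_winsorized:
  assumes n: "k n < n - m n" and "a \<le> b"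
  shows "real n * trimmed_mean X k m n \<omega> = (\<Sum>i = 1..n. winsorize a b (X i \<omega>))
    - real (k n) * a - real (m n) * b + excess X n (n - m n) b \<omega> - excess X n (k n) a \<omega>"
proof -
  let ?q = "\<lambda>i. order_stat X n i \<omega>"
  have "(\<Sum>i = 1..n - m n. ?q i) = (\<Sum>i = 1..k n. ?q i) + (\<Sum>i = k n + 1..n - m n. ?q i)"
    using n sum.ub_add_nat[of 1 "k n" ?q "n - m n - k n"] by simp
  moreover have "real n * trimmed_mean X k m n \<omega> = (\<Sum>i = k n + 1..n - m n. ?q i)"
    using n unfolding trimmed_mean_def by simp
  ultimately show ?thesis
    using n unfolding excess_def winsorize_eq[OF \<open>a \<le> b\<close>]
    by (simp add: sum.distrib sum_subtractf of_nat_diff algebra_simps)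
qed

text \<open>If the j-th value is nonnegative, the n - j + 1 values from it upwards are at least as
  large in modulus; if it is negative, the j values up to it are. So r observations dominate it in
  modulus, and a product of r independent factors requires only a moment of order \<gamma> from
  each.\<close>

lemma abs_order_stat_power_le:
  fixes \<gamma> :: real
  assumes j: "1 \<le> j" "j \<le> n" and r: "r \<le> j" "r \<le> n - j + 1" and \<gamma>: "0 \<le> \<gamma>"
  shows "(\<bar>order_stat X n j \<omega>\<bar> powr \<gamma>) ^ r \<le> (\<Sum>A | A \<subseteq> {1..n} \<and> card A = r. \<Prod>i\<in>A. \<bar>X i \<omega>\<bar> powr \<gamma>)"
proof -
  let ?q = "\<lambda>i. order_stat X n i \<omega>"
  let ?y = "\<bar>?q j\<bar>"
  define B where "B = {i \<in> {1..n}. ?y \<le> \<bar>X i \<omega>\<bar>}"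
  have "real (card B) = (\<Sum>i = 1..n. if ?y \<le> \<bar>X i \<omega>\<bar> then 1 else 0)"
    unfolding B_def by (simp add: sum.If_cases Int_def)
  also have "\<dots> = (\<Sum>i = 1..n. if ?y \<le> \<bar>?q i\<bar> then 1 else 0)"
    by (rule sum_order_stat[symmetric])
  also have "\<dots> \<ge> real r"
  proof (cases "0 \<le> ?q j")
    case True
    have "real r \<le> (\<Sum>i = j..n. 1)" using r j by simp
    also have "\<dots> \<le> (\<Sum>i = j..n. if ?y \<le> \<bar>?q i\<bar> then 1 else 0)"
      using j True order_stat_mono[of j _ n X \<omega>] by (intro sum_mono) (auto, force)
    also have "\<dots> \<le> (\<Sum>i = 1..n. if ?y \<le> \<bar>?q i\<bar> then 1 else 0)"
      using j by (intro sum_mono2) auto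
    finally show ?thesis .
  next
    case False
    have "real r \<le> (\<Sum>i = 1..j. 1)" using r j by simp
    also have "\<dots> \<le> (\<Sum>i = 1..j. if ?y \<le> \<bar>?q i\<bar> then 1 else 0)"
      using j False order_stat_mono[of _ j n X \<omega>] by (intro sum_mono) (auto, force)
    also have "\<dots> \<le> (\<Sum>i = 1..n. if ?y \<le> \<bar>?q i\<bar> then 1 else 0)"
      using j by (intro sum_mono2) auto
    finally show ?thesis .
  qed
  finally have "r \<le> card B" by simp
  then obtain A where A: "A \<subseteq> B" "card A = r"
    using obtain_subset_with_card_n by metis
  have "(?y powr \<gamma>) ^ r = (\<Prod>i\<in>A. ?y powr \<gamma>)" using A by simp
  also have "\<dots> \<le> (\<Prod>i\<in>A. \<bar>X i \<omega>\<bar> powr \<gamma>)"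
    using A(1) \<gamma> unfolding B_def by (intro prod_mono) (auto intro: powr_mono2)
  also have "\<dots> \<le> (\<Sum>A | A \<subseteq> {1..n} \<and> card A = r. \<Prod>i\<in>A. \<bar>X i \<omega>\<bar> powr \<gamma>)"
    using A unfolding B_def
    by (intro member_le_sum) (auto intro: prod_nonneg finite_subset[OF _ finite_Pow_iff[THEN iffD2, of "{1..n}"]])
  finally show ?thesis .
qed

subsection \<open>Samples\<close>

locale iid_sample = prob_space M for M :: "'a measure" +
  fixes X :: "nat \<Rightarrow> 'a \<Rightarrow> real" and F :: "real \<Rightarrow> real"
  assumes indep: "indep_vars (\<lambda>_. borel) X {1..}"
    and ident: "\<And>i. i \<ge> 1 \<Longrightarrow> distr M borel (X i) = distr M borel (X 1)"
    and F_def: "F = cdf (distr M borel (X 1))"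
begin

definition law :: "real measure" where "law = distr M borel (X 1)"

lemma rv [measurable]: "i \<ge> 1 \<Longrightarrow> random_variable borel (X i)"
  using indep unfolding indep_vars_def by auto

lemma rv1 [measurable]: "random_variable borel (X 1)" "random_variable borel (X (Suc 0))"
  by (simp_all add: rv)

lemma cdf_law: "cdf_distribution law"
proof -
  interpret D: prob_space law unfolding law_def by (rule prob_space_distr) simp
  show ?thesis by unfold_locales (simp_all add: law_def)
qed

lemma F_eq: "F = cdf law" by (simp add: F_def law_def)

lemma distr_X: "i \<ge> 1 \<Longrightarrow> distr M borel (X i) = law"
  unfolding law_def by (rule ident)

lemma expectation_X:
  fixes f :: "real \<Rightarrow> real"
  assumes "i \<ge> 1" "f \<in> borel_measurable borel"
  shows "expectation (\<lambda>\<omega>. f (X i \<omega>)) = (\<integral>x. f x \<partial>law)"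
  using integral_distr[OF rv[OF assms(1)], of f] assms by (simp add: distr_X)

lemma integrable_X_iff:
  fixes f :: "real \<Rightarrow> real"
  assumes "i \<ge> 1" "f \<in> borel_measurable borel"
  shows "integrable M (\<lambda>\<omega>. f (X i \<omega>)) \<longleftrightarrow> integrable law f"
  using integrable_distr_eq[OF rv[OF assms(1)], of f] assms by (simp add: distr_X)

lemma indep_comp:
  assumes "\<And>i. (f i :: real \<Rightarrow> real) \<in> borel_measurable borel" "I \<subseteq> {1..}"
  shows "indep_vars (\<lambda>_. borel) (\<lambda>i \<omega>. f i (X i \<omega>)) I"
  by (rule indep_vars_compose2[OF indep_vars_subset[OF indep assms(2)]]) (use assms(1) in simp)

lemma sum_iid_moments:
  fixes f :: "real \<Rightarrow> real"
  assumes [measurable]: "f \<in> borel_measurable borel" and f2: "integrable law (\<lambda>x. (f x)\<^sup>2)"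
  shows "integrable M (\<lambda>\<omega>. (\<Sum>i = 1..n. f (X i \<omega>))\<^sup>2)"
    and "expectation (\<lambda>\<omega>. \<Sum>i = 1..n. f (X i \<omega>)) = real n * integral\<^sup>L law f"
    and "variance (\<lambda>\<omega>. \<Sum>i = 1..n. f (X i \<omega>)) = real n * (\<integral>x. (f x - integral\<^sup>L law f)\<^sup>2 \<partial>law)"
proof -
  have sq: "integrable M (\<lambda>\<omega>. (f (X i \<omega>))\<^sup>2)" if "i \<in> {1..n}" for i
    using that f2 by (subst integrable_X_iff[where f = "\<lambda>x. (f x)\<^sup>2"]) auto
  have int: "integrable M (\<lambda>\<omega>. f (X i \<omega>))" if "i \<in> {1..n}" for i
    by (rule integrable_of_square) (use that sq in auto)
  note vs = variance_sum_indep[OF _ indep_comp[of "\<lambda>_. f" "{1..n}"] sq]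
  show "integrable M (\<lambda>\<omega>. (\<Sum>i = 1..n. f (X i \<omega>))\<^sup>2)" using vs by auto
  have ef: "expectation (\<lambda>\<omega>. f (X i \<omega>)) = integral\<^sup>L law f" if "i \<in> {1..n}" for i
    using that by (intro expectation_X) auto
  have "expectation (\<lambda>\<omega>. \<Sum>i = 1..n. f (X i \<omega>)) = (\<Sum>i = 1..n. expectation (\<lambda>\<omega>. f (X i \<omega>)))"
    using int by (rule Bochner_Integration.integral_sum)
  then show "expectation (\<lambda>\<omega>. \<Sum>i = 1..n. f (X i \<omega>)) = real n * integral\<^sup>L law f"
    using ef by simp
  have "variance (\<lambda>\<omega>. f (X i \<omega>)) = (\<integral>x. (f x - integral\<^sup>L law f)\<^sup>2 \<partial>law)" if "i \<in> {1..n}" for i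
    unfolding ef[OF that] using that by (intro expectation_X[where f = "\<lambda>x. (f x - integral\<^sup>L law f)\<^sup>2"]) auto
  then have "(\<Sum>i = 1..n. variance (\<lambda>\<omega>. f (X i \<omega>))) = (\<Sum>i = 1..n. (\<integral>x. (f x - integral\<^sup>L law f)\<^sup>2 \<partial>law))"
    by (intro sum.cong) auto
  then show "variance (\<lambda>\<omega>. \<Sum>i = 1..n. f (X i \<omega>)) = real n * (\<integral>x. (f x - integral\<^sup>L law f)\<^sup>2 \<partial>law)"
    using vs by simp
qed

definition count_dev :: "real set \<Rightarrow> nat \<Rightarrow> 'a \<Rightarrow> real" where
  "count_dev A n \<omega> = \<bar>(\<Sum>i = 1..n. indicator A (X i \<omega>)) - real n * measure law A\<bar>"

lemma count_dev_measurable: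
  assumes [measurable]: "A \<in> sets borel"
  shows "random_variable borel (count_dev A n)"
proof -
  have "(\<lambda>\<omega>. \<Sum>i = 1..n. indicator A (X i \<omega>) :: real) \<in> borel_measurable M"
    by (intro borel_measurable_sum) measurable
  then show ?thesis unfolding count_dev_def by measurable
qed

lemma count_dev_tail:
  assumes A [measurable]: "A \<in> sets borel" and n: "n > 0" and \<delta>: "0 \<le> \<delta>"
  shows "prob {\<omega> \<in> space M. real n * \<delta> \<le> count_dev A n \<omega>} \<le> 2 * exp (- 2 * real n * \<delta>\<^sup>2)"
proof -
  interpret D: cdf_distribution law by (rule cdf_law)
  interpret H: Hoeffding_ineq_iid M "{1..n}" "\<lambda>i \<omega>. indicator A (X i \<omega>)" "\<lambda>\<omega>. indicator A (X 1 \<omega>)" 0 1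
    "expectation (\<lambda>\<omega>. indicator A (X 1 \<omega>))"
  proof unfold_locales
    show "indep_vars (\<lambda>_. borel) (\<lambda>i \<omega>. indicator A (X i \<omega>) :: real) {1..n}"
      using indep_comp[of "\<lambda>_. indicator A" "{1..n}"] by auto
    fix i assume i: "i \<in> {1..n}"
    have "distr M borel (\<lambda>\<omega>. indicator A (X i \<omega>)) = distr (distr M borel (X i)) borel (indicator A :: real \<Rightarrow> real)"
      using i by (subst distr_distr) (auto simp: o_def)
    also have "\<dots> = distr (distr M borel (X 1)) borel (indicator A)" using i ident[of i] by (simp only: atLeastAtMost_iff)
    also have "\<dots> = distr M borel (\<lambda>\<omega>. indicator A (X 1 \<omega>))"
      by (subst distr_distr) (auto simp: o_def)
    finally show "distr M borel (\<lambda>\<omega>. indicator A (X i \<omega>)) = distr M borel (\<lambda>\<omega>. indicator A (X 1 \<omega>) :: real)" .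
  qed (auto simp: indicator_def)
  have mu: "expectation (\<lambda>\<omega>. indicator A (X 1 \<omega>)) = measure law A"
    by (subst expectation_X) auto
  have "prob {\<omega> \<in> space M. real n * \<delta> \<le> count_dev A n \<omega>} \<le> 2 * exp (- 2 * (real n * \<delta>)\<^sup>2 / (real n * (1 - 0)\<^sup>2))"
    using H.Hoeffding_ineq_abs_ge[of "real n * \<delta>"] n \<delta> unfolding count_dev_def mu by simp
  also have "- 2 * (real n * \<delta>)\<^sup>2 / (real n * (1 - 0)\<^sup>2) = - 2 * real n * \<delta>\<^sup>2"
    using n by (simp add: power2_eq_square)
  finally show ?thesis .
qed

text \<open>The second moment is a binomial variance. That it carries no logarithm is what preserves
  the rate for mean and variance.\<close>

lemma count_dev_square:
  assumes A [measurable]: "A \<in> sets borel"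
  shows "integrable M (\<lambda>\<omega>. (count_dev A n \<omega>)\<^sup>2)" "expectation (\<lambda>\<omega>. (count_dev A n \<omega>)\<^sup>2) \<le> real n"
proof -
  interpret D: cdf_distribution law by (rule cdf_law)
  let ?f = "indicator A :: real \<Rightarrow> real"
  let ?S = "\<lambda>\<omega>. \<Sum>i = 1..n. ?f (X i \<omega>)"
  have eq: "(\<lambda>x. (?f x)\<^sup>2) = ?f" by (auto simp: indicator_def)
  have intf: "integrable law ?f" by (rule D.integrable_const_bound[of _ 1]) auto
  have f2: "integrable law (\<lambda>x. (?f x)\<^sup>2)" unfolding eq by (rule intf)
  have Ef: "integral\<^sup>L law ?f = measure law A" by simp
  note mom = sum_iid_moments[OF borel_measurable_indicator[OF A] f2, of n]
  have S: "random_variable borel ?S" by (intro borel_measurable_sum) measurable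
  show int: "integrable M (\<lambda>\<omega>. (count_dev A n \<omega>)\<^sup>2)"
    unfolding count_dev_def power2_abs
    using integrable_square_add[OF S _ mom(1), of "\<lambda>_. - (real n * measure law A)"] by simp
  have "(\<integral>x. (?f x - integral\<^sup>L law ?f)\<^sup>2 \<partial>law) \<le> 1"
    using D.variance_eq[OF intf f2] unfolding eq Ef
    using D.prob_le_1[of A] zero_le_power2[of "measure law A"] by linarith
  then have "real n * (\<integral>x. (?f x - integral\<^sup>L law ?f)\<^sup>2 \<partial>law) \<le> real n * 1" by (intro mult_left_mono) auto
  moreover have "expectation (\<lambda>\<omega>. (count_dev A n \<omega>)\<^sup>2) = real n * (\<integral>x. (?f x - integral\<^sup>L law ?f)\<^sup>2 \<partial>law)"
    unfolding mom(3)[symmetric] mom(2) unfolding count_dev_def power2_abs Ef ..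
  ultimately show "expectation (\<lambda>\<omega>. (count_dev A n \<omega>)\<^sup>2) \<le> real n" by simp
qed

text \<open>However small \<gamma> is, r factors with \<gamma> r >= 4 reach order 4. The price is
  the sum over at most n^r subsets, a power of n that the small probability of the exceptional event
  will absorb.\<close>

lemma order_stat_moment:
  assumes j: "1 \<le> j" "j \<le> n" and r: "r \<le> j" "r \<le> n - j + 1" and \<gamma>: "0 < \<gamma>" "4 \<le> \<gamma> * real r"
    and int: "integrable M (\<lambda>\<omega>. \<bar>X 1 \<omega>\<bar> powr \<gamma>)"
  shows "integrable M (\<lambda>\<omega>. (order_stat X n j \<omega>) ^ 4)"
    and "expectation (\<lambda>\<omega>. (order_stat X n j \<omega>) ^ 4)
      \<le> 1 + real n ^ r * (expectation (\<lambda>\<omega>. \<bar>X 1 \<omega>\<bar> powr \<gamma>)) ^ r"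
proof -
  let ?g = "\<lambda>x :: real. \<bar>x\<bar> powr \<gamma>"
  let ?m = "expectation (\<lambda>\<omega>. ?g (X 1 \<omega>))"
  let ?AA = "{A. A \<subseteq> {1..n} \<and> card A = r}"
  let ?B = "\<lambda>\<omega>. 1 + (\<Sum>A\<in>?AA. \<Prod>i\<in>A. ?g (X i \<omega>))"
  have q [measurable]: "random_variable borel (order_stat X n j)"
    using j by (intro borel_measurable_order_stat) auto
  have "integrable law ?g" using int integrable_X_iff[of 1 ?g] by simp
  then have intX: "integrable M (\<lambda>\<omega>. ?g (X i \<omega>))" if "i \<ge> 1" for i
    by (subst integrable_X_iff[OF that]) auto
  have EX: "expectation (\<lambda>\<omega>. ?g (X i \<omega>)) = ?m" if "i \<ge> 1" for i
  proof -
    have "expectation (\<lambda>\<omega>. ?g (X i \<omega>)) = integral\<^sup>L law ?g" by (rule expectation_X[OF that]) simp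
    also have "\<dots> = ?m" by (rule expectation_X[symmetric]) simp_all
    finally show ?thesis .
  qed
  have prod: "integrable M (\<lambda>\<omega>. \<Prod>i\<in>A. ?g (X i \<omega>)) \<and> expectation (\<lambda>\<omega>. \<Prod>i\<in>A. ?g (X i \<omega>)) = ?m ^ r"
    if "A \<in> ?AA" for A
  proof -
    have A: "finite A" "A \<subseteq> {1..}" using that finite_subset[of A "{1..n}"] by auto
    have iA: "1 \<le> i" if "i \<in> A" for i using that A(2) by auto
    have i: "indep_vars (\<lambda>_. borel) (\<lambda>i \<omega>. ?g (X i \<omega>)) A" by (rule indep_comp[OF _ A(2)]) simp
    have "expectation (\<lambda>\<omega>. \<Prod>i\<in>A. ?g (X i \<omega>)) = (\<Prod>i\<in>A. expectation (\<lambda>\<omega>. ?g (X i \<omega>)))"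
      by (rule indep_vars_lebesgue_integral[OF A(1) i]) (rule intX[OF iA])
    also have "\<dots> = (\<Prod>i\<in>A. ?m)" by (rule prod.cong[OF refl EX[OF iA]])
    also have "\<dots> = ?m ^ r" using that by simp
    finally have "expectation (\<lambda>\<omega>. \<Prod>i\<in>A. ?g (X i \<omega>)) = ?m ^ r" .
    moreover have "integrable M (\<lambda>\<omega>. \<Prod>i\<in>A. ?g (X i \<omega>))"
      by (rule indep_vars_integrable[OF A(1) i]) (rule intX[OF iA])
    ultimately show ?thesis by (intro conjI)
  qed
  have intB: "integrable M ?B"
    by (rule Bochner_Integration.integrable_add[OF integrable_const Bochner_Integration.integrable_sum[OF prod[THEN conjunct1]]])
  have pw: "(order_stat X n j \<omega>) ^ 4 \<le> ?B \<omega>" for \<omega>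
  proof -
    let ?q = "order_stat X n j \<omega>"
    have "?q ^ 4 = \<bar>?q\<bar> ^ 4" by simp
    also have "\<dots> \<le> 1 + (?g ?q) ^ r"
    proof (cases "\<bar>?q\<bar> \<le> 1")
      case True
      then have "\<bar>?q\<bar> ^ 4 \<le> 1" by (intro power_le_one) auto
      moreover have "0 \<le> (?g ?q) ^ r" by simp
      ultimately show ?thesis by linarith
    next
      case False
      have "\<bar>?q\<bar> ^ 4 = \<bar>?q\<bar> powr 4" using False by (simp add: powr_numeral)
      also have "\<dots> \<le> \<bar>?q\<bar> powr (\<gamma> * real r)" using False \<gamma> by (intro powr_mono) auto
      also have "\<dots> = (?g ?q) ^ r" using False by (simp add: powr_power mult.commute)
      finally show ?thesis by simp
    qed
    also have "\<dots> \<le> ?B \<omega>" using abs_order_stat_power_le[OF j r, of \<gamma> X \<omega>] \<gamma> by simp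
    finally show ?thesis .
  qed
  show int4: "integrable M (\<lambda>\<omega>. (order_stat X n j \<omega>) ^ 4)"
  proof (rule Bochner_Integration.integrable_bound[OF intB])
    show "AE \<omega> in M. norm ((order_stat X n j \<omega>) ^ 4) \<le> norm (?B \<omega>)"
    proof (rule AE_I2)
      fix \<omega>
      have "norm ((order_stat X n j \<omega>) ^ 4) = (order_stat X n j \<omega>) ^ 4" by simp
      then show "norm ((order_stat X n j \<omega>) ^ 4) \<le> norm (?B \<omega>)" using pw[of \<omega>] by simp
    qed
  qed simp
  have "expectation (\<lambda>\<omega>. (order_stat X n j \<omega>) ^ 4) \<le> expectation ?B"
    using pw by (intro integral_mono int4 intB) auto
  also have "\<dots> = 1 + real (card ?AA) * ?m ^ r"
  proof -
    have "expectation ?B = 1 + (\<Sum>A\<in>?AA. expectation (\<lambda>\<omega>. \<Prod>i\<in>A. ?g (X i \<omega>)))"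
    proof -
      have "expectation ?B = expectation (\<lambda>_. 1) + expectation (\<lambda>\<omega>. \<Sum>A\<in>?AA. \<Prod>i\<in>A. ?g (X i \<omega>))"
        using prod by (intro Bochner_Integration.integral_add Bochner_Integration.integrable_sum) auto
      also have "expectation (\<lambda>\<omega>. \<Sum>A\<in>?AA. \<Prod>i\<in>A. ?g (X i \<omega>))
          = (\<Sum>A\<in>?AA. expectation (\<lambda>\<omega>. \<Prod>i\<in>A. ?g (X i \<omega>)))"
        using prod by (intro Bochner_Integration.integral_sum) auto
      finally show ?thesis by (simp add: prob_space)
    qed
    also have "\<dots> = 1 + (\<Sum>A\<in>?AA. ?m ^ r)" using prod by (intro arg_cong2[where f = "(+)"] sum.cong) auto
    finally show ?thesis by simp
  qed
  also have "\<dots> \<le> 1 + real n ^ r * ?m ^ r"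
  proof -
    have "card ?AA = n choose r" using n_subsets[of "{1..n}" r] by simp
    also have "\<dots> \<le> n ^ r" using r j by (intro binomial_le_pow) auto
    finally have "real (card ?AA) \<le> real n ^ r" by (simp flip: of_nat_power)
    moreover have "0 \<le> ?m" by (intro integral_nonneg_AE) auto
    ultimately show ?thesis by (intro add_left_mono mult_right_mono) auto
  qed
  finally show "expectation (\<lambda>\<omega>. (order_stat X n j \<omega>) ^ 4) \<le> 1 + real n ^ r * ?m ^ r" .
qed

end

context iid_sample
begin

lemma count_le_dev: "\<bar>count_le X n u \<omega> - real n * F u\<bar> = count_dev {..u} n \<omega>"
  by (simp add: count_le_def count_dev_def F_eq cdf_def)

lemma count_less_dev: "\<bar>count_less X n u \<omega> - real n * measure law {..<u}\<bar> = count_dev {..<u} n \<omega>"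
  by (simp add: count_less_def count_dev_def)

lemma count_range:
  "0 \<le> count_le X n u \<omega>" "count_less X n u \<omega> \<le> real n"
proof -
  show "0 \<le> count_le X n u \<omega>" unfolding count_le_def by (intro sum_nonneg) auto
  have "count_less X n u \<omega> \<le> (\<Sum>i = 1..n. 1)"
    unfolding count_less_def by (intro sum_mono) (auto simp: indicator_def)
  then show "count_less X n u \<omega> \<le> real n" by simp
qed

text \<open>Outside this set four counts are within n \<delta> of their means. The two at the
  p-quantile control the slopes in \<open>excess_bounds\<close>; those at the quantiles of p +
  \<delta> and p - \<delta> confine the j-th order statistic.\<close>

definition atypical :: "nat \<Rightarrow> nat \<Rightarrow> real \<Rightarrow> 'a set" where
  "atypical n j \<delta> = (let p = real j / real n; L = (\<lambda>A. {\<omega> \<in> space M. real n * \<delta> \<le> count_dev A n \<omega>}) in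
     (L {..quantile F p} \<union> L {..<quantile F p}) \<union> (L {..quantile F (p + \<delta>)} \<union> L {..<quantile F (p - \<delta>)}))"

lemma atypical_event:
  assumes n: "n > 0" and \<delta>: "0 \<le> \<delta>"
  shows "atypical n j \<delta> \<in> events" and "prob (atypical n j \<delta>) \<le> 8 * exp (- 2 * real n * \<delta>\<^sup>2)"
proof -
  define L where "L A = {\<omega> \<in> space M. real n * \<delta> \<le> count_dev A n \<omega>}" for A
  have ev: "L A \<in> events" if "A \<in> sets borel" for A
    using count_dev_measurable[OF that, of n] unfolding L_def by measurable
  have tail: "prob (L A) \<le> 2 * exp (- 2 * real n * \<delta>\<^sup>2)" if "A \<in> sets borel" for A
    unfolding L_def by (rule count_dev_tail[OF that n \<delta>])
  define p where "p = real j / real n"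
  let ?A = "L {..quantile F p}" and ?B = "L {..<quantile F p}"
  let ?C = "L {..quantile F (p + \<delta>)}" and ?D = "L {..<quantile F (p - \<delta>)}"
  have eq: "atypical n j \<delta> = (?A \<union> ?B) \<union> (?C \<union> ?D)"
    unfolding atypical_def Let_def L_def p_def ..
  have e: "?A \<in> events" "?B \<in> events" "?C \<in> events" "?D \<in> events" by (auto intro: ev)
  show "atypical n j \<delta> \<in> events" unfolding eq using e by auto
  have "prob ((?A \<union> ?B) \<union> (?C \<union> ?D)) \<le> prob (?A \<union> ?B) + prob (?C \<union> ?D)"
    using e by (intro measure_Un_le) auto
  also have "\<dots> \<le> (prob ?A + prob ?B) + (prob ?C + prob ?D)"
    using e by (intro add_mono measure_Un_le) auto
  finally show "prob (atypical n j \<delta>) \<le> 8 * exp (- 2 * real n * \<delta>\<^sup>2)"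
    unfolding eq using tail[of "{..quantile F p}"] tail[of "{..<quantile F p}"]
      tail[of "{..quantile F (p + \<delta>)}"] tail[of "{..<quantile F (p - \<delta>)}"] by simp
qed

section \<open>The excess at a fixed sample size\<close>

context
  fixes n j :: nat and p \<delta> a \<Delta> :: real
  assumes j: "1 \<le> j" "j \<le> n" and p_def: "p = real j / real n" and a_def: "a = quantile F p"
    and \<delta>: "0 \<le> \<delta>" "0 < p - \<delta>" "p + \<delta> < 1"
    and \<Delta>: "quantile F (p + \<delta>) - a \<le> \<Delta>" "a - quantile F (p - \<delta>) \<le> \<Delta>"
begin

lemma n_pos: "n > 0" using j by simp

lemma np: "real n * p = real j" using n_pos by (simp add: p_def)

lemma p01: "0 < p" "p < 1" using \<delta> by auto

lemma \<Delta>_nonneg: "0 \<le> \<Delta>"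
proof -
  interpret D: cdf_distribution law by (rule cdf_law)
  have "quantile F p \<le> quantile F (p + \<delta>)"
    unfolding F_eq using p01 \<delta> by (intro D.quantile_mono) auto
  then show ?thesis using \<Delta>(1) by (simp add: a_def)
qed

text \<open>Since P(X < a) <= p <= F a, the slopes have nonpositive means and can be positive only
  through fluctuations of the counts; an atom at a works in the favourable direction.\<close>

lemma slope_le_dev:
  "max 0 (max (real j - count_le X n a \<omega>) (count_less X n a \<omega> - real j))
    \<le> max (count_dev {..a} n \<omega>) (count_dev {..<a} n \<omega>)"
proof -
  interpret D: cdf_distribution law by (rule cdf_law)
  have "p \<le> F a" unfolding a_def F_eq using p01 by (intro D.le_cdf_quantile)
  then have "real n * p \<le> real n * F a" by (intro mult_left_mono) auto
  then have 1: "real j - count_le X n a \<omega> \<le> count_dev {..a} n \<omega>"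
    using count_le_dev[of n a \<omega>] np by linarith
  have "measure law {..<a} \<le> p" unfolding a_def F_eq using p01 by (intro D.measure_less_quantile)
  then have "real n * measure law {..<a} \<le> real n * p" by (intro mult_left_mono) auto
  then have 2: "count_less X n a \<omega> - real j \<le> count_dev {..<a} n \<omega>"
    using count_less_dev[of n a \<omega>] np by linarith
  have "0 \<le> count_dev {..a} n \<omega>" by (simp add: count_dev_def)
  then show ?thesis using 1 2 by auto
qed

lemma slope_le_n:
  "max 0 (max (real j - count_le X n a \<omega>) (count_less X n a \<omega> - real j)) \<le> real n"
  using count_range(1)[of n a \<omega>] count_range(2)[of n a \<omega>] j by auto

text \<open>The count at the (p + \<delta>)-quantile has mean at least n p + n \<delta> and deviates
  by less than n \<delta>, so it reaches j = n p; likewise the strict count at the (p -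
  \<delta>)-quantile stays below j.\<close>

lemma order_stat_near_quantile:
  assumes \<omega>: "\<omega> \<in> space M - atypical n j \<delta>"
  shows "\<bar>order_stat X n j \<omega> - a\<bar> \<le> \<Delta>"
proof -
  interpret D: cdf_distribution law by (rule cdf_law)
  let ?u = "quantile F (p + \<delta>)" and ?l = "quantile F (p - \<delta>)"
  have dev: "count_dev {..?u} n \<omega> < real n * \<delta>" "count_dev {..<?l} n \<omega> < real n * \<delta>"
    using \<omega> unfolding atypical_def Let_def p_def[symmetric] by auto
  have "p + \<delta> \<le> F ?u" unfolding F_eq using p01 \<delta> by (intro D.le_cdf_quantile) auto
  then have "real n * (p + \<delta>) \<le> real n * F ?u" by (intro mult_left_mono) auto
  then have "real j \<le> count_le X n ?u \<omega>"
    using count_le_dev[of n ?u \<omega>] dev(1) np unfolding distrib_left by linarith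
  then have up: "order_stat X n j \<omega> \<le> ?u" unfolding order_stat_le_iff[OF j] .
  have "measure law {..<?l} \<le> p - \<delta>" unfolding F_eq using p01 \<delta> by (intro D.measure_less_quantile) auto
  then have "real n * measure law {..<?l} \<le> real n * (p - \<delta>)" by (intro mult_left_mono) auto
  then have "\<not> real j \<le> count_less X n ?l \<omega>"
    using count_less_dev[of n ?l \<omega>] dev(2) np unfolding right_diff_distrib by linarith
  then have "?l \<le> order_stat X n j \<omega>" unfolding order_stat_less_iff[OF j, symmetric] by simp
  then show ?thesis using up \<Delta> by linarith
qed

lemma excess_good:
  assumes \<omega>: "\<omega> \<in> space M - atypical n j \<delta>"
  shows "excess X n j a \<omega> \<le> real n * \<delta> * \<Delta>"
proof -
  have "count_dev {..a} n \<omega> < real n * \<delta>" "count_dev {..<a} n \<omega> < real n * \<delta>"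
    using \<omega> unfolding atypical_def Let_def p_def[symmetric] a_def by auto
  then have "max 0 (max (real j - count_le X n a \<omega>) (count_less X n a \<omega> - real j)) \<le> real n * \<delta>"
    using slope_le_dev[of \<omega>] by linarith
  then have "max 0 (max (real j - count_le X n a \<omega>) (count_less X n a \<omega> - real j)) * \<bar>order_stat X n j \<omega> - a\<bar>
      \<le> real n * \<delta> * \<Delta>"
    using order_stat_near_quantile[OF \<omega>] \<delta>(1) by (intro mult_mono) auto
  then show ?thesis using excess_bounds(2)[OF j, of X a \<omega>] by linarith
qed

lemma excess_measurable: "random_variable borel (excess X n j a)"
proof -
  have "order_stat X n i \<in> borel_measurable M" if "i \<in> {1..j}" for i
    using that j by (intro borel_measurable_order_stat) auto
  then have 1: "(\<lambda>\<omega>. \<Sum>i = 1..j. order_stat X n i \<omega>) \<in> borel_measurable M"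
    by (intro borel_measurable_sum) auto
  have 2: "(\<lambda>\<omega>. \<Sum>i = 1..n. max 0 (a - X i \<omega>)) \<in> borel_measurable M"
    by (intro borel_measurable_sum) measurable
  show ?thesis unfolding excess_def using 1 2 by measurable
qed

text \<open>Off the exceptional event the slope is bounded by the random count deviations and not by
  n \<delta>, so second moments and no log n enter. On it the slope is at most n, and Young's
  inequality 2 v^2 <= v^4 / s + s with free s takes the place of Cauchy-Schwarz, leaving a fourth
  moment and a probability.\<close>

lemma excess_square_le:
  assumes \<omega>: "\<omega> \<in> space M" and s: "0 < s"
  shows "(excess X n j a \<omega>)\<^sup>2 \<le> \<Delta>\<^sup>2 * ((count_dev {..a} n \<omega>)\<^sup>2 + (count_dev {..<a} n \<omega>)\<^sup>2)
    + (real n)\<^sup>2 / 2 * (8 / s * ((order_stat X n j \<omega>) ^ 4 + a ^ 4) + s * indicator (atypical n j \<delta>) \<omega>)"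
proof -
  define E where "E = excess X n j a \<omega>"
  define S where "S = max 0 (max (real j - count_le X n a \<omega>) (count_less X n a \<omega> - real j))"
  define q where "q = order_stat X n j \<omega>"
  define d1 where "d1 = count_dev {..a} n \<omega>"
  define d2 where "d2 = count_dev {..<a} n \<omega>"
  have E: "0 \<le> E" "E \<le> S * \<bar>q - a\<bar>" unfolding E_def S_def q_def by (rule excess_bounds[OF j])+
  have S: "0 \<le> S" "S \<le> max d1 d2" "S \<le> real n"
    unfolding S_def d1_def d2_def using slope_le_dev slope_le_n by auto
  have q4: "0 \<le> 8 / s * (q ^ 4 + a ^ 4)" using s by simp
  have sq: "E\<^sup>2 \<le> S\<^sup>2 * (q - a)\<^sup>2"
  proof -
    have "E\<^sup>2 \<le> (S * \<bar>q - a\<bar>)\<^sup>2" using E by (intro power_mono) auto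
    then show ?thesis by (simp add: power_mult_distrib)
  qed
  have "E\<^sup>2 \<le> \<Delta>\<^sup>2 * (d1\<^sup>2 + d2\<^sup>2) + (real n)\<^sup>2 / 2 * (8 / s * (q ^ 4 + a ^ 4) + s * indicator (atypical n j \<delta>) \<omega>)"
  proof (cases "\<omega> \<in> atypical n j \<delta>")
    case False
    then have "\<bar>q - a\<bar> \<le> \<Delta>" unfolding q_def using order_stat_near_quantile \<omega> by auto
    then have "(q - a)\<^sup>2 \<le> \<Delta>\<^sup>2" using \<Delta>_nonneg by (intro abs_le_square_iff[THEN iffD1]) auto
    moreover have "S\<^sup>2 \<le> d1\<^sup>2 + d2\<^sup>2"
    proof -
      have "S\<^sup>2 \<le> (max d1 d2)\<^sup>2" using S by (intro power_mono) auto
      also have "\<dots> \<le> d1\<^sup>2 + d2\<^sup>2" by (simp add: max_def)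
      finally show ?thesis .
    qed
    ultimately have "S\<^sup>2 * (q - a)\<^sup>2 \<le> (d1\<^sup>2 + d2\<^sup>2) * \<Delta>\<^sup>2" by (intro mult_mono) auto
    moreover have "0 \<le> (real n)\<^sup>2 / 2 * (8 / s * (q ^ 4 + a ^ 4) + s * indicator (atypical n j \<delta>) \<omega>)"
      using s q4 by (intro mult_nonneg_nonneg add_nonneg_nonneg) auto
    ultimately show ?thesis using sq unfolding mult.commute[of "d1\<^sup>2 + d2\<^sup>2"] by linarith
  next
    case True
    have "2 * ((q - a)\<^sup>2 * 1) \<le> (q - a) ^ 4 / s + s"
    proof -
      have "0 \<le> ((q - a)\<^sup>2 - s)\<^sup>2" by simp
      also have "\<dots> = (q - a) ^ 4 - 2 * s * (q - a)\<^sup>2 + s\<^sup>2"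
      proof -
        have "(v\<^sup>2 - s)\<^sup>2 = v ^ 4 - 2 * s * v\<^sup>2 + s\<^sup>2" for v :: real
          by (simp add: power2_eq_square power4_eq_xxxx algebra_simps)
        then show ?thesis .
      qed
      finally have "s * (2 * (q - a)\<^sup>2) \<le> (q - a) ^ 4 + s\<^sup>2" by simp
      then show ?thesis using s by (simp add: field_simps power2_eq_square)
    qed
    moreover have "(q - a) ^ 4 \<le> 8 * (q ^ 4 + a ^ 4)"
    proof -
      have par: "2 * (x\<^sup>2 + y\<^sup>2) = (x - y)\<^sup>2 + (x + y)\<^sup>2" for x y :: real
        by (simp add: power2_eq_square algebra_simps)
      have "(q - a)\<^sup>2 \<le> 2 * (q\<^sup>2 + a\<^sup>2)" unfolding par by simp
      then have "((q - a)\<^sup>2)\<^sup>2 \<le> (2 * (q\<^sup>2 + a\<^sup>2))\<^sup>2" by (intro power_mono) auto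
      moreover have "(q\<^sup>2 + a\<^sup>2)\<^sup>2 \<le> 2 * ((q\<^sup>2)\<^sup>2 + (a\<^sup>2)\<^sup>2)"
        unfolding par by simp
      moreover have "((q - a)\<^sup>2)\<^sup>2 = (q - a) ^ 4" "(2 * (q\<^sup>2 + a\<^sup>2))\<^sup>2 = 4 * (q\<^sup>2 + a\<^sup>2)\<^sup>2"
        "(q\<^sup>2)\<^sup>2 = q ^ 4" "(a\<^sup>2)\<^sup>2 = a ^ 4"
        by (simp_all only: power_mult_distrib power_mult[symmetric]) simp_all
      ultimately show ?thesis by simp
    qed
    then have "(q - a) ^ 4 / s \<le> 8 / s * (q ^ 4 + a ^ 4)"
      using s divide_right_mono[of "(q - a) ^ 4" "8 * (q ^ 4 + a ^ 4)" s] by simp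
    ultimately have "(q - a)\<^sup>2 \<le> 1 / 2 * (8 / s * (q ^ 4 + a ^ 4) + s)" by simp
    moreover have "S\<^sup>2 \<le> (real n)\<^sup>2" using S by (intro power_mono) auto
    ultimately have "S\<^sup>2 * (q - a)\<^sup>2 \<le> (real n)\<^sup>2 * (1 / 2 * (8 / s * (q ^ 4 + a ^ 4) + s))"
      by (intro mult_mono) auto
    also have "\<dots> = (real n)\<^sup>2 / 2 * (8 / s * (q ^ 4 + a ^ 4) + s * indicator (atypical n j \<delta>) \<omega>)"
      using True by simp
    finally have "E\<^sup>2 \<le> (real n)\<^sup>2 / 2 * (8 / s * (q ^ 4 + a ^ 4) + s * indicator (atypical n j \<delta>) \<omega>)"
      using sq by linarith
    moreover have "0 \<le> \<Delta>\<^sup>2 * (d1\<^sup>2 + d2\<^sup>2)" by simp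
    ultimately show ?thesis by linarith
  qed
  then show ?thesis unfolding E_def q_def d1_def d2_def .
qed

lemma excess_second_moment:
  assumes s: "0 < s" and q4: "integrable M (\<lambda>\<omega>. (order_stat X n j \<omega>) ^ 4)"
  shows "integrable M (\<lambda>\<omega>. (excess X n j a \<omega>)\<^sup>2)"
    and "expectation (\<lambda>\<omega>. (excess X n j a \<omega>)\<^sup>2) \<le> \<Delta>\<^sup>2 * (2 * real n)
      + (real n)\<^sup>2 / 2 * (8 / s * (expectation (\<lambda>\<omega>. (order_stat X n j \<omega>) ^ 4) + a ^ 4)
        + s * (8 * exp (- 2 * real n * \<delta>\<^sup>2)))"
proof -
  let ?B = "\<lambda>\<omega>. \<Delta>\<^sup>2 * ((count_dev {..a} n \<omega>)\<^sup>2 + (count_dev {..<a} n \<omega>)\<^sup>2)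
    + (real n)\<^sup>2 / 2 * (8 / s * ((order_stat X n j \<omega>) ^ 4 + a ^ 4) + s * indicator (atypical n j \<delta>) \<omega>)"
  note be = atypical_event[OF n_pos \<delta>(1), of j]
  note d = count_dev_square[of "{..a}" n, simplified] count_dev_square[of "{..<a}" n, simplified]
  have ib: "integrable M (\<lambda>\<omega>. indicator (atypical n j \<delta>) \<omega> :: real)" using be(1) by (simp add: emeasure_eq_measure)
  have intB: "integrable M ?B" using d(1,3) q4 ib by simp
  have [measurable]: "random_variable borel (excess X n j a)" by (rule excess_measurable)
  show int: "integrable M (\<lambda>\<omega>. (excess X n j a \<omega>)\<^sup>2)"
  proof (rule Bochner_Integration.integrable_bound[OF intB])
    show "AE \<omega> in M. norm ((excess X n j a \<omega>)\<^sup>2) \<le> norm (?B \<omega>)"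
    proof (rule AE_I2)
      fix \<omega> assume "\<omega> \<in> space M"
      then have "(excess X n j a \<omega>)\<^sup>2 \<le> ?B \<omega>" using s by (rule excess_square_le)
      then show "norm ((excess X n j a \<omega>)\<^sup>2) \<le> norm (?B \<omega>)" by simp
    qed
  qed simp
  have "expectation (\<lambda>\<omega>. (excess X n j a \<omega>)\<^sup>2) \<le> expectation ?B"
    using excess_square_le s by (intro integral_mono int intB) auto
  also have "\<dots> = \<Delta>\<^sup>2 * (expectation (\<lambda>\<omega>. (count_dev {..a} n \<omega>)\<^sup>2) + expectation (\<lambda>\<omega>. (count_dev {..<a} n \<omega>)\<^sup>2))
      + (real n)\<^sup>2 / 2 * (8 / s * (expectation (\<lambda>\<omega>. (order_stat X n j \<omega>) ^ 4) + a ^ 4)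
        + s * prob (atypical n j \<delta>))"
    using d(1,3) q4 ib be(1) by (simp add: prob_space)
  also have "\<dots> \<le> \<Delta>\<^sup>2 * (2 * real n)
      + (real n)\<^sup>2 / 2 * (8 / s * (expectation (\<lambda>\<omega>. (order_stat X n j \<omega>) ^ 4) + a ^ 4)
        + s * (8 * exp (- 2 * real n * \<delta>\<^sup>2)))"
    using d(2,4) be(2) s by (intro add_mono mult_left_mono) auto
  finally show "expectation (\<lambda>\<omega>. (excess X n j a \<omega>)\<^sup>2) \<le> \<Delta>\<^sup>2 * (2 * real n)
      + (real n)\<^sup>2 / 2 * (8 / s * (expectation (\<lambda>\<omega>. (order_stat X n j \<omega>) ^ 4) + a ^ 4)
        + s * (8 * exp (- 2 * real n * \<delta>\<^sup>2)))" .
qed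

end

end

subsection \<open>Asymptotics of the excess\<close>

definition rate :: "real \<Rightarrow> nat \<Rightarrow> real" where
  "rate \<epsilon> n = ln (real n) powr (- (1 + \<epsilon>))"

text \<open>The scale on which Hoeffding's bound turns into a power of n, with an exponent that
  grows with the square of the multiple \<tau>.\<close>

definition mesh :: "nat \<Rightarrow> real" where
  "mesh n = sqrt (ln (real n) / real n)"

lemma rate_nonneg: "0 \<le> rate \<epsilon> n"
  by (simp add: rate_def)

lemma mesh_nonneg: "0 \<le> mesh n"
  by (cases "n = 0") (simp_all add: mesh_def)

lemma eventually_mesh_less: "0 < b \<Longrightarrow> \<forall>\<^sub>F n in sequentially. \<tau> * mesh n < b"
proof -
  assume "0 < b"
  have "(\<lambda>n::nat. \<tau> * sqrt (ln (real n) / real n)) \<longlonglongrightarrow> 0"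
    by (rule tendsto_mult_right_zero) real_asymp
  from order_tendstoD(2)[OF this \<open>0 < b\<close>] show ?thesis by (simp add: mesh_def)
qed

lemma exp_mesh:
  assumes "n > 1"
  shows "exp (- 2 * real n * (\<tau> * mesh n)\<^sup>2) = real n powr (- 2 * \<tau>\<^sup>2)"
  using assms by (simp add: mesh_def power_mult_distrib powr_def)

context iid_sample
begin

text \<open>Form of the hypotheses on the increments that no longer contains the weights \<alpha>
  and \<beta> under the square root, so both ends of the sample share one argument.\<close>

definition oscillation_le :: "real \<Rightarrow> real \<Rightarrow> real \<Rightarrow> real \<Rightarrow> nat \<Rightarrow> bool" where
  "oscillation_le \<epsilon> C p \<tau> n \<longleftrightarrow> quantile F (p + \<tau> * mesh n) - quantile F p \<le> C * rate \<epsilon> n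
    \<and> quantile F p - quantile F (p - \<tau> * mesh n) \<le> C * rate \<epsilon> n"

text \<open>The first bound, of order sqrt(n log n) times the rate, serves the tails; the second, of
  order sqrt n times the rate in L2, serves mean and variance and is free of the factor sqrt(log
  n).\<close>

lemma excess_asymptotics:
  fixes J :: "nat \<Rightarrow> nat" and p :: "nat \<Rightarrow> real"
  assumes p_def: "\<And>n. p n = real (J n) / real n"
    and a0: "0 < a0" "\<forall>\<^sub>F n in sequentially. a0 \<le> p n \<and> p n \<le> 1 - a0"
    and osc: "\<And>\<tau>. 0 \<le> \<tau> \<Longrightarrow> \<exists>C. \<forall>\<^sub>F n in sequentially.
      oscillation_le \<epsilon> C (p n) \<tau> n"
    and \<gamma>: "0 < \<gamma>" "integrable M (\<lambda>\<omega>. \<bar>X 1 \<omega>\<bar> powr \<gamma>)"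
  defines "R \<equiv> (\<lambda>n. excess X n (J n) (quantile F (p n)))"
  shows "\<And>r. 0 \<le> r \<Longrightarrow> \<exists>C\<ge>0. \<forall>\<^sub>F n in sequentially.
      prob {\<omega> \<in> space M. R n \<omega> > C * (real n * mesh n * rate \<epsilon> n)} \<le> 8 * real n powr (- r)"
    and "\<exists>C. \<forall>\<^sub>F n in sequentially. random_variable borel (R n) \<and> integrable M (\<lambda>\<omega>. (R n \<omega>)\<^sup>2)
      \<and> expectation (\<lambda>\<omega>. (R n \<omega>)\<^sup>2) \<le> C * (real n * (rate \<epsilon> n)\<^sup>2)"
proof -
  interpret D: cdf_distribution law by (rule cdf_law)
  have interior: "\<forall>\<^sub>F n in sequentially. n > 1 \<and> 1 \<le> J n \<and> J n \<le> n \<and> a0 \<le> p n \<and> p n \<le> 1 - a0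
      \<and> 0 < p n - \<tau> * mesh n \<and> p n + \<tau> * mesh n < 1" for \<tau>
    using a0(2) eventually_mesh_less[OF a0(1), of \<tau>] eventually_gt_at_top[of 1]
  proof eventually_elim
    case (elim n)
    then have "0 < p n" "p n < 1" using a0(1) by auto
    then have "0 < real (J n)" "real (J n) < real n"
      using elim unfolding p_def by (auto simp: divide_simps split: if_splits)
    then show ?case using elim by auto
  qed
  {
    fix r :: real assume r: "0 \<le> r"
    define \<tau> where "\<tau> = sqrt r"
    have \<tau>: "0 \<le> \<tau>" "\<tau>\<^sup>2 = r" using r by (auto simp: \<tau>_def)
    obtain C where C: "\<forall>\<^sub>F n in sequentially.
        oscillation_le \<epsilon> C (p n) \<tau> n"
      using osc[OF \<tau>(1)] by blast
    have "\<forall>\<^sub>F n in sequentially.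
        prob {\<omega> \<in> space M. R n \<omega> > \<tau> * max C 0 * (real n * mesh n * rate \<epsilon> n)} \<le> 8 * real n powr (- r)"
      using C interior[of \<tau>]
    proof eventually_elim
      case (elim n)
      have d0: "0 \<le> \<tau> * mesh n" using \<tau> mesh_nonneg by simp
      have "C * rate \<epsilon> n \<le> max C 0 * rate \<epsilon> n" using rate_nonneg by (intro mult_right_mono) auto
      then have \<Delta>: "quantile F (p n + \<tau> * mesh n) - quantile F (p n) \<le> max C 0 * rate \<epsilon> n"
        "quantile F (p n) - quantile F (p n - \<tau> * mesh n) \<le> max C 0 * rate \<epsilon> n"
        using elim unfolding oscillation_le_def by auto
      have good: "R n \<omega> \<le> real n * (\<tau> * mesh n) * (max C 0 * rate \<epsilon> n)"
        if "\<omega> \<in> space M - atypical n (J n) (\<tau> * mesh n)" for \<omega>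
        unfolding R_def using elim
        by (intro excess_good[OF _ _ p_def refl d0 _ _ \<Delta> that]) auto
      have "prob {\<omega> \<in> space M. R n \<omega> > \<tau> * max C 0 * (real n * mesh n * rate \<epsilon> n)}
          \<le> prob (atypical n (J n) (\<tau> * mesh n))"
      proof (rule finite_measure_mono)
        show "atypical n (J n) (\<tau> * mesh n) \<in> events" using elim d0 by (intro atypical_event) auto
        show "{\<omega> \<in> space M. R n \<omega> > \<tau> * max C 0 * (real n * mesh n * rate \<epsilon> n)} \<subseteq> atypical n (J n) (\<tau> * mesh n)"
        proof
          fix \<omega> assume \<omega>: "\<omega> \<in> {\<omega> \<in> space M. R n \<omega> > \<tau> * max C 0 * (real n * mesh n * rate \<epsilon> n)}"
          show "\<omega> \<in> atypical n (J n) (\<tau> * mesh n)"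
          proof (rule ccontr)
            assume "\<omega> \<notin> atypical n (J n) (\<tau> * mesh n)"
            then have "R n \<omega> \<le> real n * (\<tau> * mesh n) * (max C 0 * rate \<epsilon> n)" using good \<omega> by auto
            also have "\<dots> = \<tau> * max C 0 * (real n * mesh n * rate \<epsilon> n)" by (simp only: mult_ac)
            finally show False using \<omega> by simp
          qed
        qed
      qed
      also have "\<dots> \<le> 8 * exp (- 2 * real n * (\<tau> * mesh n)\<^sup>2)" using elim d0 by (intro atypical_event) auto
      also have "\<dots> = 8 * real n powr (- 2 * r)" using elim by (subst exp_mesh) (auto simp: \<tau>)
      also have "\<dots> \<le> 8 * real n powr (- r)" using elim r by (intro mult_left_mono powr_mono) auto
      finally show ?case .
    qed
    moreover have "0 \<le> \<tau> * max C 0" using \<tau> by simp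
    ultimately show "\<exists>C\<ge>0. \<forall>\<^sub>F n in sequentially.
      prob {\<omega> \<in> space M. R n \<omega> > C * (real n * mesh n * rate \<epsilon> n)} \<le> 8 * real n powr (- r)" by blast
  }
  \<comment> \<open>The number of observations whose moments of order \<gamma> combine into a fourth
    moment of the order statistic.\<close>
  define r where "r = nat \<lceil>4 / \<gamma>\<rceil>"
  have r: "4 \<le> \<gamma> * real r"
  proof -
    have "4 / \<gamma> \<le> real r" unfolding r_def by (rule real_nat_ceiling_ge)
    then show ?thesis using \<gamma>(1) by (simp add: field_simps)
  qed
  define m where "m = expectation (\<lambda>\<omega>. \<bar>X 1 \<omega>\<bar> powr \<gamma>)"
  have m0: "0 \<le> m" unfolding m_def by (intro integral_nonneg_AE) auto
  \<comment> \<open>Matched with s = n^(r + 3) below: up to constants, the fourth-moment part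
    becomes n^2 n^r / s = 1 / n and the probability part n^2 s n^(-2 (r + 3)) = n^(-1 - r), so both
    are at most of order 1 / n.\<close>
  define \<tau> where "\<tau> = sqrt (real r + 3)"
  have \<tau>: "0 \<le> \<tau>" "\<tau>\<^sup>2 = real r + 3" by (auto simp: \<tau>_def)
  obtain C where C: "\<forall>\<^sub>F n in sequentially.
      oscillation_le \<epsilon> C (p n) \<tau> n"
    using osc[OF \<tau>(1)] by blast
  define K where "K = \<bar>quantile F a0\<bar> + \<bar>quantile F (1 - a0)\<bar>"
  \<comment> \<open>As p stays in [a0, 1 - a0], eventually r is at most \<open>J n\<close> and at
    most \<open>n - J n\<close>, which the moment bound requires.\<close>
  have rl: "\<forall>\<^sub>F n in sequentially. real r \<le> a0 * real n" using a0(1) by real_asymp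
  \<comment> \<open>Equivalently 1 / n <= n times the squared rate, so contributions of order 1 / n
    are absorbed.\<close>
  have small: "\<forall>\<^sub>F n in sequentially. 1 \<le> (real n * rate \<epsilon> n)\<^sup>2"
  proof -
    have "filterlim (\<lambda>n::nat. (real n * ln (real n) powr (- (1 + \<epsilon>)))\<^sup>2) at_top sequentially" by real_asymp
    then show ?thesis unfolding rate_def filterlim_at_top by blast
  qed
  define C2 where "C2 = 4 * (1 + m ^ r + K ^ 4) + 4"
  have C20: "0 \<le> C2" using m0 by (simp add: C2_def K_def)
  have "\<forall>\<^sub>F n in sequentially. random_variable borel (R n) \<and> integrable M (\<lambda>\<omega>. (R n \<omega>)\<^sup>2)
      \<and> expectation (\<lambda>\<omega>. (R n \<omega>)\<^sup>2) \<le> (2 * (max C 0)\<^sup>2 + C2) * (real n * (rate \<epsilon> n)\<^sup>2)"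
    using C interior[of \<tau>] rl small
  proof eventually_elim
    case (elim n)
    let ?q = "\<lambda>\<omega>. order_stat X n (J n) \<omega>"
    let ?a = "quantile F (p n)"
    let ?n = "real n"
    have n: "n > 1" and J: "1 \<le> J n" "J n \<le> n" and n0: "?n > 0" using elim by auto
    have Jn: "real (J n) = ?n * p n" using n0 by (simp add: p_def)
    have d0: "0 \<le> \<tau> * mesh n" using \<tau> mesh_nonneg by simp
    have "C * rate \<epsilon> n \<le> max C 0 * rate \<epsilon> n" using rate_nonneg by (intro mult_right_mono) auto
    then have \<Delta>: "quantile F (p n + \<tau> * mesh n) - ?a \<le> max C 0 * rate \<epsilon> n"
      "?a - quantile F (p n - \<tau> * mesh n) \<le> max C 0 * rate \<epsilon> n"
      using elim unfolding oscillation_le_def by auto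
    have "?n * a0 \<le> ?n * p n" "?n * a0 \<le> ?n * (1 - p n)" using elim n0 by (auto intro!: mult_left_mono)
    moreover have "real r \<le> ?n * a0" using elim by (simp add: mult.commute)
    ultimately have "real r \<le> real (J n)" "real r \<le> ?n - real (J n)"
      unfolding Jn right_diff_distrib by linarith+
    then have rJ: "r \<le> J n" "r \<le> n - J n + 1" by linarith+
    note q4 = order_stat_moment[OF J rJ \<gamma>(1) r \<gamma>(2), folded m_def]
    define s where "s = ?n powr (real r + 3)"
    have s: "0 < s" using n0 by (simp add: s_def)
    have s_eq: "s = ?n ^ r * ?n ^ 3"
    proof -
      have "s = ?n powr real r * ?n powr real 3" by (simp add: s_def powr_add)
      then show ?thesis using n0 by (simp only: powr_realpow)
    qed
    have pd: "0 < p n - \<tau> * mesh n" "p n + \<tau> * mesh n < 1" using elim by auto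
    note mom = excess_second_moment[OF J p_def refl d0 pd \<Delta> s q4(1)]
    have a4: "?a ^ 4 \<le> K ^ 4"
    proof -
      have "quantile F a0 \<le> ?a" "?a \<le> quantile F (1 - a0)"
        unfolding F_eq using elim a0(1) by (auto intro!: D.quantile_mono)
      then have "\<bar>?a\<bar> \<le> K" unfolding K_def by auto
      then have "\<bar>?a\<bar> ^ 4 \<le> K ^ 4" by (intro power_mono) auto
      then show ?thesis by simp
    qed
    have nr: "1 \<le> ?n ^ r" using n by simp
    have one: "?n\<^sup>2 / 2 * (8 / s * (expectation (\<lambda>\<omega>. (?q \<omega>) ^ 4) + ?a ^ 4)) \<le> 4 * (1 + m ^ r + K ^ 4) / ?n"
    proof -
      have "expectation (\<lambda>\<omega>. (?q \<omega>) ^ 4) + ?a ^ 4 \<le> (1 + ?n ^ r * m ^ r) + K ^ 4"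
        using q4(2) a4 by linarith
      also have "\<dots> \<le> ?n ^ r * (1 + m ^ r + K ^ 4)"
        using nr mult_right_mono[OF nr, of "K ^ 4"] by (simp add: algebra_simps)
      finally have "?n\<^sup>2 / 2 * (8 / s * (expectation (\<lambda>\<omega>. (?q \<omega>) ^ 4) + ?a ^ 4))
          \<le> ?n\<^sup>2 / 2 * (8 / s * (?n ^ r * (1 + m ^ r + K ^ 4)))"
        using s by (intro mult_left_mono) auto
      also have "\<dots> = 4 * (1 + m ^ r + K ^ 4) / ?n"
        unfolding s_eq using n0 by (simp add: power2_eq_square power3_eq_cube field_simps)
      finally show ?thesis .
    qed
    have two: "?n\<^sup>2 / 2 * (s * (8 * exp (- 2 * ?n * (\<tau> * mesh n)\<^sup>2))) \<le> 4 / ?n"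
    proof -
      have "?n\<^sup>2 / 2 * (s * (8 * exp (- 2 * ?n * (\<tau> * mesh n)\<^sup>2)))
          = 4 * (?n powr 2 * (?n powr (real r + 3) * ?n powr (- 2 * (real r + 3))))"
        unfolding exp_mesh[OF n] \<tau>(2) s_def using n0 by (simp add: powr_numeral)
      also have "\<dots> = 4 * ?n powr (2 + (real r + 3 + - 2 * (real r + 3)))" by (simp only: powr_add)
      also have "\<dots> = 4 * ?n powr (- 1 - real r)" by simp
      also have "\<dots> \<le> 4 * ?n powr (- 1)" using n by (intro mult_left_mono powr_mono) auto
      also have "\<dots> = 4 / ?n" using n0 by (simp add: powr_minus_divide)
      finally show ?thesis .
    qed
    have "expectation (\<lambda>\<omega>. (R n \<omega>)\<^sup>2) \<le> (max C 0 * rate \<epsilon> n)\<^sup>2 * (2 * ?n) + C2 / ?n"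
      using mom(2) one two unfolding R_def C2_def distrib_left add_divide_distrib by linarith
    also have "C2 / ?n \<le> C2 * (?n * (rate \<epsilon> n)\<^sup>2)"
    proof -
      have "C2 / ?n * 1 \<le> C2 / ?n * (?n * rate \<epsilon> n)\<^sup>2" using elim C20 n0 by (intro mult_left_mono) auto
      also have "\<dots> = C2 * (?n * (rate \<epsilon> n)\<^sup>2)" using n0 by (simp add: power2_eq_square)
      finally show ?thesis by simp
    qed
    finally have "expectation (\<lambda>\<omega>. (R n \<omega>)\<^sup>2) \<le> (max C 0 * rate \<epsilon> n)\<^sup>2 * (2 * ?n) + C2 * (?n * (rate \<epsilon> n)\<^sup>2)" by simp
    also have "\<dots> = (2 * (max C 0)\<^sup>2 + C2) * (?n * (rate \<epsilon> n)\<^sup>2)"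
      by (simp add: power_mult_distrib algebra_simps)
    finally show ?case
      using mom(1) excess_measurable[OF J p_def refl d0 pd \<Delta>] unfolding R_def by simp
  qed
  then show "\<exists>C. \<forall>\<^sub>F n in sequentially. random_variable borel (R n) \<and> integrable M (\<lambda>\<omega>. (R n \<omega>)\<^sup>2)
      \<and> expectation (\<lambda>\<omega>. (R n \<omega>)\<^sup>2) \<le> C * (real n * (rate \<epsilon> n)\<^sup>2)" by blast
qed

end

subsection \<open>The trimmed mean\<close>

lemma (in prob_space) expectation_le_sqrt_second_moment:
  fixes Y :: "'a \<Rightarrow> real"
  assumes Y: "random_variable borel Y" "integrable M (\<lambda>\<omega>. (Y \<omega>)\<^sup>2)"
  shows "\<bar>expectation Y\<bar> \<le> sqrt (expectation (\<lambda>\<omega>. (Y \<omega>)\<^sup>2))"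
proof -
  have "0 \<le> expectation (\<lambda>\<omega>. (Y \<omega>)\<^sup>2) - (expectation Y)\<^sup>2"
    using variance_positive[of Y] variance_eq[OF integrable_of_square[OF Y] Y(2)] by simp
  then have "sqrt ((expectation Y)\<^sup>2) \<le> sqrt (expectation (\<lambda>\<omega>. (Y \<omega>)\<^sup>2))"
    by (intro real_sqrt_le_mono) simp
  then show ?thesis by simp
qed

lemma (in prob_space) second_moment_diff_le:
  fixes Y Z :: "'a \<Rightarrow> real"
  assumes Y: "random_variable borel Y" "integrable M (\<lambda>\<omega>. (Y \<omega>)\<^sup>2)"
    and Z: "random_variable borel Z" "integrable M (\<lambda>\<omega>. (Z \<omega>)\<^sup>2)"
  shows "integrable M (\<lambda>\<omega>. (Y \<omega> - Z \<omega>)\<^sup>2)"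
    and "expectation (\<lambda>\<omega>. (Y \<omega> - Z \<omega>)\<^sup>2)
      \<le> 2 * (expectation (\<lambda>\<omega>. (Y \<omega>)\<^sup>2) + expectation (\<lambda>\<omega>. (Z \<omega>)\<^sup>2))"
proof -
  show int: "integrable M (\<lambda>\<omega>. (Y \<omega> - Z \<omega>)\<^sup>2)"
    using integrable_square_add[OF Y(1) _ Y(2), of "\<lambda>\<omega>. - Z \<omega>"] Z by simp
  have "(y - z)\<^sup>2 \<le> 2 * (y\<^sup>2 + z\<^sup>2)" for y z :: real
  proof -
    have "2 * (y\<^sup>2 + z\<^sup>2) = (y - z)\<^sup>2 + (y + z)\<^sup>2" by (simp add: power2_eq_square algebra_simps)
    then show ?thesis by simp
  qed
  then have "expectation (\<lambda>\<omega>. (Y \<omega> - Z \<omega>)\<^sup>2) \<le> expectation (\<lambda>\<omega>. 2 * ((Y \<omega>)\<^sup>2 + (Z \<omega>)\<^sup>2))"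
    using Y(2) Z(2) by (intro integral_mono int) auto
  then show "expectation (\<lambda>\<omega>. (Y \<omega> - Z \<omega>)\<^sup>2)
      \<le> 2 * (expectation (\<lambda>\<omega>. (Y \<omega>)\<^sup>2) + expectation (\<lambda>\<omega>. (Z \<omega>)\<^sup>2))"
    using Y(2) Z(2) by simp
qed

context iid_sample
begin

text \<open>The terms k a and m b of the pointwise identity are exactly those by which n times the
  Winsorized mean differs from n \<mu>. What remains is a centred sum and two excesses, with no
  deterministic bias.\<close>

lemma trimmed_mean_decomposition:
  assumes n: "n > 0" "k n < n - m n" and \<alpha>: "\<alpha> = real (k n) / real n" and \<beta>: "\<beta> = real (m n) / real n"
    and pos: "0 < \<alpha>" "1 - \<beta> < 1"
  defines "a \<equiv> quantile F \<alpha>" and "b \<equiv> quantile F (1 - \<beta>)"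
  shows "real n * (trimmed_mean X k m n \<omega> - trimmed_centering F \<alpha> \<beta>)
    = (\<Sum>i = 1..n. winsorize a b (X i \<omega>)) - real n * integral\<^sup>L law (winsorize a b)
      + (excess X n (n - m n) b \<omega> - excess X n (k n) a \<omega>)"
proof -
  interpret D: cdf_distribution law by (rule cdf_law)
  have lt: "\<alpha> < 1 - \<beta>"
  proof -
    have "real (k n) < real n - real (m n)" using n by linarith
    then show ?thesis unfolding \<alpha> \<beta> using n(1) by (simp add: field_simps)
  qed
  have ab: "a \<le> b" unfolding a_def b_def F_eq using lt pos by (intro D.quantile_mono) auto
  have "integral\<^sup>L law (winsorize a b) = \<alpha> * a + trimmed_centering F \<alpha> \<beta> + \<beta> * b"
    unfolding a_def b_def F_eq by (rule D.expectation_winsorized[OF pos(1) lt pos(2)])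
  then have "real n * integral\<^sup>L law (winsorize a b)
      = (real n * \<alpha>) * a + real n * trimmed_centering F \<alpha> \<beta> + (real n * \<beta>) * b"
    by (simp add: algebra_simps)
  moreover have "real n * \<alpha> = real (k n)" "real n * \<beta> = real (m n)" using n(1) by (simp_all add: \<alpha> \<beta>)
  ultimately show ?thesis
    using trimmed_mean_winsorized[where k = k and m = m and n = n and X = X and \<omega> = \<omega>, OF n(2) ab] by (simp add: right_diff_distrib)
qed

lemma winsorized_sd_eq:
  "winsorized_sd M (X 1) F \<alpha> \<beta> = sqrt (\<integral>x. (winsorize (quantile F \<alpha>) (quantile F (1 - \<beta>)) x
    - integral\<^sup>L law (winsorize (quantile F \<alpha>) (quantile F (1 - \<beta>))))\<^sup>2 \<partial>law)"
proof -
  interpret D: cdf_distribution law by (rule cdf_law)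
  let ?W = "winsorize (quantile F \<alpha>) (quantile F (1 - \<beta>))"
  have [measurable]: "?W \<in> borel_measurable borel" by (rule D.borel_measurable_winsorize)
  have "expectation (\<lambda>\<omega>. ?W (X 1 \<omega>)) = integral\<^sup>L law ?W" by (rule expectation_X) simp_all
  moreover have "expectation (\<lambda>\<omega>. (?W (X 1 \<omega>) - integral\<^sup>L law ?W)\<^sup>2) = (\<integral>x. (?W x - integral\<^sup>L law ?W)\<^sup>2 \<partial>law)"
    by (rule expectation_X[where f = "\<lambda>x. (?W x - integral\<^sup>L law ?W)\<^sup>2"]) simp_all
  ultimately show ?thesis unfolding winsorized_sd_def by simp
qed

text \<open>In the application f, hence the law of a summand, changes with n. The standardised
  summands are bounded by 2 K / s0, so the constant depends on K and s0 only and is the same along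
  the whole array.\<close>

lemma moderate_deviation_iid:
  fixes f :: "real \<Rightarrow> real"
  assumes f [measurable]: "f \<in> borel_measurable borel" and K: "\<And>x. \<bar>f x\<bar> \<le> K"
    and \<sigma>_def: "\<sigma> = sqrt (\<integral>x. (f x - integral\<^sup>L law f)\<^sup>2 \<partial>law)" and s0: "0 < s0" "s0 \<le> \<sigma>"
    and n: "n > 0" and x: "3 * (1 + \<bar>x\<bar>) \<le> real n powr (1 / 8)"
  shows "\<bar>prob {\<omega>\<in>space M. ((\<Sum>i = 1..n. f (X i \<omega>)) - real n * integral\<^sup>L law f) / (\<sigma> * sqrt (real n)) > x} - (1 - \<Phi> x)\<bar>
    \<le> md_const (2 * K / s0) * ((1 + \<bar>x\<bar>) * real n powr (- 1 / 8)) * (1 - \<Phi> x)"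
proof -
  interpret D: cdf_distribution law by (rule cdf_law)
  define e where "e = integral\<^sup>L law f"
  define g where "g x = (f x - e) / \<sigma>" for x
  have [measurable]: "g \<in> borel_measurable borel" unfolding g_def by measurable
  have \<sigma>: "0 < \<sigma>" using s0 by simp
  have K0: "0 \<le> K" using K[of 0] by simp
  have intf: "integrable law f" using K by (intro D.integrable_const_bound[of _ K]) auto
  have eK: "\<bar>e\<bar> \<le> K"
  proof -
    have "\<bar>e\<bar> \<le> (\<integral>x. \<bar>f x\<bar> \<partial>law)" unfolding e_def by (rule integral_abs_bound)
    also have "\<dots> \<le> (\<integral>x. K \<partial>law)" using K intf by (intro integral_mono) auto
    finally show ?thesis using D.prob_space by simp
  qed
  have gK: "\<bar>g x\<bar> \<le> 2 * K / s0" for x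
  proof -
    have "\<bar>g x\<bar> = \<bar>f x - e\<bar> / \<sigma>" using \<sigma> by (simp add: g_def)
    also have "\<dots> \<le> (2 * K) / s0"
      using K[of x] eK abs_triangle_ineq4[of "f x" e] s0 by (intro frac_le) auto
    finally show ?thesis .
  qed
  define P where "P = distr law borel g"
  have P: "prob_space P" "sets P = sets borel" unfolding P_def by (auto intro: D.prob_space_distr)
  have PK: "AE y in P. \<bar>y\<bar> \<le> 2 * K / s0"
    unfolding P_def using gK by (subst AE_distr_iff) auto
  have mean: "(\<integral>y. y \<partial>P) = 0"
    unfolding P_def g_def using intf D.prob_space by (subst integral_distr) (auto simp: e_def)
  have var: "(\<integral>y. y\<^sup>2 \<partial>P) = 1"
  proof -
    have "(\<integral>y. y\<^sup>2 \<partial>P) = (\<integral>x. (f x - e)\<^sup>2 / \<sigma>\<^sup>2 \<partial>law)"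
      unfolding P_def by (subst integral_distr) (auto simp: g_def power_divide)
    also have "\<dots> = (\<integral>x. (f x - e)\<^sup>2 \<partial>law) / \<sigma>\<^sup>2" by simp
    also have "(\<integral>x. (f x - e)\<^sup>2 \<partial>law) = \<sigma>\<^sup>2"
      unfolding \<sigma>_def e_def by (subst real_sqrt_pow2) (auto intro: integral_nonneg_AE)
    finally show ?thesis using \<sigma> by simp
  qed
  have "distr M borel (\<lambda>\<omega>. g (X i \<omega>)) = P" if "i \<in> {1..n}" for i
  proof -
    have "distr M borel (\<lambda>\<omega>. g (X i \<omega>)) = distr (distr M borel (X i)) borel g"
      using that by (subst distr_distr) (auto simp: o_def)
    then show ?thesis using that distr_X[of i] by (simp add: P_def)
  qed
  moreover have "indep_vars (\<lambda>_. borel) (\<lambda>i \<omega>. g (X i \<omega>)) {1..n}"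
    by (rule indep_comp) auto
  moreover have "0 \<le> 2 * K / s0" using K0 s0 by simp
  ultimately have "\<bar>prob {\<omega>\<in>space M. (\<Sum>i = 1..n. g (X i \<omega>)) > x * sqrt (real n)} - (1 - \<Phi> x)\<bar>
    \<le> md_const (2 * K / s0) * ((1 + \<bar>x\<bar>) * real n powr (- 1 / 8)) * (1 - \<Phi> x)"
    using moderate_deviation_bounded[of "{1..n}" n "\<lambda>i \<omega>. g (X i \<omega>)" P "2 * K / s0" x] n P PK mean var x by simp
  moreover have "(\<Sum>i = 1..n. g (X i \<omega>)) > x * sqrt (real n)
      \<longleftrightarrow> ((\<Sum>i = 1..n. f (X i \<omega>)) - real n * e) / (\<sigma> * sqrt (real n)) > x" for \<omega>
  proof -
    have "(\<Sum>i = 1..n. g (X i \<omega>)) = ((\<Sum>i = 1..n. f (X i \<omega>)) - real n * e) / \<sigma>"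
      unfolding g_def by (simp add: sum_divide_distrib[symmetric] sum_subtractf)
    then have "((\<Sum>i = 1..n. f (X i \<omega>)) - real n * e) / (\<sigma> * sqrt (real n)) = (\<Sum>i = 1..n. g (X i \<omega>)) / sqrt (real n)"
      by (simp only: divide_divide_eq_left)
    then show ?thesis using n by (simp only: pos_less_divide_eq real_sqrt_gt_0_iff of_nat_0_less_iff)
  qed
  ultimately show ?thesis unfolding e_def by simp
qed

text \<open>The weight w, which is \<alpha> or \<beta>, is at least a0. So t = \<tau> / sqrt a0
  gives a step of at least \<tau> times \<open>mesh\<close>, and monotonicity of the quantile
  function transfers the bound; w <= 1 keeps the arguments inside (0, 1).\<close>

lemma oscillation_from_increments:
  fixes p w :: "nat \<Rightarrow> real"
  assumes a0: "0 < a0" "\<forall>\<^sub>F n in sequentially. a0 \<le> p n \<and> p n \<le> 1 - a0 \<and> a0 \<le> w n \<and> w n \<le> 1"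
    and incr: "\<And>t. (\<lambda>n. quantile F (p n + t * sqrt (w n * ln (real n) / real n)) - quantile F (p n))
      \<in> O(\<lambda>n. ln (real n) powr (- (1 + \<epsilon>)))"
    and \<tau>: "0 \<le> \<tau>"
  shows "\<exists>C. \<forall>\<^sub>F n in sequentially.
      oscillation_le \<epsilon> C (p n) \<tau> n"
proof -
  interpret D: cdf_distribution law by (rule cdf_law)
  define t where "t = \<tau> / sqrt a0"
  have t0: "0 \<le> t" using \<tau> a0 by (simp add: t_def)
  obtain C1 where C1: "\<forall>\<^sub>F n in sequentially.
      norm (quantile F (p n + t * sqrt (w n * ln (real n) / real n)) - quantile F (p n)) \<le> C1 * norm (ln (real n) powr (- (1 + \<epsilon>)))"
    using landau_o.bigE[OF incr[of t]] by blast
  obtain C2 where C2: "\<forall>\<^sub>F n in sequentially.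
      norm (quantile F (p n + (- t) * sqrt (w n * ln (real n) / real n)) - quantile F (p n)) \<le> C2 * norm (ln (real n) powr (- (1 + \<epsilon>)))"
    using landau_o.bigE[OF incr[of "- t"]] by blast
  have "\<forall>\<^sub>F n in sequentially.
      oscillation_le \<epsilon> (max C1 C2) (p n) \<tau> n"
    using C1 C2 a0(2) eventually_mesh_less[OF a0(1), of t]
  proof eventually_elim
    case (elim n)
    define y where "y = t * sqrt (w n * ln (real n) / real n)"
    have y: "y = t * (sqrt (w n) * mesh n)" by (simp add: y_def mesh_def real_sqrt_mult[symmetric])
    have "sqrt a0 * mesh n \<le> sqrt (w n) * mesh n" using elim mesh_nonneg by (intro mult_right_mono) auto
    then have "t * (sqrt a0 * mesh n) \<le> y" unfolding y using t0 by (intro mult_left_mono)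
    then have low: "\<tau> * mesh n \<le> y" using a0(1) by (simp add: t_def)
    have "sqrt (w n) * mesh n \<le> 1 * mesh n" using elim mesh_nonneg by (intro mult_right_mono) auto
    then have "y \<le> t * (1 * mesh n)" unfolding y using t0 by (intro mult_left_mono)
    then have up: "y < a0" using elim by simp
    have p: "0 < p n - y" "p n + y < 1" using up elim by auto
    have y0: "0 \<le> \<tau> * mesh n" using \<tau> mesh_nonneg by simp
    have "quantile F (p n + \<tau> * mesh n) \<le> quantile F (p n + y)"
      unfolding F_eq using low p y0 up elim a0(1) by (intro D.quantile_mono) auto
    moreover have "quantile F (p n - y) \<le> quantile F (p n - \<tau> * mesh n)"
      unfolding F_eq using low p y0 elim a0(1) by (intro D.quantile_mono) auto
    moreover have "C1 * rate \<epsilon> n \<le> max C1 C2 * rate \<epsilon> n" "C2 * rate \<epsilon> n \<le> max C1 C2 * rate \<epsilon> n"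
      using rate_nonneg by (auto intro!: mult_right_mono)
    moreover have "quantile F (p n + y) - quantile F (p n) \<le> C1 * rate \<epsilon> n"
      using elim(1) unfolding y_def rate_def by simp
    moreover have "quantile F (p n) - quantile F (p n - y) \<le> C2 * rate \<epsilon> n"
      using elim(2) unfolding y_def rate_def by simp
    ultimately show ?case unfolding oscillation_le_def by linarith
  qed
  then show ?thesis by blast
qed

end

theorem theorem1p4:
  fixes M :: "'a measure"
    and X :: "nat \<Rightarrow> 'a \<Rightarrow> real"
    and F :: "real \<Rightarrow> real"
    and k m :: "nat \<Rightarrow> nat"
    and \<alpha> \<beta> \<mu> \<sigma>W :: "nat \<Rightarrow> real"
    and T :: "nat \<Rightarrow> 'a \<Rightarrow> real"
    and \<epsilon> \<gamma> :: real
  assumes "prob_space M"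
    and "prob_space.indep_vars M (\<lambda>_. borel) X {1..}"
    and "\<And>i. i \<ge> 1 \<Longrightarrow> distr M borel (X i) = distr M borel (X 1)"
    and F_def: "F = cdf (distr M borel (X 1))"
    and "\<And>n. n \<ge> 1 \<Longrightarrow> k n < n - m n"
    and \<alpha>_def: "\<And>n. \<alpha> n = real (k n) / real n"
    and \<beta>_def: "\<And>n. \<beta> n = real (m n) / real n"
    and T_def: "\<And>n. T n = trimmed_mean X k m n"
    and \<mu>_def: "\<And>n. \<mu> n = trimmed_centering F (\<alpha> n) (\<beta> n)"
    and \<sigma>W_def: "\<And>n. \<sigma>W n = winsorized_sd M (X 1) F (\<alpha> n) (\<beta> n)"
    and "filterlim (\<lambda>n. min (k n) (m n)) at_top sequentially"
    and "liminf (\<lambda>n. ereal (\<sigma>W n)) > 0"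
    and "0 < liminf (\<lambda>n. ereal (\<alpha> n))"
    and "limsup (\<lambda>n. ereal (1 - \<beta> n)) < 1"
    and "limsup (\<lambda>n. ereal (\<alpha> n)) < liminf (\<lambda>n. ereal (1 - \<beta> n))"
    and "\<epsilon> > 0"
    and "\<And>t. (\<lambda>n. G_incr F (\<alpha> n) n t) \<in> O(\<lambda>n. ln (real n) powr (- (1 + \<epsilon>)))"
    and "\<And>t. (\<lambda>n. H_incr F (\<beta> n) n t) \<in> O(\<lambda>n. ln (real n) powr (- (1 + \<epsilon>)))"
    and "\<gamma> > 0"
    and "integrable M (\<lambda>\<omega>. \<bar>X 1 \<omega>\<bar> powr \<gamma>)"
  shows "(\<forall>\<^sub>F n in sequentially. integrable M (T n) \<and> integrable M (\<lambda>\<omega>. (T n \<omega>)\<^sup>2))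
     \<and> (\<lambda>n. sqrt (real n) * (prob_space.expectation M (T n) - \<mu> n))
          \<in> O(\<lambda>n. ln (real n) powr (- (1 + \<epsilon>)))
     \<and> (\<lambda>n. sqrt (prob_space.variance M (T n)) / (\<sigma>W n / sqrt (real n)) - 1)
          \<in> O(\<lambda>n. ln (real n) powr (- (1 + \<epsilon>)))
     \<and> (\<forall>a \<in> {\<mu>, \<lambda>n. prob_space.expectation M (T n)}.
        \<forall>b \<in> {\<sigma>W, \<lambda>n. sqrt (real n * prob_space.variance M (T n))}.
        \<forall>c>0. \<forall>A>0.
          uniform_asymp_equiv (\<lambda>n. {- A..c * sqrt (ln (real n))})
            (\<lambda>n x. \<P>(\<omega> in M. sqrt (real n) * (T n \<omega> - a n) / b n > x)) (\<lambda>x. 1 - \<Phi> x)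
        \<and> uniform_asymp_equiv (\<lambda>n. {- A..c * sqrt (ln (real n))})
            (\<lambda>n x. \<P>(\<omega> in M. sqrt (real n) * (T n \<omega> - a n) / b n < - x)) (\<lambda>x. \<Phi> (- x)))"
proof -
  interpret iid_sample M X F
    using assms(1-3) F_def by (intro iid_sample.intro iid_sample_axioms.intro)
  interpret D: cdf_distribution law by (rule cdf_law)
  define L where "L = rate \<epsilon>"
  have L0: "0 \<le> L n" for n unfolding L_def by (rule rate_nonneg)
  obtain a1 where a1: "0 < ereal a1" "ereal a1 < liminf (\<lambda>n. ereal (\<alpha> n))"
    using ereal_dense2[OF assms(13)] by auto
  obtain a2 where a2: "limsup (\<lambda>n. ereal (1 - \<beta> n)) < ereal a2" "ereal a2 < 1"
    using ereal_dense2[OF assms(14)] by auto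
  obtain s0 where s0: "0 < ereal s0" "ereal s0 < liminf (\<lambda>n. ereal (\<sigma>W n))"
    using ereal_dense2[OF assms(12)] by auto
  have s0_pos: "0 < s0" using s0(1) by simp
  have \<sigma>_ge: "\<forall>\<^sub>F n in sequentially. s0 \<le> \<sigma>W n"
    using less_LiminfD[OF s0(2)] by eventually_elim auto
  \<comment> \<open>One margin for both ends: eventually \<alpha> and 1 - \<beta> lie in
    [a0, 1 - a0].\<close>
  define a0 where "a0 = min a1 (1 - a2)"
  have a0: "0 < a0" using a1(1) a2(2) by (simp add: a0_def one_ereal_def)
  have range: "\<forall>\<^sub>F n in sequentially. n > 1 \<and> a0 \<le> \<alpha> n \<and> \<alpha> n < 1 - \<beta> n \<and> 1 - \<beta> n \<le> 1 - a0"
    using less_LiminfD[OF a1(2)] Limsup_lessD[OF a2(1)] eventually_gt_at_top[of 1]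
  proof eventually_elim
    case (elim n)
    have "real (k n) < real n - real (m n)" using assms(5)[of n] elim by linarith
    then have "\<alpha> n < 1 - \<beta> n" unfolding \<alpha>_def \<beta>_def using elim by (simp add: field_simps)
    then show ?case using elim by (auto simp: a0_def)
  qed
  \<comment> \<open>The quotient j / n for j = n - m, in the form required by
    \<open>excess_asymptotics\<close> for every n. It agrees with 1 - \<beta> only for n >= 1, where
    m < n makes the natural subtraction exact.\<close>
  define p2 where "p2 n = real (n - m n) / real n" for n
  have p2: "\<forall>\<^sub>F n in sequentially. p2 n = 1 - \<beta> n"
    using eventually_gt_at_top[of 1]
  proof eventually_elim
    case (elim n)
    then have "m n \<le> n" using assms(5)[of n] by linarith
    then show ?case using elim by (simp add: p2_def \<beta>_def of_nat_diff field_simps)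
  qed
  define f where "f n = winsorize (quantile F (\<alpha> n)) (quantile F (1 - \<beta> n))" for n
  define e where "e n = integral\<^sup>L law (f n)" for n
  define V where "V n \<omega> = (\<Sum>i = 1..n. f n (X i \<omega>)) - real n * e n" for n \<omega>
  define R1 where "R1 n = excess X n (k n) (quantile F (\<alpha> n))" for n
  define R2 where "R2 n = excess X n (n - m n) (quantile F (p2 n))" for n
  have osc1: "\<exists>C. \<forall>\<^sub>F n in sequentially.
      oscillation_le \<epsilon> C (\<alpha> n) \<tau> n" if "0 \<le> \<tau>" for \<tau>
  proof (rule oscillation_from_increments[OF a0 _ _ that])
    show "\<forall>\<^sub>F n in sequentially. a0 \<le> \<alpha> n \<and> \<alpha> n \<le> 1 - a0 \<and> a0 \<le> \<alpha> n \<and> \<alpha> n \<le> 1"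
      using range by eventually_elim (use a0 in auto)
    show "(\<lambda>n. quantile F (\<alpha> n + t * sqrt (\<alpha> n * ln (real n) / real n)) - quantile F (\<alpha> n))
      \<in> O(\<lambda>n. ln (real n) powr (- (1 + \<epsilon>)))" for t
      using assms(17)[of t] unfolding G_incr_def .
  qed
  have osc2: "\<exists>C. \<forall>\<^sub>F n in sequentially.
      oscillation_le \<epsilon> C (p2 n) \<tau> n" if "0 \<le> \<tau>" for \<tau>
  proof -
    have "\<exists>C. \<forall>\<^sub>F n in sequentially.
      oscillation_le \<epsilon> C (1 - \<beta> n) \<tau> n"
    proof (rule oscillation_from_increments[OF a0 _ _ that])
      show "\<forall>\<^sub>F n in sequentially. a0 \<le> 1 - \<beta> n \<and> 1 - \<beta> n \<le> 1 - a0 \<and> a0 \<le> \<beta> n \<and> \<beta> n \<le> 1"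
        using range by eventually_elim (use a0 in auto)
      show "(\<lambda>n. quantile F (1 - \<beta> n + t * sqrt (\<beta> n * ln (real n) / real n)) - quantile F (1 - \<beta> n))
        \<in> O(\<lambda>n. ln (real n) powr (- (1 + \<epsilon>)))" for t
        using assms(18)[of t] unfolding H_incr_def .
    qed
    then obtain C where C: "\<forall>\<^sub>F n in sequentially.
      oscillation_le \<epsilon> C (1 - \<beta> n) \<tau> n" by blast
    have "\<forall>\<^sub>F n in sequentially.
      oscillation_le \<epsilon> C (p2 n) \<tau> n"
      using C p2 by eventually_elim simp
    then show ?thesis by blast
  qed
  have rg1: "\<forall>\<^sub>F n in sequentially. a0 \<le> \<alpha> n \<and> \<alpha> n \<le> 1 - a0"
    using range by eventually_elim auto
  have rg2: "\<forall>\<^sub>F n in sequentially. a0 \<le> p2 n \<and> p2 n \<le> 1 - a0"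
    using range p2 by eventually_elim auto
  note EA1 = excess_asymptotics[OF \<alpha>_def a0 rg1 osc1 assms(19,20), folded R1_def L_def]
  note EA2 = excess_asymptotics[OF p2_def a0 rg2 osc2 assms(19,20), folded R2_def L_def]
  obtain C1 where C1: "\<forall>\<^sub>F n in sequentially. random_variable borel (R1 n) \<and> integrable M (\<lambda>\<omega>. (R1 n \<omega>)\<^sup>2)
      \<and> expectation (\<lambda>\<omega>. (R1 n \<omega>)\<^sup>2) \<le> C1 * (real n * (L n)\<^sup>2)" using EA1(2) by blast
  obtain C2 where C2: "\<forall>\<^sub>F n in sequentially. random_variable borel (R2 n) \<and> integrable M (\<lambda>\<omega>. (R2 n \<omega>)\<^sup>2)
      \<and> expectation (\<lambda>\<omega>. (R2 n \<omega>)\<^sup>2) \<le> C2 * (real n * (L n)\<^sup>2)" using EA2(2) by blast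
  define \<Delta> where "\<Delta> n \<omega> = R2 n \<omega> - R1 n \<omega>" for n \<omega>
  define C where "C = sqrt (max 0 (2 * (C1 + C2)))"
  have C0: "0 \<le> C" by (simp add: C_def)
  have \<Delta>: "\<forall>\<^sub>F n in sequentially. random_variable borel (\<Delta> n) \<and> integrable M (\<lambda>\<omega>. (\<Delta> n \<omega>)\<^sup>2)
      \<and> sqrt (expectation (\<lambda>\<omega>. (\<Delta> n \<omega>)\<^sup>2)) \<le> C * (sqrt (real n) * L n)"
    using C1 C2
  proof eventually_elim
    case (elim n)
    have d: "integrable M (\<lambda>\<omega>. (\<Delta> n \<omega>)\<^sup>2)"
      "expectation (\<lambda>\<omega>. (\<Delta> n \<omega>)\<^sup>2) \<le> 2 * (expectation (\<lambda>\<omega>. (R2 n \<omega>)\<^sup>2) + expectation (\<lambda>\<omega>. (R1 n \<omega>)\<^sup>2))"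
      unfolding \<Delta>_def using elim by (intro second_moment_diff_le; simp)+
    have "expectation (\<lambda>\<omega>. (\<Delta> n \<omega>)\<^sup>2) \<le> 2 * (C1 + C2) * (real n * (L n)\<^sup>2)"
      using d(2) elim by (simp add: algebra_simps)
    also have "\<dots> \<le> max 0 (2 * (C1 + C2)) * (real n * (L n)\<^sup>2)" by (intro mult_right_mono) auto
    finally have "sqrt (expectation (\<lambda>\<omega>. (\<Delta> n \<omega>)\<^sup>2)) \<le> sqrt (max 0 (2 * (C1 + C2)) * (real n * (L n)\<^sup>2))"
      by (rule real_sqrt_le_mono)
    also have "\<dots> = C * (sqrt (real n) * L n)" using L0[of n] by (simp add: C_def real_sqrt_mult)
    finally have "sqrt (expectation (\<lambda>\<omega>. (\<Delta> n \<omega>)\<^sup>2)) \<le> C * (sqrt (real n) * L n)" .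
    moreover have "random_variable borel (\<Delta> n)" unfolding \<Delta>_def using elim by (intro borel_measurable_diff) auto
    ultimately show ?case using d(1) by blast
  qed
  define K where "K = \<bar>quantile F a0\<bar> + \<bar>quantile F (1 - a0)\<bar>"
  have K0: "0 \<le> K" by (simp add: K_def)
  have fm [measurable]: "f n \<in> borel_measurable borel" for n
    unfolding f_def by (rule D.borel_measurable_winsorize)
  have fK: "\<forall>\<^sub>F n in sequentially. \<forall>x. \<bar>f n x\<bar> \<le> K"
    using range
  proof eventually_elim
    case (elim n)
    have "quantile F a0 \<le> quantile F (\<alpha> n)" "quantile F (\<alpha> n) \<le> quantile F (1 - \<beta> n)"
      "quantile F (1 - \<beta> n) \<le> quantile F (1 - a0)"
      unfolding F_eq using elim a0 by (auto intro!: D.quantile_mono)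
    then show ?case unfolding f_def winsorize_def K_def by auto
  qed
  have \<sigma>: "\<sigma>W n = sqrt (\<integral>x. (f n x - e n)\<^sup>2 \<partial>law)" for n
    unfolding \<sigma>W_def winsorized_sd_eq f_def e_def ..
  have V: "\<forall>\<^sub>F n in sequentially. random_variable borel (V n) \<and> integrable M (\<lambda>\<omega>. (V n \<omega>)\<^sup>2)
      \<and> expectation (V n) = 0 \<and> sqrt (variance (V n)) = sqrt (real n) * \<sigma>W n"
    using fK
  proof eventually_elim
    case (elim n)
    have "(f n x)\<^sup>2 \<le> K\<^sup>2" for x using elim K0 abs_le_square_iff[of "f n x" K] by simp
    then have f2: "integrable law (\<lambda>x. (f n x)\<^sup>2)" by (intro D.integrable_const_bound[of _ "K\<^sup>2"]) auto
    note mom = sum_iid_moments[OF fm f2, of n, folded e_def]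
    have rvS: "random_variable borel (\<lambda>\<omega>. \<Sum>i = 1..n. f n (X i \<omega>))"
      by (intro borel_measurable_sum) measurable
    have rvV: "random_variable borel (V n)" unfolding V_def using rvS by measurable
    have V2: "integrable M (\<lambda>\<omega>. (V n \<omega>)\<^sup>2)"
      unfolding V_def using integrable_square_add[OF rvS _ mom(1), of "\<lambda>_. - (real n * e n)"] by simp
    have "expectation (V n) = expectation (\<lambda>\<omega>. \<Sum>i = 1..n. f n (X i \<omega>)) - real n * e n"
      unfolding V_def using integrable_of_square[OF rvS mom(1)] by (simp add: prob_space)
    then have EV: "expectation (V n) = 0" using mom(2) by simp
    have "variance (V n) = real n * (\<integral>x. (f n x - e n)\<^sup>2 \<partial>law)"
      unfolding mom(3)[symmetric] EV mom(2) V_def by simp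
    then show ?case using rvV V2 EV unfolding \<sigma> by (simp add: real_sqrt_mult)
  qed
  have decomp: "\<forall>\<^sub>F n in sequentially. \<forall>\<omega>. real n * (T n \<omega> - \<mu> n) = V n \<omega> + \<Delta> n \<omega>"
    using range p2
  proof eventually_elim
    case (elim n)
    have "real n * (T n \<omega> - \<mu> n) = V n \<omega> + \<Delta> n \<omega>" for \<omega>
      unfolding T_def \<mu>_def V_def \<Delta>_def R1_def R2_def f_def e_def using elim a0 assms(5)[of n]
      by (subst trimmed_mean_decomposition[OF _ _ \<alpha>_def \<beta>_def]) auto
    then show ?case by blast
  qed
  \<comment> \<open>\<open>V n\<close> has mean 0 and standard deviation sqrt n *
    \<open>\<sigma>W n\<close> exactly, so both errors are governed by the L2 norm of
    \<open>\<Delta> n\<close>: through its mean in the first, through the triangle inequality for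
    standard deviations in the second.\<close>
  have TE: "\<forall>\<^sub>F n in sequentially. random_variable borel (T n) \<and> integrable M (T n) \<and> integrable M (\<lambda>\<omega>. (T n \<omega>)\<^sup>2)
      \<and> \<bar>sqrt (real n) * (expectation (T n) - \<mu> n)\<bar> \<le> C * L n
      \<and> \<bar>sqrt (variance (T n)) / (\<sigma>W n / sqrt (real n)) - 1\<bar> \<le> C / s0 * L n"
    using \<Delta> V decomp \<sigma>_ge range
  proof eventually_elim
    case (elim n)
    have n0: "real n > 0" using elim by simp
    have Teq: "T n = (\<lambda>\<omega>. \<mu> n + (V n \<omega> + \<Delta> n \<omega>) / real n)"
    proof
      fix \<omega>
      have "real n * (T n \<omega> - \<mu> n) = V n \<omega> + \<Delta> n \<omega>" using elim by blast
      then show "T n \<omega> = \<mu> n + (V n \<omega> + \<Delta> n \<omega>) / real n" using n0 by (simp add: field_simps)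
    qed
    have rV: "random_variable borel (V n)" and V2: "integrable M (\<lambda>\<omega>. (V n \<omega>)\<^sup>2)"
      and r\<Delta>: "random_variable borel (\<Delta> n)" and \<Delta>2: "integrable M (\<lambda>\<omega>. (\<Delta> n \<omega>)\<^sup>2)" using elim by auto
    have iV: "integrable M (V n)" by (rule integrable_of_square[OF rV V2])
    have i\<Delta>: "integrable M (\<Delta> n)" by (rule integrable_of_square[OF r\<Delta> \<Delta>2])
    have rT: "random_variable borel (T n)" unfolding Teq using rV r\<Delta> by measurable
    have T2: "integrable M (\<lambda>\<omega>. (T n \<omega>)\<^sup>2)"
    proof -
      have "integrable M (\<lambda>\<omega>. ((V n \<omega> + \<Delta> n \<omega>) * (1 / real n))\<^sup>2)"
        unfolding power_mult_distrib by (intro integrable_mult_left integrable_square_add[OF rV r\<Delta> V2 \<Delta>2])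
      then show ?thesis unfolding Teq using rV r\<Delta>
        by (intro integrable_square_add) auto
    qed
    have iT: "integrable M (T n)" by (rule integrable_of_square[OF rT T2])
    have ET: "expectation (T n) = \<mu> n + expectation (\<Delta> n) / real n"
      unfolding Teq using iV i\<Delta> elim by (simp add: prob_space)
    have "\<bar>expectation (\<Delta> n)\<bar> \<le> C * (sqrt (real n) * L n)"
      using expectation_le_sqrt_second_moment[OF r\<Delta> \<Delta>2] elim by linarith
    moreover have "sqrt (real n) * (expectation (T n) - \<mu> n) = expectation (\<Delta> n) / sqrt (real n)"
      unfolding ET using n0 by (simp add: field_simps)
    ultimately have "\<bar>sqrt (real n) * (expectation (T n) - \<mu> n)\<bar> \<le> C * (sqrt (real n) * L n) / sqrt (real n)"
      by (simp only: abs_divide abs_of_nonneg real_sqrt_ge_zero of_nat_0_le_iff divide_right_mono)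
    then have E: "\<bar>sqrt (real n) * (expectation (T n) - \<mu> n)\<bar> \<le> C * L n" using n0 by simp
    have "variance (T n) = variance (\<lambda>\<omega>. V n \<omega> + \<Delta> n \<omega>) / (real n)\<^sup>2"
    proof -
      have "T n \<omega> - expectation (T n) = (V n \<omega> + \<Delta> n \<omega> - expectation (\<lambda>\<omega>. V n \<omega> + \<Delta> n \<omega>)) / real n" for \<omega>
        unfolding ET using iV i\<Delta> elim by (simp add: Teq add_divide_distrib diff_divide_distrib)
      then show ?thesis by (simp add: power_divide)
    qed
    then have sdT: "sqrt (variance (T n)) = sqrt (variance (\<lambda>\<omega>. V n \<omega> + \<Delta> n \<omega>)) / real n"
      using n0 by (simp add: real_sqrt_divide)
    have \<sigma>s: "0 < s0" "s0 \<le> \<sigma>W n" using s0_pos elim by auto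
    have "sqrt (variance (T n)) / (\<sigma>W n / sqrt (real n)) - 1
        = (sqrt (variance (\<lambda>\<omega>. V n \<omega> + \<Delta> n \<omega>)) - sqrt (variance (V n))) / (sqrt (real n) * \<sigma>W n)"
    proof -
      have vV: "sqrt (variance (V n)) = sqrt (real n) * \<sigma>W n" using elim by auto
      have "sqrt (variance (T n)) / (\<sigma>W n / sqrt (real n)) = sqrt (variance (\<lambda>\<omega>. V n \<omega> + \<Delta> n \<omega>)) / (sqrt (real n) * \<sigma>W n)"
        unfolding sdT using n0 \<sigma>s by (simp add: field_simps)
      then show ?thesis unfolding vV using n0 \<sigma>s by (simp add: diff_divide_distrib)
    qed
    also have "\<bar>(sqrt (variance (\<lambda>\<omega>. V n \<omega> + \<Delta> n \<omega>)) - sqrt (variance (V n))) / (sqrt (real n) * \<sigma>W n)\<bar>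
        \<le> (C * (sqrt (real n) * L n)) / (sqrt (real n) * s0)"
    proof -
      have "\<bar>sqrt (variance (\<lambda>\<omega>. V n \<omega> + \<Delta> n \<omega>)) - sqrt (variance (V n))\<bar> \<le> C * (sqrt (real n) * L n)"
        using sd_add_bound[OF rV r\<Delta> V2 \<Delta>2] elim by linarith
      then have "\<bar>sqrt (variance (\<lambda>\<omega>. V n \<omega> + \<Delta> n \<omega>)) - sqrt (variance (V n))\<bar> / (sqrt (real n) * \<sigma>W n)
          \<le> (C * (sqrt (real n) * L n)) / (sqrt (real n) * s0)"
        using n0 \<sigma>s C0 L0[of n] by (intro frac_le mult_left_mono) auto
      then show ?thesis using n0 \<sigma>s by (simp add: abs_mult)
    qed
    also have "\<dots> = C / s0 * L n" using n0 by simp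
    finally have "\<bar>sqrt (variance (T n)) / (\<sigma>W n / sqrt (real n)) - 1\<bar> \<le> C / s0 * L n" .
    then show ?case using rT iT T2 E by blast
  qed
  define S where "S n \<omega> = V n \<omega> / (\<sigma>W n * sqrt (real n))" for n \<omega>
  define \<kappa> where "\<kappa> = md_const (2 * K / s0)"
  have \<kappa>0: "0 \<le> \<kappa>" unfolding \<kappa>_def md_const_def using swap_const_nonneg[of "2 * K / s0"] K0 s0_pos by simp
  have S_upper: "\<forall>\<^sub>F n in sequentially. \<forall>x. 3 * (1 + \<bar>x\<bar>) \<le> real n powr (1 / 8) \<longrightarrow>
      \<bar>prob {\<omega>\<in>space M. S n \<omega> > x} - (1 - \<Phi> x)\<bar> \<le> \<kappa> * ((1 + \<bar>x\<bar>) * real n powr (- 1 / 8)) * (1 - \<Phi> x)"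
    using fK \<sigma>_ge range
  proof eventually_elim
    case (elim n)
    show ?case
    proof (intro allI impI)
      fix x :: real assume x: "3 * (1 + \<bar>x\<bar>) \<le> real n powr (1 / 8)"
      show "\<bar>prob {\<omega>\<in>space M. S n \<omega> > x} - (1 - \<Phi> x)\<bar> \<le> \<kappa> * ((1 + \<bar>x\<bar>) * real n powr (- 1 / 8)) * (1 - \<Phi> x)"
        unfolding S_def V_def e_def \<kappa>_def using elim
        by (intro moderate_deviation_iid[OF fm _ _ s0_pos _ _ x]) (auto simp: \<sigma> e_def)
    qed
  qed
  \<comment> \<open>The lower tail is the upper tail for - f, which has the same bound and the same
    variance.\<close>
  have S_lower: "\<forall>\<^sub>F n in sequentially. \<forall>x. 3 * (1 + \<bar>x\<bar>) \<le> real n powr (1 / 8) \<longrightarrow>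
      \<bar>prob {\<omega>\<in>space M. - S n \<omega> > x} - (1 - \<Phi> x)\<bar> \<le> \<kappa> * ((1 + \<bar>x\<bar>) * real n powr (- 1 / 8)) * (1 - \<Phi> x)"
    using fK \<sigma>_ge range
  proof eventually_elim
    case (elim n)
    have eq: "- S n \<omega> = ((\<Sum>i = 1..n. - f n (X i \<omega>)) - real n * integral\<^sup>L law (\<lambda>x. - f n x)) / (\<sigma>W n * sqrt (real n))" for \<omega>
      unfolding S_def V_def e_def by (simp add: sum_negf minus_divide_left)
    have sq: "\<sigma>W n = sqrt (\<integral>x. (- f n x - integral\<^sup>L law (\<lambda>x. - f n x))\<^sup>2 \<partial>law)"
      unfolding \<sigma> e_def by (simp add: power2_commute)
    show ?case
    proof (intro allI impI)
      fix x :: real assume x: "3 * (1 + \<bar>x\<bar>) \<le> real n powr (1 / 8)"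
      show "\<bar>prob {\<omega>\<in>space M. - S n \<omega> > x} - (1 - \<Phi> x)\<bar> \<le> \<kappa> * ((1 + \<bar>x\<bar>) * real n powr (- 1 / 8)) * (1 - \<Phi> x)"
        unfolding eq \<kappa>_def using elim
        by (intro moderate_deviation_iid[OF _ _ sq s0_pos _ _ x]) auto
    qed
  qed
  \<comment> \<open>For n > 1 this product is (log n)^(-\<epsilon>); here the positivity of
    \<epsilon> is decisive.\<close>
  have lnL: "(\<lambda>n. ln (real n) * L n) \<longlonglongrightarrow> 0"
    unfolding L_def rate_def using assms(16) by real_asymp
  have sqL: "(\<lambda>n. sqrt (ln (real n)) * L n) \<longlonglongrightarrow> 0"
    unfolding L_def rate_def using assms(16) by real_asymp
  \<comment> \<open>Stated for any centring within order L / sqrt n of \<mu> and any scale within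
    relative error of order L of \<sigma>W, so that all four combinations in the theorem are
    instances.\<close>
  have MD: "uniform_asymp_equiv (\<lambda>n. {- A..c * sqrt (ln (real n))})
        (\<lambda>n x. \<P>(\<omega> in M. sqrt (real n) * (T n \<omega> - a n) / b n > x)) (\<lambda>x. 1 - \<Phi> x)
      \<and> uniform_asymp_equiv (\<lambda>n. {- A..c * sqrt (ln (real n))})
        (\<lambda>n x. \<P>(\<omega> in M. sqrt (real n) * (T n \<omega> - a n) / b n < - x)) (\<lambda>x. \<Phi> (- x))"
    if a: "\<forall>\<^sub>F n in sequentially. \<bar>sqrt (real n) * (\<mu> n - a n)\<bar> \<le> Ca * L n"
      and b: "\<forall>\<^sub>F n in sequentially. s0 / 2 \<le> b n \<and> \<bar>\<sigma>W n / b n - 1\<bar> \<le> Cb * L n"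
      and cA: "0 < c" "0 < A" for a b :: "nat \<Rightarrow> real" and Ca Cb c A
  proof -
    define Z where "Z n \<omega> = sqrt (real n) * (T n \<omega> - a n) / b n" for n \<omega>
    \<comment> \<open>A change of scale multiplies the standardised Winsorized sum by \<rho>; the
      change of centring and the excesses form the additive error.\<close>
    define \<rho> where "\<rho> n = \<sigma>W n / b n" for n
    have rvZS: "\<forall>\<^sub>F n in sequentially. random_variable borel (S n) \<and> random_variable borel (Z n)"
      using V TE
    proof eventually_elim
      case (elim n)
      have [measurable]: "random_variable borel (V n)" "random_variable borel (T n)" using elim by auto
      show ?case unfolding S_def Z_def by measurable
    qed
    have \<rho>: "(\<lambda>n. \<bar>\<rho> n - 1\<bar> * ln (real n)) \<longlonglongrightarrow> 0"
    proof (rule Lim_null_comparison)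
      show "\<forall>\<^sub>F n in sequentially. norm (\<bar>\<rho> n - 1\<bar> * ln (real n)) \<le> Cb * (ln (real n) * L n)"
        using b range
      proof eventually_elim
        case (elim n)
        have l: "0 \<le> ln (real n)" using elim by simp
        then have "\<bar>\<rho> n - 1\<bar> * ln (real n) \<le> Cb * L n * ln (real n)"
          unfolding \<rho>_def using elim by (intro mult_right_mono) auto
        then show ?case using l by (simp add: abs_mult mult_ac)
      qed
      show "(\<lambda>n. Cb * (ln (real n) * L n)) \<longlonglongrightarrow> 0" using lnL by (rule tendsto_mult_right_zero)
    qed
    have diff: "\<forall>\<^sub>F n in sequentially. \<forall>\<omega>. \<bar>Z n \<omega> - \<rho> n * S n \<omega>\<bar>
        \<le> 2 / s0 * (\<bar>\<Delta> n \<omega>\<bar> / sqrt (real n) + Ca * L n)"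
      using a b decomp \<sigma>_ge range
    proof eventually_elim
      case (elim n)
      show ?case
      proof
        fix \<omega>
        have n0: "0 < real n" and b0: "0 < b n" and \<sigma>0: "0 < \<sigma>W n" using elim s0_pos by auto
        have "real n * (T n \<omega> - \<mu> n) = V n \<omega> + \<Delta> n \<omega>" using elim by blast
        then have "T n \<omega> - \<mu> n = (V n \<omega> + \<Delta> n \<omega>) / real n" using n0 by (simp add: field_simps)
        then have "sqrt (real n) * (T n \<omega> - \<mu> n) = sqrt (real n) / real n * (V n \<omega> + \<Delta> n \<omega>)" by simp
        then have "sqrt (real n) * (T n \<omega> - \<mu> n) = (V n \<omega> + \<Delta> n \<omega>) / sqrt (real n)"
          unfolding sqrt_divide_self_eq[OF of_nat_0_le_iff] by (simp only: divide_inverse_commute)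
        then have shift: "sqrt (real n) * (T n \<omega> - a n)
            = V n \<omega> / sqrt (real n) + (\<Delta> n \<omega> / sqrt (real n) + sqrt (real n) * (\<mu> n - a n))"
          by (simp add: right_diff_distrib add_divide_distrib)
        have "\<rho> n * S n \<omega> = V n \<omega> / sqrt (real n) / b n"
          unfolding \<rho>_def S_def using \<sigma>0 by simp
        then have "Z n \<omega> - \<rho> n * S n \<omega> = (\<Delta> n \<omega> / sqrt (real n) + sqrt (real n) * (\<mu> n - a n)) / b n"
          unfolding Z_def shift by (simp add: add_divide_distrib)
        then have "\<bar>Z n \<omega> - \<rho> n * S n \<omega>\<bar> = \<bar>\<Delta> n \<omega> / sqrt (real n) + sqrt (real n) * (\<mu> n - a n)\<bar> / b n"
          using b0 by simp
        also have "\<dots> \<le> (\<bar>\<Delta> n \<omega>\<bar> / sqrt (real n) + Ca * L n) / (s0 / 2)"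
        proof (rule frac_le)
          have "\<bar>\<Delta> n \<omega> / sqrt (real n) + sqrt (real n) * (\<mu> n - a n)\<bar>
              \<le> \<bar>\<Delta> n \<omega> / sqrt (real n)\<bar> + \<bar>sqrt (real n) * (\<mu> n - a n)\<bar>" by (rule abs_triangle_ineq)
          also have "\<dots> \<le> \<bar>\<Delta> n \<omega>\<bar> / sqrt (real n) + Ca * L n" using elim by simp
          finally show "\<bar>\<Delta> n \<omega> / sqrt (real n) + sqrt (real n) * (\<mu> n - a n)\<bar>
              \<le> \<bar>\<Delta> n \<omega>\<bar> / sqrt (real n) + Ca * L n" .
          then show "0 \<le> \<bar>\<Delta> n \<omega>\<bar> / sqrt (real n) + Ca * L n" by (rule order_trans[OF abs_ge_zero])
        qed (use elim s0_pos in auto)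
        finally show "\<bar>Z n \<omega> - \<rho> n * S n \<omega>\<bar> \<le> 2 / s0 * (\<bar>\<Delta> n \<omega>\<bar> / sqrt (real n) + Ca * L n)"
          by (simp add: mult.commute)
      qed
    qed
    have close: "\<exists>\<eta>. (\<lambda>n. \<eta> n * sqrt (ln (real n))) \<longlonglongrightarrow> 0 \<and>
        (\<forall>\<^sub>F n in sequentially. 0 \<le> \<eta> n \<and> prob {\<omega>\<in>space M. \<bar>Z n \<omega> - \<rho> n * S n \<omega>\<bar> > \<eta> n} \<le> 16 * real n powr (- r))"
      if r: "0 \<le> r" for r
    proof -
      obtain c1 where c1: "0 \<le> c1" "\<forall>\<^sub>F n in sequentially.
          prob {\<omega> \<in> space M. R1 n \<omega> > c1 * (real n * mesh n * L n)} \<le> 8 * real n powr (- r)"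
        using EA1(1)[OF _ r] by blast
      obtain c2 where c2: "0 \<le> c2" "\<forall>\<^sub>F n in sequentially.
          prob {\<omega> \<in> space M. R2 n \<omega> > c2 * (real n * mesh n * L n)} \<le> 8 * real n powr (- r)"
        using EA2(1)[OF _ r] by blast
      \<comment> \<open>Dividing the bounds on \<open>R1\<close> and \<open>R2\<close> by sqrt n
        leaves sqrt(log n) * L, the change of centring adds \<open>Ca * L n\<close>, and 2 / s0
        bounds 1 / b. A further factor sqrt(log n) still gives a null sequence.\<close>
      define \<eta> where "\<eta> n = 2 / s0 * ((c1 + c2) * (sqrt (ln (real n)) * L n) + Ca * L n)" for n
      have "(\<lambda>n. 2 / s0 * ((c1 + c2) * (ln (real n) * L n) + Ca * (sqrt (ln (real n)) * L n))) \<longlonglongrightarrow> 2 / s0 * ((c1 + c2) * 0 + Ca * 0)"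
        by (intro tendsto_intros lnL sqL)
      moreover have "\<forall>\<^sub>F n in sequentially. 2 / s0 * ((c1 + c2) * (ln (real n) * L n) + Ca * (sqrt (ln (real n)) * L n)) = \<eta> n * sqrt (ln (real n))"
        using range
      proof eventually_elim
        case (elim n)
        define l where "l = sqrt (ln (real n))"
        have "ln (real n) = l * l" using elim by (simp add: l_def)
        then show ?case unfolding \<eta>_def l_def[symmetric] by (simp add: algebra_simps)
      qed
      ultimately have lim: "(\<lambda>n. \<eta> n * sqrt (ln (real n))) \<longlonglongrightarrow> 0"
        by (auto intro: Lim_transform_eventually)
      have "\<forall>\<^sub>F n in sequentially. 0 \<le> \<eta> n \<and> prob {\<omega>\<in>space M. \<bar>Z n \<omega> - \<rho> n * S n \<omega>\<bar> > \<eta> n} \<le> 16 * real n powr (- r)"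
        using c1(2) c2(2) diff a C1 C2 range p2
      proof eventually_elim
        case (elim n)
        have n0: "0 < real n" using elim by simp
        have rvR [measurable]: "random_variable borel (R1 n)" "random_variable borel (R2 n)" using elim by auto
        define x where "x = real n * mesh n * L n"
        have x: "x / sqrt (real n) = sqrt (ln (real n)) * L n"
        proof -
          have "real n / sqrt (real n) = sqrt (real n)" by (rule real_div_sqrt) simp
          moreover have "sqrt (real n) * mesh n = sqrt (ln (real n))"
            using n0 by (simp add: mesh_def real_sqrt_divide)
          moreover have "x / sqrt (real n) = real n / sqrt (real n) * mesh n * L n" by (simp add: x_def)
          ultimately show ?thesis by simp
        qed
        have CaL: "0 \<le> Ca * L n" using elim(4) by (rule order_trans[OF abs_ge_zero])
        have k: "1 \<le> k n" "k n \<le> n" and nm: "1 \<le> n - m n" "n - m n \<le> n"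
        proof -
          have "0 < \<alpha> n" using elim a0 by auto
          then show "1 \<le> k n" unfolding \<alpha>_def using n0 by (cases "k n") auto
          show "k n \<le> n" "1 \<le> n - m n" "n - m n \<le> n" using assms(5)[of n] elim by auto
        qed
        have pos: "0 \<le> R1 n \<omega>" "0 \<le> R2 n \<omega>" for \<omega>
          unfolding R1_def R2_def by (rule excess_bounds[OF k] excess_bounds[OF nm])+
        have "prob {\<omega>\<in>space M. \<bar>Z n \<omega> - \<rho> n * S n \<omega>\<bar> > \<eta> n}
            \<le> prob ({\<omega> \<in> space M. R1 n \<omega> > c1 * x} \<union> {\<omega> \<in> space M. R2 n \<omega> > c2 * x})"
        proof (rule finite_measure_mono)
          show "{\<omega>\<in>space M. \<bar>Z n \<omega> - \<rho> n * S n \<omega>\<bar> > \<eta> n}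
              \<subseteq> {\<omega> \<in> space M. R1 n \<omega> > c1 * x} \<union> {\<omega> \<in> space M. R2 n \<omega> > c2 * x}"
          proof
            fix \<omega> assume \<omega>: "\<omega> \<in> {\<omega>\<in>space M. \<bar>Z n \<omega> - \<rho> n * S n \<omega>\<bar> > \<eta> n}"
            show "\<omega> \<in> {\<omega> \<in> space M. R1 n \<omega> > c1 * x} \<union> {\<omega> \<in> space M. R2 n \<omega> > c2 * x}"
            proof (rule ccontr)
              assume "\<omega> \<notin> {\<omega> \<in> space M. R1 n \<omega> > c1 * x} \<union> {\<omega> \<in> space M. R2 n \<omega> > c2 * x}"
              then have "R1 n \<omega> \<le> c1 * x" "R2 n \<omega> \<le> c2 * x" using \<omega> by auto
              then have "\<bar>\<Delta> n \<omega>\<bar> \<le> (c1 + c2) * x"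
                unfolding \<Delta>_def distrib_right using pos[of \<omega>] by auto
              then have "\<bar>\<Delta> n \<omega>\<bar> / sqrt (real n) \<le> (c1 + c2) * x / sqrt (real n)" by (rule divide_right_mono) simp
              also have "\<dots> = (c1 + c2) * (sqrt (ln (real n)) * L n)" unfolding x[symmetric] by simp
              finally have "2 / s0 * (\<bar>\<Delta> n \<omega>\<bar> / sqrt (real n) + Ca * L n) \<le> \<eta> n"
                unfolding \<eta>_def using s0_pos by (intro mult_left_mono add_right_mono) auto
              moreover have "\<bar>Z n \<omega> - \<rho> n * S n \<omega>\<bar> \<le> 2 / s0 * (\<bar>\<Delta> n \<omega>\<bar> / sqrt (real n) + Ca * L n)"
                using elim(3) by blast
              ultimately show False using \<omega> by simp
            qed
          qed
        qed measurable
        also have "\<dots> \<le> prob {\<omega> \<in> space M. R1 n \<omega> > c1 * x} + prob {\<omega> \<in> space M. R2 n \<omega> > c2 * x}"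
          by (intro measure_Un_le) measurable
        also have "\<dots> \<le> 16 * real n powr (- r)" using elim(1,2) unfolding x_def by simp
        finally have "prob {\<omega>\<in>space M. \<bar>Z n \<omega> - \<rho> n * S n \<omega>\<bar> > \<eta> n} \<le> 16 * real n powr (- r)" .
        moreover have "0 \<le> \<eta> n"
        proof -
          have "0 \<le> (c1 + c2) * (sqrt (ln (real n)) * L n)" using c1(1) c2(1) L0[of n] n0 by simp
          then have "0 \<le> (c1 + c2) * (sqrt (ln (real n)) * L n) + Ca * L n" using CaL by (rule add_nonneg_nonneg)
          then show ?thesis unfolding \<eta>_def using s0_pos by (intro mult_nonneg_nonneg) auto
        qed
        ultimately show ?case by blast
      qed
      then show ?thesis using lim by blast
    qed
    have up: "uniform_asymp_equiv (\<lambda>n. {- A..c * sqrt (ln (real n))}) (\<lambda>n x. \<P>(\<omega> in M. Z n \<omega> > x)) (\<lambda>x. 1 - \<Phi> x)"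
      by (rule moderate_deviation_transfer[OF rvZS S_upper \<kappa>0 \<rho> close cA])
    have "uniform_asymp_equiv (\<lambda>n. {- A..c * sqrt (ln (real n))}) (\<lambda>n x. \<P>(\<omega> in M. - Z n \<omega> > x)) (\<lambda>x. 1 - \<Phi> x)"
    proof (rule moderate_deviation_transfer[OF _ S_lower \<kappa>0 \<rho> _ cA])
      show "\<forall>\<^sub>F n in sequentially. random_variable borel (\<lambda>\<omega>. - S n \<omega>) \<and> random_variable borel (\<lambda>\<omega>. - Z n \<omega>)"
        using rvZS by eventually_elim auto
      have flip: "\<bar>- Z n \<omega> - \<rho> n * - S n \<omega>\<bar> = \<bar>Z n \<omega> - \<rho> n * S n \<omega>\<bar>" for n \<omega>
        using abs_minus_commute[of "\<rho> n * S n \<omega>" "Z n \<omega>"] by simp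
      show "\<exists>\<eta>. (\<lambda>n. \<eta> n * sqrt (ln (real n))) \<longlonglongrightarrow> 0 \<and> (\<forall>\<^sub>F n in sequentially. 0 \<le> \<eta> n
          \<and> prob {\<omega>\<in>space M. \<bar>- Z n \<omega> - \<rho> n * - S n \<omega>\<bar> > \<eta> n} \<le> 16 * real n powr (- r))"
        if "0 \<le> r" for r unfolding flip by (rule close[OF that])
    qed
    moreover have "- z > x \<longleftrightarrow> z < - x" for x z :: real by linarith
    ultimately show ?thesis using up unfolding Z_def std_normal_cdf_minus by simp
  qed
  \<comment> \<open>Eventually the ratio of the standard deviations is at least 1/2, which keeps the
    scale away from 0 when it is computed from the variance of \<open>T n\<close>.\<close>
  have smallL: "\<forall>\<^sub>F n in sequentially. C / s0 * L n < 1 / 2"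
  proof -
    have "L \<longlonglongrightarrow> 0" unfolding L_def rate_def using assms(16) by real_asymp
    from tendsto_mult_right_zero[OF this, of "C / s0"] show ?thesis by (rule order_tendstoD(2)) simp
  qed
  have normL: "norm (ln (real n) powr (- (1 + \<epsilon>))) = L n" for n by (simp add: L_def rate_def)
  show ?thesis
  proof (intro conjI ballI allI impI)
    show "\<forall>\<^sub>F n in sequentially. integrable M (T n) \<and> integrable M (\<lambda>\<omega>. (T n \<omega>)\<^sup>2)"
      using TE by eventually_elim blast
    show "(\<lambda>n. sqrt (real n) * (expectation (T n) - \<mu> n)) \<in> O(\<lambda>n. ln (real n) powr (- (1 + \<epsilon>)))"
    proof (rule bigoI[of _ C])
      show "\<forall>\<^sub>F n in sequentially. norm (sqrt (real n) * (expectation (T n) - \<mu> n)) \<le> C * norm (ln (real n) powr (- (1 + \<epsilon>)))"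
        unfolding normL unfolding real_norm_def using TE by (rule eventually_mono) (elim conjE)
    qed
    show "(\<lambda>n. sqrt (variance (T n)) / (\<sigma>W n / sqrt (real n)) - 1) \<in> O(\<lambda>n. ln (real n) powr (- (1 + \<epsilon>)))"
    proof (rule bigoI[of _ "C / s0"])
      show "\<forall>\<^sub>F n in sequentially. norm (sqrt (variance (T n)) / (\<sigma>W n / sqrt (real n)) - 1)
          \<le> C / s0 * norm (ln (real n) powr (- (1 + \<epsilon>)))"
        unfolding normL unfolding real_norm_def using TE by (rule eventually_mono) (elim conjE)
    qed
    fix a b :: "nat \<Rightarrow> real" and c A :: real
    assume a: "a \<in> {\<mu>, \<lambda>n. expectation (T n)}" and b: "b \<in> {\<sigma>W, \<lambda>n. sqrt (real n * variance (T n))}"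
      and cA: "0 < c" "0 < A"
    have a': "\<forall>\<^sub>F n in sequentially. \<bar>sqrt (real n) * (\<mu> n - a n)\<bar> \<le> C * L n"
      using TE
    proof eventually_elim
      case (elim n)
      have "\<bar>sqrt (real n) * (\<mu> n - expectation (T n))\<bar> = \<bar>sqrt (real n) * (expectation (T n) - \<mu> n)\<bar>"
        unfolding abs_mult by (simp only: abs_minus_commute)
      then show ?case using a elim C0 L0[of n] by auto
    qed
    have b': "\<forall>\<^sub>F n in sequentially. s0 / 2 \<le> b n \<and> \<bar>\<sigma>W n / b n - 1\<bar> \<le> 2 * (C / s0) * L n"
      using TE \<sigma>_ge smallL range
    proof eventually_elim
      case (elim n)
      have n0: "0 < real n" and \<sigma>s: "0 < \<sigma>W n" "s0 \<le> \<sigma>W n" using elim s0_pos by auto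
      have CL: "0 \<le> C / s0 * L n" using C0 s0_pos L0[of n] by simp
      define q where "q = sqrt (variance (T n)) / (\<sigma>W n / sqrt (real n))"
      have q1: "\<bar>q - 1\<bar> \<le> C / s0 * L n" unfolding q_def using elim by blast
      have "\<bar>q - 1\<bar> < 1 / 2" using q1 elim by linarith
      then have q: "1 / 2 \<le> q" unfolding abs_less_iff by simp
      have "sqrt (real n * variance (T n)) = q * \<sigma>W n"
        unfolding q_def real_sqrt_mult using \<sigma>s n0 by simp
      moreover have "s0 / 2 \<le> q * \<sigma>W n" using mult_mono[of "1 / 2" q s0 "\<sigma>W n"] q \<sigma>s s0_pos by simp
      moreover have "\<bar>\<sigma>W n / (q * \<sigma>W n) - 1\<bar> \<le> 2 * (C / s0) * L n"
      proof -
        have "\<sigma>W n / (q * \<sigma>W n) - 1 = (1 - q) / q" using \<sigma>s q by (simp add: field_simps)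
        also have "\<bar>(1 - q) / q\<bar> = \<bar>q - 1\<bar> / q" using q by (simp add: abs_minus_commute)
        also have "\<dots> \<le> (C / s0 * L n) / (1 / 2)" using q1 q CL by (intro frac_le) auto
        also have "\<dots> = 2 * (C / s0) * L n" by simp
        finally show ?thesis .
      qed
      moreover have "\<bar>\<sigma>W n / \<sigma>W n - 1\<bar> \<le> 2 * (C / s0) * L n" using \<sigma>s CL by simp
      moreover have "s0 / 2 \<le> \<sigma>W n" using \<sigma>s s0_pos by linarith
      ultimately show ?case using b by auto
    qed
    show "uniform_asymp_equiv (\<lambda>n. {- A..c * sqrt (ln (real n))})
        (\<lambda>n x. \<P>(\<omega> in M. sqrt (real n) * (T n \<omega> - a n) / b n > x)) (\<lambda>x. 1 - \<Phi> x)"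
      by (rule MD[OF a' b' cA, THEN conjunct1])
    show "uniform_asymp_equiv (\<lambda>n. {- A..c * sqrt (ln (real n))})
        (\<lambda>n x. \<P>(\<omega> in M. sqrt (real n) * (T n \<omega> - a n) / b n < - x)) (\<lambda>x. \<Phi> (- x))"
      by (rule MD[OF a' b' cA, THEN conjunct2])
  qed
qed

end
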